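(* Let $\mathcal{X},\mathcal{Y}$ be compact Polish spaces, $d_\mathcal{X}$ a compatible metric on $\mathcal{X}$, $c\in C(\mathcal{X}\times\mathcal{Y})$, and let $w\colon\mathbb{R}_+\to\mathbb{R}_+$ be a concave modulus of continuity with $w(\delta)>0$ for $\delta>0$ and $|c(x,y)-c(x',y)|\le w(d_\mathcal{X}(x,x'))$ for all $x,x'\in\mathcal{X},y\in\mathcal{Y}$. Let $\mu\in\mathcal{P}(\mathcal{X})$, $\nu\in\mathcal{P}(\mathcal{Y})$, let $X_1,\dots,X_n\sim\mu$ i.i.d. and independently $Y_1,\dots,Y_m\sim\nu$ i.i.d., with empirical measures $\mu_n,\nu_m$, and let $c_{n,m}\in C(\mathcal{X}\times\mathcal{Y})$ be random with $c_{n,m}(x,y)$ measurable for every $(x,y)$. Set $\mathcal{F}:=\mathcal{F}(2\|c\|_\infty+1,2w)$. Assume, as $n,m\to\infty$ with $m/(n+m)\to\lambda\in(0,1)$: (A3) $\sqrt{\tfrac{nm}{n+m}}\,(\mu_n-\mu,\ \nu_m-\nu,\ c_{n,m}-c)\rightsquigarrow(\sqrt\lambda\,\mathbb{G}^\mu,\sqrt{1-\lambda}\,\mathbb{G}^\nu,\mathbb{G}^c)$ in $\ell^\infty(\mathcal{F}^{cc})\times\ell^\infty(\mathcal{F}^c)\times C(\mathcal{X}\times\mathcal{Y})$, where $(\mathbb{G}^\mu,\mathbb{G}^\nu,\mathbb{G}^c)$ is tight and $\mathbb{G}^\mu,\mathbb{G}^\nu$ have the covariance structures of a $\mu$-, resp.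 $\nu$-Brownian bridge. Assume moreover either (B1) $\Pi^\star_c(\mu,\nu)$ consists of a single optimal transport plan; or (B2) $\sup_{f\in\mathcal{F}}\sqrt n(\mu_n-\mu)(f^{c_{n,m}c_{n,m}}-f^{cc})\to0$ and $\sup_{f\in\mathcal{F}}\sqrt m(\nu_m-\nu)(f^{c_{n,m}}-f^{c})\to0$ in outer probability. Then, as $n,m\to\infty$ with $m/(n+m)\to\lambda$, $$\sqrt{\tfrac{nm}{n+m}}\big(OT(\mu_n,\nu_m,c_{n,m})-OT(\mu,\nu,c)\big)\rightsquigarrow\inf_{\pi\in\Pi^\star_c(\mu,\nu)}\pi(\mathbb{G}^c)+\sup_{f\in S_c(\mu,\nu)}\sqrt\lambda\,\mathbb{G}^\mu(f^{cc})+\sqrt{1-\lambda}\,\mathbb{G}^\nu(f^c).$$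
   Context: $OT(\mu,\nu,c):=\inf_{\pi\in\Pi(\mu,\nu)}\int c\,d\pi$; $\Pi^\star_c(\mu,\nu)$ its set of minimizers; $\pi(h)=\int h\,d\pi$. $c$-transforms $f^c(y)=\inf_x c(x,y)-f(x)$, $f^{cc}(x)=\inf_y c(x,y)-f^c(y)$; $\mathcal{G}^c,\mathcal{G}^{cc}$ images of a class. $\mathcal{F}(B,w):=\{f\colon\mathcal{X}\to\mathbb{R}:\|f\|_\infty\le2B,\ |f(x)-f(x')|\le w(d_\mathcal{X}(x,x'))\}$. $S_c(\mu,\nu)$ is the (non-empty) set of $f\in\mathcal{F}$ maximizing $\mu(f^{cc})+\nu(f^c)$, whose maximum equals $OT(\mu,\nu,c)$. Measures act on $\ell^\infty(\mathcal{G})$ via $f\mapsto\int f\,d\mu$. Weak convergence $\rightsquigarrow$ is in the Hoffmann-Jørgensen sense; a $\mu$-Brownian bridge is a centered Gaussian process with $\mathrm{Cov}(\mathbb{G}^\mu(f),\mathbb{G}^\mu(g))=\mu(fg)-\mu(f)\mu(g)$. *)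

theory Defs
  imports "HOL-Probability.Probability"
begin

definition ctrans :: "('x \<times> 'y \<Rightarrow> real) \<Rightarrow> ('x \<Rightarrow> real) \<Rightarrow> 'y \<Rightarrow> real" where
  "ctrans c f y = (INF x. c (x, y) - f x)"

definition cctrans :: "('x \<times> 'y \<Rightarrow> real) \<Rightarrow> ('x \<Rightarrow> real) \<Rightarrow> 'x \<Rightarrow> real" where
  "cctrans c f x = (INF y. c (x, y) - ctrans c f y)"

definition Fclass :: "real \<Rightarrow> (real \<Rightarrow> real) \<Rightarrow> ('x::metric_space \<Rightarrow> real) set" where
  "Fclass B w = {f. (\<forall>x. \<bar>f x\<bar> \<le> 2 * B) \<and> (\<forall>x x'. \<bar>f x - f x'\<bar> \<le> w (dist x x'))}"

definition couplings :: "'x::topological_space measure \<Rightarrow> 'y::topological_space measure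
    \<Rightarrow> ('x \<times> 'y) measure set" where
  "couplings \<mu> \<nu> = {\<pi>. prob_space \<pi> \<and> sets \<pi> = sets borel \<and>
      distr \<pi> borel fst = \<mu> \<and> distr \<pi> borel snd = \<nu>}"

definition OT :: "'x::topological_space measure \<Rightarrow> 'y::topological_space measure
    \<Rightarrow> ('x \<times> 'y \<Rightarrow> real) \<Rightarrow> real" where
  "OT \<mu> \<nu> c = (INF \<pi>\<in>couplings \<mu> \<nu>. integral\<^sup>L \<pi> c)"

definition opt_plans :: "'x::topological_space measure \<Rightarrow> 'y::topological_space measure
    \<Rightarrow> ('x \<times> 'y \<Rightarrow> real) \<Rightarrow> ('x \<times> 'y) measure set" where
  "opt_plans \<mu> \<nu> c = {\<pi> \<in> couplings \<mu> \<nu>. integral\<^sup>L \<pi> c = OT \<mu> \<nu> c}"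

definition Sc :: "('x \<Rightarrow> real) set \<Rightarrow> 'x measure \<Rightarrow> 'y measure \<Rightarrow> ('x \<times> 'y \<Rightarrow> real)
    \<Rightarrow> ('x \<Rightarrow> real) set" where
  "Sc F \<mu> \<nu> c = {f \<in> F. \<forall>g \<in> F.
      integral\<^sup>L \<mu> (cctrans c g) + integral\<^sup>L \<nu> (ctrans c g)
        \<le> integral\<^sup>L \<mu> (cctrans c f) + integral\<^sup>L \<nu> (ctrans c f)}"

definition emp_meas :: "nat \<Rightarrow> (nat \<Rightarrow> 'a::topological_space) \<Rightarrow> 'a measure" where
  "emp_meas n x = measure_of UNIV (sets borel)
     (\<lambda>A. ennreal (real (card {i. i < n \<and> x i \<in> A}) / real n))"

definition concave_modulus :: "(real \<Rightarrow> real) \<Rightarrow> bool" where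
  "concave_modulus w \<longleftrightarrow> w 0 = 0 \<and> (\<forall>t\<ge>0. w t \<ge> 0) \<and> mono_on {0..} w \<and>
     concave_on {0..} w \<and> (w \<longlongrightarrow> 0) (at_right 0)"

definition outer_exp :: "'a measure \<Rightarrow> ('a \<Rightarrow> real) \<Rightarrow> real" where
  "outer_exp M f = Inf {integral\<^sup>L M U | U. U \<in> borel_measurable M \<and> integrable M U \<and>
      (\<forall>x\<in>space M. f x \<le> U x)}"

definition outer_prob :: "'a measure \<Rightarrow> 'a set \<Rightarrow> real" where
  "outer_prob M A = Inf {measure M B | B. B \<in> sets M \<and> A \<inter> space M \<subseteq> B}"

definition pm_open :: "('d \<Rightarrow> 'd \<Rightarrow> real) \<Rightarrow> 'd set \<Rightarrow> 'd set \<Rightarrow> bool" where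
  "pm_open dD D U \<longleftrightarrow> U \<subseteq> D \<and> (\<forall>x\<in>U. \<exists>e>0. \<forall>y\<in>D. dD x y < e \<longrightarrow> y \<in> U)"

definition pm_compact :: "('d \<Rightarrow> 'd \<Rightarrow> real) \<Rightarrow> 'd set \<Rightarrow> 'd set \<Rightarrow> bool" where
  "pm_compact dD D K \<longleftrightarrow> K \<subseteq> D \<and> (\<forall>s::nat \<Rightarrow> 'd. (\<forall>k. s k \<in> K) \<longrightarrow>
      (\<exists>r l. strict_mono r \<and> l \<in> K \<and> (\<lambda>k. dD (s (r k)) l) \<longlonglongrightarrow> 0))"

definition pm_cont :: "('d \<Rightarrow> 'd \<Rightarrow> real) \<Rightarrow> 'd set \<Rightarrow> ('d \<Rightarrow> real) \<Rightarrow> bool" where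
  "pm_cont dD D h \<longleftrightarrow> (\<forall>x\<in>D. \<forall>e>0. \<exists>d>0. \<forall>y\<in>D. dD x y < d \<longrightarrow> \<bar>h y - h x\<bar> < e)"

definition borel_into :: "'q measure \<Rightarrow> ('d \<Rightarrow> 'd \<Rightarrow> real) \<Rightarrow> 'd set \<Rightarrow> ('q \<Rightarrow> 'd) \<Rightarrow> bool" where
  "borel_into Q dD D L \<longleftrightarrow> (\<forall>q\<in>space Q. L q \<in> D) \<and>
      (\<forall>U. pm_open dD D U \<longrightarrow> {q \<in> space Q. L q \<in> U} \<in> sets Q)"

definition tight_into :: "'q measure \<Rightarrow> ('d \<Rightarrow> 'd \<Rightarrow> real) \<Rightarrow> 'd set \<Rightarrow> ('q \<Rightarrow> 'd) \<Rightarrow> bool" where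
  "tight_into Q dD D L \<longleftrightarrow> (\<forall>\<epsilon>>0. \<exists>K A. pm_compact dD D K \<and> A \<in> sets Q \<and>
      A \<subseteq> {q \<in> space Q. L q \<in> K} \<and> measure Q A \<ge> 1 - \<epsilon>)"

definition HJ_conv :: "'o measure \<Rightarrow> (nat \<Rightarrow> 'o \<Rightarrow> 'd) \<Rightarrow> ('d \<Rightarrow> 'd \<Rightarrow> real) \<Rightarrow> 'd set
    \<Rightarrow> 'q measure \<Rightarrow> ('q \<Rightarrow> 'd) \<Rightarrow> bool" where
  "HJ_conv P Xs dD D Q L \<longleftrightarrow> (\<forall>k. \<forall>\<omega>\<in>space P. Xs k \<omega> \<in> D) \<and> borel_into Q dD D L \<and>
     (\<forall>h. pm_cont dD D h \<and> (\<exists>B. \<forall>x\<in>D. \<bar>h x\<bar> \<le> B) \<longrightarrow>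
        (\<lambda>k. outer_exp P (\<lambda>\<omega>. h (Xs k \<omega>))) \<longlonglongrightarrow> integral\<^sup>L Q (\<lambda>q. h (L q)))"

definition D3 :: "('x \<Rightarrow> real) set \<Rightarrow> ('y \<Rightarrow> real) set \<Rightarrow>
    ((('x \<Rightarrow> real) \<Rightarrow> real) \<times> (('y \<Rightarrow> real) \<Rightarrow> real) \<times> ('x::topological_space \<times> 'y::topological_space \<Rightarrow> real)) set" where
  "D3 G1 G2 = {(a, b, k). bounded (a ` G1) \<and> bounded (b ` G2) \<and> continuous_on UNIV k}"

definition dist3 :: "('x \<Rightarrow> real) set \<Rightarrow> ('y \<Rightarrow> real) set \<Rightarrow>
    ((('x \<Rightarrow> real) \<Rightarrow> real) \<times> (('y \<Rightarrow> real) \<Rightarrow> real) \<times> ('x \<times> 'y \<Rightarrow> real)) \<Rightarrow>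
    ((('x \<Rightarrow> real) \<Rightarrow> real) \<times> (('y \<Rightarrow> real) \<Rightarrow> real) \<times> ('x \<times> 'y \<Rightarrow> real)) \<Rightarrow> real" where
  "dist3 G1 G2 u v = (case u of (a, b, k) \<Rightarrow> case v of (a', b', k') \<Rightarrow>
     max (SUP g\<in>G1. \<bar>a g - a' g\<bar>) (max (SUP g\<in>G2. \<bar>b g - b' g\<bar>) (SUP p. \<bar>k p - k' p\<bar>)))"

definition bb_cov :: "'q measure \<Rightarrow> ('q \<Rightarrow> ('x \<Rightarrow> real) \<Rightarrow> real) \<Rightarrow> 'x measure
    \<Rightarrow> ('x \<Rightarrow> real) set \<Rightarrow> bool" where
  "bb_cov Q G \<mu> C \<longleftrightarrow> (\<forall>g\<in>C. (\<lambda>q. G q g) \<in> borel_measurable Q \<and> integrable Q (\<lambda>q. (G q g)\<^sup>2)) \<and>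
     (\<forall>g1\<in>C. \<forall>g2\<in>C.
        integral\<^sup>L Q (\<lambda>q. (G q g1 - integral\<^sup>L Q (\<lambda>q'. G q' g1)) * (G q g2 - integral\<^sup>L Q (\<lambda>q'. G q' g2)))
        = integral\<^sup>L \<mu> (\<lambda>x. g1 x * g2 x) - integral\<^sup>L \<mu> g1 * integral\<^sup>L \<mu> g2)"

definition admissible :: "(nat \<Rightarrow> nat) \<Rightarrow> (nat \<Rightarrow> nat) \<Rightarrow> real \<Rightarrow> bool" where
  "admissible N M lam \<longleftrightarrow> filterlim N at_top sequentially \<and> filterlim M at_top sequentially \<and>
     (\<lambda>k. real (M k) / (real (N k) + real (M k))) \<longlonglongrightarrow> lam"

definition rate :: "nat \<Rightarrow> nat \<Rightarrow> real" where
  "rate n m = sqrt (real n * real m / (real n + real m))"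

end

theory Submission
  imports Defs "HOL-Complex_Analysis.Great_Picard" "HOL-Combinatorics.Cycles"
begin

text \<open>
  Write \<open>r\<close> for the rate, \<open>a\<close>, \<open>b\<close>, \<open>h\<close> for the scaled differences of the measures and of the cost,
  and \<open>J f = \<mu>(f^cc) + \<nu>(f^c)\<close>. The scaled error of the optimal value is squeezed between functionals
  of \<open>(a, b, h)\<close> that are Lipschitz uniformly in the sample size, so that weak convergence only has
  to be tested on them.

  Lower bound: any optimal plan of the perturbed problem is nearly optimal for \<open>(\<mu>, \<nu>, c)\<close>, and weak
  duality with a potential in \<open>S_c\<close> gives \<open>sup_(S_c) (a + b)\<close> plus the infimum of \<open>h\<close> over nearly
  optimal plans; by weak compactness the latter tends to the infimum over optimal plans.
  Upper bound under uniqueness: test the perturbed cost with an optimal plan for \<open>c\<close>; it is nearly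
  optimal for \<open>(\<mu>, \<nu>, c)\<close>, and nearly optimal plans cluster at the only optimal one.
  Upper bound under the second condition: after an inf-convolution of the perturbed cost, which
  costs only the oscillation of \<open>h\<close>, its potentials lie in \<open>F\<close>. Replacing \<open>\<mu>_n, \<nu>_m\<close> by \<open>\<mu>, \<nu>\<close> in
  the dual objective leaves the negligible terms of the condition, and the remaining value is at
  most \<open>J f + 3 |h| / r\<close> and at most the optimal value plus \<open>inf_\<pi> \<pi>(h) / r\<close>.

  Both upper bounds contain a supremum over \<open>F\<close> penalised by \<open>r (OT - J f)\<close>. It converges to the
  supremum over \<open>S_c\<close> if the limit is continuous along uniformly convergent potentials. Empirical
  processes are Lipschitz in this sense, and continuity is a closed condition, so the weak limit
  has it almost surely. Strong duality comes from optimal permutations of finite samples and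
  passes to the limit along empirical measures.
\<close>

section \<open>Weak compactness of probability measures on a compact metric space\<close>

text \<open>The obstacle is that the scaled error is not a fixed functional of
  \<open>(a, b, h)\<close>: the rate and the plans change with the sample size, and the triple need
  not be measurable before the limit. The brackets are therefore indexed by an auxiliary
  \<open>j\<close> instead of the sample size. The penalty rate \<open>r\<close> eventually exceeds
  \<open>j\<close>, so it may be weakened to \<open>j\<close>, and a tolerance
  \<open>1 / (j + 1)\<close> replaces the vanishing suboptimality. For fixed \<open>j\<close> the
  sample size tends to infinity; afterwards \<open>j\<close> tends to infinity under the limit law
  alone. The two alternatives of the hypotheses answer one difficulty. Testing with plans bounds the
  error by the supremum of \<open>h\<close> over nearly optimal plans, which tends to the supremum
  over optimal plans and matches the infimum if there is only one. Otherwise the bound has to come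
  from the dual side, where the potential belongs to a random cost without a deterministic modulus.
  Doubling \<open>w\<close> and enlarging the bound to \<open>2 * C + 1\<close> leave the room in
  which such potentials fit after regularization.\<close>

lemma digit_sum_separation:
  fixes A B :: "nat \<Rightarrow> real"
  assumes A: "\<And>j. A j \<in> {0, 1}" and B: "\<And>j. B j \<in> {0, 1}"
    and lt: "\<bar>(\<Sum>j. A j * (1/3)^j) - (\<Sum>j. B j * (1/3)^j)\<bar> < (1/3)^J / 2"
    and "j \<le> J"
  shows "A j = B j"
proof (rule ccontr)
  assume "A j \<noteq> B j"
  define I where "I = (LEAST j. A j \<noteq> B j)"
  have I: "A I \<noteq> B I" "I \<le> J"
    using \<open>A j \<noteq> B j\<close> \<open>j \<le> J\<close> LeastI[of "\<lambda>j. A j \<noteq> B j" j] Least_le[of "\<lambda>j. A j \<noteq> B j" j]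
    unfolding I_def by auto
  have less: "A i = B i" if "i < I" for i
    using not_less_Least[of i "\<lambda>j. A j \<noteq> B j"] that unfolding I_def by auto
  define d where "d j = (A j - B j) * (1/3)^j" for j
  have dle: "\<bar>d j\<bar> \<le> (1/3)^j" for j
  proof -
    have "\<bar>A j - B j\<bar> \<le> 1" using A[of j] B[of j] by auto
    then have "\<bar>A j - B j\<bar> * (1/3)^j \<le> 1 * (1/3::real)^j" by (intro mult_right_mono) auto
    then show ?thesis by (simp add: d_def abs_mult)
  qed
  have geo: "summable (\<lambda>j. (1/3::real)^j)" by (rule summable_geometric) simp
  have sm: "summable (\<lambda>j. E j * (1/3)^j)" if "\<And>j. E j \<in> {0, 1::real}" for E
  proof (rule summable_comparison_test[OF _ geo], intro exI[of _ 0] allI impI)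
    show "norm (E n * (1/3)^n) \<le> (1/3)^n" for n using that[of n] by auto
  qed
  have sd: "summable d"
    by (rule summable_comparison_test[OF _ geo]) (use dle in \<open>auto intro!: exI[of _ 0]\<close>)
  have eq: "(\<Sum>j. A j * (1/3)^j) - (\<Sum>j. B j * (1/3)^j) = (\<Sum>j. d j)"
    using suminf_diff[OF sm[OF A] sm[OF B]] by (simp add: d_def left_diff_distrib)
  have split: "(\<Sum>j. d j) = (\<Sum>j. d (j + Suc I)) + sum d {..<Suc I}"
    by (rule suminf_split_initial_segment[OF sd])
  have "sum d {..<Suc I} = d I"
    using less by (simp add: d_def)
  \<comment> \<open>The digits after the first difference \<open>I\<close> contribute at most half
    of the leading term \<open>3^(-I)\<close>. Base three with digits 0 and 1 leaves this gap; in
    base two the tail could cancel the leading term.\<close>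
  have tail: "\<bar>\<Sum>j. d (j + Suc I)\<bar> \<le> (1/3)^I / 2"
  proof -
    have s1: "summable (\<lambda>j. (1/3::real)^(j + Suc I))"
      using geo by (rule summable_ignore_initial_segment)
    have s2: "summable (\<lambda>j. \<bar>d (j + Suc I)\<bar>)"
    proof (rule summable_comparison_test[OF _ s1], intro exI[of _ 0] allI impI)
      show "norm \<bar>d (n + Suc I)\<bar> \<le> (1/3)^(n + Suc I)" for n using dle[of "n + Suc I"] by simp
    qed
    have "\<bar>\<Sum>j. d (j + Suc I)\<bar> \<le> (\<Sum>j. \<bar>d (j + Suc I)\<bar>)"
      by (rule summable_rabs[OF s2])
    also have "\<dots> \<le> (\<Sum>j. (1/3::real)^(j + Suc I))"
      by (rule suminf_le[OF _ s2 s1]) (rule dle)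
    also have "\<dots> = (1/3)^(Suc I) * (\<Sum>j. (1/3::real)^j)"
      using suminf_mult[OF geo, of "(1/3)^(Suc I)"] by (simp add: power_add mult.commute mult.left_commute)
    also have "(\<Sum>j. (1/3::real)^j) = 3/2"
      by (subst suminf_geometric) auto
    finally show ?thesis by simp
  qed
  have "\<bar>d I\<bar> = (1/3)^I"
    using I(1) A[of I] B[of I] by (auto simp: d_def abs_mult)
  with tail split eq \<open>sum d {..<Suc I} = d I\<close>
  have "(1/3)^I / 2 \<le> \<bar>(\<Sum>j. A j * (1/3)^j) - (\<Sum>j. B j * (1/3)^j)\<bar>"
    by linarith
  moreover have "(1/3::real)^J \<le> (1/3)^I"
    using I(2) by (intro power_decreasing) auto
  ultimately show False using lt by linarith
qed

text \<open>The digits of the code record membership in countably many balls, taken from finite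
  covers of radius \<open>1 / (n + 1)\<close>. The code need not be continuous; what is used is that
  close codes share their leading digits, so their points lie in a common small ball and decoding is
  uniformly continuous.\<close>

lemma ex_separating_real_code:
  assumes cpt: "compact (UNIV :: 'a::metric_space set)"
  shows "\<exists>s :: 'a \<Rightarrow> real. s \<in> borel_measurable borel \<and> range s \<subseteq> {0..3/2} \<and>
    (\<forall>e>0. \<exists>\<delta>>0. \<forall>z z'. \<bar>s z - s z'\<bar> < \<delta> \<longrightarrow> dist z z' < e)"
proof -
  have "\<forall>n. \<exists>k::'a set. finite k \<and> UNIV \<subseteq> (\<Union>x\<in>k. ball x (1 / real (Suc n)))"
  proof
    fix n :: nat
    have "0 < 1 / real (Suc n)" by simp
    from mp[OF spec[OF seq_compact_imp_totally_bounded[OF compact_imp_seq_compact[OF cpt]]] this]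
    show "\<exists>k::'a set. finite k \<and> UNIV \<subseteq> (\<Union>x\<in>k. ball x (1 / real (Suc n)))"
      by (elim exE conjE) (rule exI, rule conjI)
  qed
  then obtain k :: "nat \<Rightarrow> 'a set" where
    k: "\<And>n. finite (k n)" "\<And>n. UNIV \<subseteq> (\<Union>x\<in>k n. ball x (1 / real (Suc n)))"
    unfolding choice_iff by blast
  define BB where "BB = (\<Union>n. (\<lambda>x. ball x (1 / real (Suc n))) ` k n)"
  have cB: "countable BB" unfolding BB_def
    using k(1) by (intro countable_UN countable_image) (auto intro: countable_finite)
  have neB: "BB \<noteq> {}"
    using k(2)[of 0] unfolding BB_def by blast
  define U where "U = from_nat_into BB"
  have rU: "range U = BB" unfolding U_def using neB cB by (rule range_from_nat_into)
  have oU: "open (U j)" for j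
  proof -
    have "U j \<in> BB" using rU by auto
    then show ?thesis by (auto simp: BB_def)
  qed
  define s where "s z = (\<Sum>j. indicator (U j) z * (1/3::real)^j)" for z
  have geo: "summable (\<lambda>j. (1/3::real)^j)" by (rule summable_geometric) simp
  have sm: "summable (\<lambda>j. indicator (U j) z * (1/3::real)^j)" for z
    by (rule summable_comparison_test[OF _ geo]) (auto intro!: exI[of _ 0] simp: indicator_def)
  have "s \<in> borel_measurable borel"
    unfolding s_def using oU by (intro borel_measurable_suminf) (auto intro!: borel_measurable_times borel_measurable_indicator)
  moreover have "0 \<le> s z \<and> s z \<le> 3/2" for z
  proof
    show "0 \<le> s z" unfolding s_def by (rule suminf_nonneg[OF sm]) auto
    have "s z \<le> (\<Sum>j. (1/3::real)^j)" unfolding s_def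
      by (rule suminf_le[OF _ sm geo]) (auto simp: indicator_def)
    also have "\<dots> = 3/2" by (subst suminf_geometric) auto
    finally show "s z \<le> 3/2" .
  qed
  moreover have "\<exists>\<delta>>0. \<forall>z z'. \<bar>s z - s z'\<bar> < \<delta> \<longrightarrow> dist z z' < e" if "e > 0" for e
  proof -
    obtain n where n: "1 / real (Suc n) < e / 2"
      using nat_approx_posE[of "e/2"] \<open>e > 0\<close> half_gt_zero by blast
    have "\<forall>x\<in>k n. \<exists>j. ball x (1 / real (Suc n)) = U j"
    proof
      fix x assume "x \<in> k n"
      then have "ball x (1 / real (Suc n)) \<in> range U" unfolding rU BB_def by blast
      then show "\<exists>j. ball x (1 / real (Suc n)) = U j" by blast
    qed
    then obtain j where j: "\<forall>x\<in>k n. ball x (1 / real (Suc n)) = U (j x)" unfolding bchoice_iff by blast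
    \<comment> \<open>All balls of the n-th cover occur among the digits up to \<open>J\<close>, so
      codes closer than half of \<open>3^(-J)\<close> agree on each of them.\<close>
    define J where "J = Max (insert 0 (j ` k n))"
    have J: "j x \<le> J" if "x \<in> k n" for x
      unfolding J_def using that k(1) by (intro Max_ge) auto
    have "dist z z' < e" if lt: "\<bar>s z - s z'\<bar> < (1/3)^J / 2" for z z'
    proof -
      obtain x where x: "x \<in> k n" "z \<in> ball x (1 / real (Suc n))" using k(2)[of n] by blast
      have "indicator (U (j x)) z = (indicator (U (j x)) z' :: real)"
        by (rule digit_sum_separation[OF _ _ lt[unfolded s_def] J[OF x(1)]]) (auto simp: indicator_def)
      moreover have "z \<in> U (j x)" using x(2) unfolding bspec[OF j x(1)] .
      ultimately have "z' \<in> U (j x)" by (simp add: indicator_def split: if_splits)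
      then have "z' \<in> ball x (1 / real (Suc n))" unfolding bspec[OF j x(1)] .
      with x(2) have "dist z x < e/2" "dist z' x < e/2" using n by (auto simp: dist_commute)
      then show ?thesis using dist_triangle_half_r[of x z e z'] by (simp add: dist_commute)
    qed
    then show ?thesis by (intro exI[of _ "(1/3)^J / 2"]) auto
  qed
  ultimately show ?thesis by (intro exI[of _ s]) auto
qed

lemma integrable_continuous_compact:
  fixes h :: "'a::metric_space \<Rightarrow> real"
  assumes "compact (UNIV :: 'a set)" "finite_measure M" "sets M = sets borel" "continuous_on UNIV h"
  shows "integrable M h"
proof -
  have "compact (range h)" using assms by (intro compact_continuous_image) auto
  then have "bounded (range h)" by (rule compact_imp_bounded)
  then obtain B where "\<And>x. norm (h x) \<le> B" by (auto simp: bounded_iff)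
  moreover have "h \<in> borel_measurable M"
    using borel_measurable_continuous_onI[OF assms(4)] measurable_cong_sets[OF assms(3) refl] by blast
  ultimately show ?thesis
    using assms(2) by (intro finite_measure.integrable_const_bound[of M h B]) auto
qed

text \<open>The space is coded into the reals by a measurable injection whose inverse extends continuously
  to the closure of its range; Helly's selection theorem is applied to the coded measures.\<close>

theorem compact_prob_weak_limit:
  fixes \<rho> :: "nat \<Rightarrow> 'a::metric_space measure"
  assumes cpt: "compact (UNIV :: 'a set)"
    and \<rho>: "\<And>n. prob_space (\<rho> n)" "\<And>n. sets (\<rho> n) = sets borel"
  shows "\<exists>r \<pi>. strict_mono (r :: nat \<Rightarrow> nat) \<and> prob_space \<pi> \<and> sets \<pi> = sets borel \<and>
    (\<forall>h::'a \<Rightarrow> real. continuous_on UNIV h \<longrightarrow>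
       (\<lambda>n. integral\<^sup>L (\<rho> (r n)) h) \<longlonglongrightarrow> integral\<^sup>L \<pi> h)"
proof -
  obtain s :: "'a \<Rightarrow> real" where s: "s \<in> borel_measurable borel" "range s \<subseteq> {0..3/2}"
    and sep: "\<And>e. e > 0 \<Longrightarrow> \<exists>\<delta>>0. \<forall>z z'. \<bar>s z - s z'\<bar> < \<delta> \<longrightarrow> dist z z' < e"
    using ex_separating_real_code[OF cpt] by blast
  define C where "C = closure (range s)"
  have C: "closed C" "C \<noteq> {}" by (auto simp: C_def)
  \<comment> \<open>The decoded value of \<open>t\<close> is a cluster point of preimages of codes
    converging to \<open>t\<close>; it exists because the space is compact.\<close>
  have "\<exists>z. \<forall>e>0. \<exists>z'. \<bar>s z' - t\<bar> < e \<and> dist z' z < e" if "t \<in> C" for t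
  proof -
    have "\<exists>\<tau>. (\<forall>n. \<tau> n \<in> range s) \<and> \<tau> \<longlonglongrightarrow> t"
      using that unfolding C_def closure_sequential .
    then obtain \<tau> where \<tau>: "\<forall>n. \<tau> n \<in> range s" "\<tau> \<longlonglongrightarrow> t" by (elim exE conjE)
    have "\<forall>n. \<exists>z. \<tau> n = s z" using \<tau>(1) by blast
    then obtain \<zeta> where \<zeta>: "\<And>n. \<tau> n = s (\<zeta> n)" by metis
    obtain z r where z: "strict_mono (r :: nat \<Rightarrow> nat)" "(\<zeta> \<circ> r) \<longlonglongrightarrow> z"
      by (rule seq_compactE[OF compact_imp_seq_compact[OF cpt], of \<zeta>]) auto
    have "\<exists>z'. \<bar>s z' - t\<bar> < e \<and> dist z' z < e" if "e > 0" for e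
    proof -
      have "(\<tau> \<circ> r) \<longlonglongrightarrow> t" using \<tau>(2) z(1) by (rule LIMSEQ_subseq_LIMSEQ)
      then have "\<forall>\<^sub>F n in sequentially. dist ((\<tau> \<circ> r) n) t < e" using that by (rule tendstoD)
      moreover have "\<forall>\<^sub>F n in sequentially. dist ((\<zeta> \<circ> r) n) z < e" using z(2) that by (rule tendstoD)
      ultimately have "\<forall>\<^sub>F n in sequentially. dist ((\<tau> \<circ> r) n) t < e \<and> dist ((\<zeta> \<circ> r) n) z < e"
        by (rule eventually_conj)
      then obtain n where "dist ((\<tau> \<circ> r) n) t < e" "dist ((\<zeta> \<circ> r) n) z < e"
        by (auto simp: eventually_sequentially)
      then show ?thesis using \<zeta> by (auto simp: dist_real_def)
    qed
    then show ?thesis by blast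
  qed
  then have "\<forall>t\<in>C. \<exists>z. \<forall>e>0. \<exists>z'. \<bar>s z' - t\<bar> < e \<and> dist z' z < e" by blast
  then obtain q where q: "\<And>t e. t \<in> C \<Longrightarrow> e > 0 \<Longrightarrow> \<exists>z'. \<bar>s z' - t\<bar> < e \<and> dist z' (q t) < e"
    unfolding bchoice_iff by blast
  have qcont: "continuous_on C q"
    unfolding continuous_on_iff
  proof (intro ballI allI impI)
    fix t e :: real assume t: "t \<in> C" and "0 < e"
    then obtain \<delta> where \<delta>: "\<delta> > 0" "\<And>z z'. \<bar>s z - s z'\<bar> < \<delta> \<Longrightarrow> dist z z' < e/3"
      using sep[of "e/3"] by auto
    have "dist (q t') (q t) < e" if t': "t' \<in> C" "dist t' t < \<delta>/3" for t'
    proof -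
      obtain z where z: "\<bar>s z - t\<bar> < min (\<delta>/3) (e/3)" "dist z (q t) < min (\<delta>/3) (e/3)"
        using q[OF t, of "min (\<delta>/3) (e/3)"] \<delta>(1) \<open>0 < e\<close> by auto
      obtain z' where z': "\<bar>s z' - t'\<bar> < min (\<delta>/3) (e/3)" "dist z' (q t') < min (\<delta>/3) (e/3)"
        using q[OF t'(1), of "min (\<delta>/3) (e/3)"] \<delta>(1) \<open>0 < e\<close> by auto
      have "\<bar>s z' - s z\<bar> < \<delta>" using z(1) z'(1) t'(2) unfolding dist_real_def by linarith
      then have "dist z' z < e/3" by (rule \<delta>(2))
      moreover have "dist (q t') (q t) \<le> dist z' (q t') + dist z' z + dist z (q t)"
        using dist_triangle3[of "q t'" "q t" z'] dist_triangle[of z' "q t" z] by linarith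
      ultimately show ?thesis using z(2) z'(2) by linarith
    qed
    then show "\<exists>d>0. \<forall>x'\<in>C. dist x' t < d \<longrightarrow> dist (q x') (q t) < e"
      using \<delta>(1) by (intro exI[of _ "\<delta>/3"]) auto
  qed
  have qs: "q (s z) = z" for z
  proof (rule ccontr)
    assume "q (s z) \<noteq> z"
    define e where "e = dist z (q (s z)) / 2"
    have e: "e > 0" using \<open>q (s z) \<noteq> z\<close> by (simp add: e_def)
    obtain \<delta> where \<delta>: "\<delta> > 0" "\<And>z z'. \<bar>s z - s z'\<bar> < \<delta> \<Longrightarrow> dist z z' < e" using sep[OF e] by auto
    have "s z \<in> C" unfolding C_def by (rule subsetD[OF closure_subset]) auto
    then obtain z' where "\<bar>s z' - s z\<bar> < min \<delta> e" "dist z' (q (s z)) < min \<delta> e"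
      using q[of "s z" "min \<delta> e"] \<delta>(1) e by auto
    then have "dist z' z < e" "dist z' (q (s z)) < e" using \<delta>(2) by auto
    then have "dist z (q (s z)) < 2 * e" using dist_triangle3[of z "q (s z)" z'] by linarith
    then show False by (simp add: e_def)
  qed
  define \<sigma> where "\<sigma> n = distr (\<rho> n) borel s" for n
  have sm: "s \<in> borel_measurable (\<rho> n)" for n
    using s(1) measurable_cong_sets[OF \<rho>(2) refl] by blast
  have rd: "real_distribution (\<sigma> n)" for n
    unfolding \<sigma>_def using \<rho>(1) sm
    by (intro real_distribution.intro prob_space.prob_space_distr) (auto simp: real_distribution_axioms_def)
  have "tight \<sigma>"
    unfolding tight_def
  proof (intro conjI allI impI)
    fix n show "real_distribution (\<sigma> n)" by (rule rd)
  next
    fix \<epsilon> :: real assume "0 < \<epsilon>"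
    \<comment> \<open>The interval is open on the left, so it has to start below the least possible
      code 0.\<close>
    have "measure (\<sigma> n) {-1<..2} = 1" for n
    proof -
      have "s -` {-1<..2} \<inter> space (\<rho> n) = space (\<rho> n)"
      proof -
        have "s z \<in> {-1<..2}" for z
        proof -
          have "s z \<in> {0..3/2}" using s(2) by blast
          then show ?thesis by simp
        qed
        then show ?thesis by auto
      qed
      then show ?thesis unfolding \<sigma>_def using sm[of n] prob_space.prob_space[OF \<rho>(1)]
        by (subst measure_distr) auto
    qed
    then show "\<exists>a b. a < b \<and> (\<forall>n. 1 - \<epsilon> < measure (\<sigma> n) {a<..b})"
      using \<open>0 < \<epsilon>\<close> by (intro exI[of _ "-1"] exI[of _ 2]) auto
  qed
  then obtain r M where r: "strict_mono (r :: nat \<Rightarrow> nat)" and M: "real_distribution M"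
    and wc: "weak_conv_m (\<sigma> \<circ> id \<circ> r) M"
    using tight_imp_convergent_subsubsequence[of \<sigma> id] strict_mono_id by blast
  interpret M: real_distribution M by fact
  have conv: "(\<lambda>n. integral\<^sup>L (\<sigma> (r n)) g) \<longlonglongrightarrow> integral\<^sup>L M g"
    if "continuous_on UNIV g" "\<And>x. norm (g x) \<le> B" for g :: "real \<Rightarrow> real" and B
  proof -
    have "\<And>x. isCont g x" using that(1) by (simp add: continuous_on_eq_continuous_at)
    then have "(\<lambda>n. integral\<^sup>L ((\<sigma> \<circ> id \<circ> r) n) g) \<longlonglongrightarrow> integral\<^sup>L M g"
      using rd M wc that(2)
      by (intro weak_conv_imp_integral_bdd_continuous_conv[where B=B and M=M]) (auto simp: o_def)
    then show ?thesis by simp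
  qed
  have int\<sigma>: "integral\<^sup>L (\<sigma> n) g = integral\<^sup>L (\<rho> n) (\<lambda>z. g (s z))"
    if "continuous_on UNIV g" for n and g :: "real \<Rightarrow> real"
    unfolding \<sigma>_def using sm that by (intro integral_distr) (auto intro: borel_measurable_continuous_onI)
  \<comment> \<open>The truncated distance to \<open>C\<close> integrates to zero under every coded
    measure, hence under the limit.\<close>
  have AEC: "AE t in M. t \<in> C"
  proof -
    define g where "g t = min 1 (infdist t C)" for t
    have gc: "continuous_on UNIV g" unfolding g_def by (intro continuous_intros)
    have gb: "norm (g t) \<le> 1" "0 \<le> g t" for t by (auto simp: g_def infdist_nonneg)
    have "g (s z) = 0" for z
    proof -
      have "s z \<in> C" unfolding C_def by (rule subsetD[OF closure_subset]) auto
      then show ?thesis by (simp add: g_def)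
    qed
    then have "integral\<^sup>L M g = 0"
      using conv[OF gc gb(1)] int\<sigma>[OF gc] by (simp add: LIMSEQ_const_iff)
    moreover have "integrable M g"
      using gb borel_measurable_continuous_onI[OF gc] by (intro M.integrable_const_bound[of _ 1]) auto
    ultimately have "AE t in M. g t = 0"
      using gb by (subst (asm) integral_nonneg_eq_0_iff_AE) auto
    then show ?thesis
      by eventually_elim
        (use in_closed_iff_infdist_zero[OF C] in \<open>auto simp: g_def min_def split: if_splits\<close>)
  qed
  obtain z0 :: 'a where True by blast
  \<comment> \<open>The value off \<open>C\<close> is arbitrary, since the limit measure does not
    charge that set.\<close>
  define q' where "q' t = (if t \<in> C then q t else z0)" for t
  have q'm: "q' \<in> borel_measurable borel"
  proof -
    have 1: "q \<in> borel_measurable (restrict_space borel C)"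
      using qcont by (rule borel_measurable_continuous_on_restrict)
    have "C \<in> sets borel" using C(1) by auto
    then show ?thesis unfolding q'_def
      using 1 by (intro measurable_If_restrict_space_iff[THEN iffD2]) auto
  qed
  define \<pi> where "\<pi> = distr M borel q'"
  have q'M: "q' \<in> measurable M borel" using q'm by simp
  have "prob_space \<pi>" unfolding \<pi>_def using q'M by (rule M.prob_space_distr)
  moreover have "sets \<pi> = sets borel" by (simp add: \<pi>_def)
  moreover have "(\<lambda>n. integral\<^sup>L (\<rho> (r n)) h) \<longlonglongrightarrow> integral\<^sup>L \<pi> h"
    if h: "continuous_on UNIV h" for h :: "'a \<Rightarrow> real"
  proof -
    have "compact (range h)" using cpt h by (intro compact_continuous_image) auto
    then have "bounded (range h)" by (rule compact_imp_bounded)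
    then obtain B where "\<And>x. norm (h x) \<le> B" by (auto simp: bounded_iff)
    then have B: "\<And>x. norm (h x) \<le> B" "0 \<le> B" using norm_ge_zero order_trans by blast+
    have "continuous_on C (\<lambda>t. h (q t))"
      using qcont h by (auto intro: continuous_on_compose2)
    moreover have "closedin (top_of_set UNIV) C" using C by simp
    \<comment> \<open>Decoding turns \<open>h\<close> into a continuous function on \<open>C\<close>
      only. Its Tietze extension to the line keeps the bound \<open>B\<close> and can be tested
      against the Helly limit.\<close>
    ultimately obtain g where g: "continuous_on UNIV g" "\<And>x. x \<in> C \<Longrightarrow> g x = h (q x)"
        "\<And>x. x \<in> UNIV \<Longrightarrow> norm (g x) \<le> B"
      by (rule Tietze[where B=B and f="\<lambda>t. h (q t)", OF _ _ B(2) B(1)]) blast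
    have "g (s z) = h z" for z
    proof -
      have "s z \<in> C" unfolding C_def by (rule subsetD[OF closure_subset]) auto
      then show ?thesis using g(2) qs by simp
    qed
    then have "integral\<^sup>L (\<sigma> n) g = integral\<^sup>L (\<rho> n) h" for n using int\<sigma>[OF g(1)] by simp
    moreover have "integral\<^sup>L \<pi> h = integral\<^sup>L M g"
    proof -
      have "integral\<^sup>L \<pi> h = integral\<^sup>L M (\<lambda>t. h (q' t))"
        unfolding \<pi>_def using q'M h by (intro integral_distr borel_measurable_continuous_onI)
      also have "\<dots> = integral\<^sup>L M g"
      proof (rule integral_cong_AE)
        show "(\<lambda>t. h (q' t)) \<in> borel_measurable M"
          using q'M borel_measurable_continuous_onI[OF h] by (rule measurable_compose)
        show "g \<in> borel_measurable M" using borel_measurable_continuous_onI[OF g(1)] by simp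
        show "AE t in M. h (q' t) = g t" using AEC by eventually_elim (simp add: q'_def g(2))
      qed
      finally show ?thesis .
    qed
    ultimately show ?thesis using conv[OF g(1,3)] by simp
  qed
  ultimately show ?thesis using r by (intro exI[of _ r] exI[of _ \<pi>]) auto
qed

section \<open>Uniformly equicontinuous classes and cost transforms\<close>

text \<open>Closed sets form an intersection-stable generator, and their indicators are limits of
  the tent functions \<open>g n\<close>. Division by \<open>n + 1\<close> makes a tent 1-Lipschitz.
  As \<open>Fclass\<close> doubles its first argument, \<open>Fclass (1/2) (\<lambda>t. t)\<close>
  consists of the 1-Lipschitz functions bounded by 1.\<close>

lemma measure_eqI_bounded_Lipschitz:
  fixes M N :: "'a::metric_space measure"
  assumes M: "prob_space M" "sets M = sets borel" and N: "prob_space N" "sets N = sets borel"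
    and eq: "\<And>g. g \<in> Fclass (1/2) (\<lambda>t. t) \<Longrightarrow> integral\<^sup>L M g = integral\<^sup>L N g"
  shows "M = N"
proof -
  interpret M: prob_space M by fact
  interpret N: prob_space N by fact
  have meq: "measure M S = measure N S" if S: "closed S" "S \<noteq> {}" for S :: "'a set"
  proof -
    define g where "g n x = max 0 (1 - real (Suc n) * infdist x S)" for n x
    have gcl: "(\<lambda>x. g n x / real (Suc n)) \<in> Fclass (1/2) (\<lambda>t. t)" for n
    proof -
      have 1: "\<bar>g n x / real (Suc n)\<bar> \<le> 1" for x
      proof -
        have "0 \<le> g n x" "g n x \<le> 1" by (auto simp: g_def infdist_nonneg)
        moreover have "1 \<le> real (Suc n)" by simp
        ultimately show ?thesis by (simp add: divide_le_eq)
      qed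
      have 2: "\<bar>g n x / real (Suc n) - g n x' / real (Suc n)\<bar> \<le> dist x x'" for x x'
      proof -
        have "\<bar>infdist x S - infdist x' S\<bar> \<le> dist x x'"
          using infdist_triangle[of x S x'] infdist_triangle[of x' S x] by (simp add: dist_commute)
        then have "real (Suc n) * \<bar>infdist x S - infdist x' S\<bar> \<le> real (Suc n) * dist x x'"
          by (intro mult_left_mono) auto
        then have "\<bar>real (Suc n) * infdist x S - real (Suc n) * infdist x' S\<bar> \<le> real (Suc n) * dist x x'"
          by (simp add: abs_mult flip: right_diff_distrib)
        then have "\<bar>g n x - g n x'\<bar> \<le> real (Suc n) * dist x x'"
          unfolding g_def by linarith
        then have "\<bar>(g n x - g n x') / real (Suc n)\<bar> \<le> dist x x'"
          by (simp add: divide_le_eq mult.commute)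
        then show ?thesis by (simp add: diff_divide_distrib)
      qed
      show ?thesis unfolding Fclass_def using 1 2 by simp
    qed
    have gm: "g n \<in> borel_measurable borel" for n
      unfolding g_def by (intro borel_measurable_continuous_onI continuous_intros)
    have lim: "(\<lambda>n. g n x) \<longlonglongrightarrow> indicator S x" for x
    proof (cases "x \<in> S")
      case True then show ?thesis by (simp add: g_def)
    next
      case False
      then have pos: "infdist x S > 0" using in_closed_iff_infdist_zero[OF S] infdist_nonneg[of x S]
        by (metis less_eq_real_def)
      obtain n0 :: nat where n0: "1 / infdist x S < real n0" using reals_Archimedean2 by blast
      have "g n x = 0" if "n \<ge> n0" for n
      proof -
        have "1 < real n0 * infdist x S" using n0 pos by (simp add: divide_less_eq)
        also have "\<dots> \<le> real (Suc n) * infdist x S" using that pos by (intro mult_right_mono) auto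
        finally show ?thesis by (simp add: g_def)
      qed
      then have "eventually (\<lambda>n. g n x = indicator S x) sequentially"
        using False by (auto simp: eventually_sequentially)
      then show ?thesis by (rule tendsto_eventually)
    qed
    have "(\<lambda>n. integral\<^sup>L L (g n)) \<longlonglongrightarrow> measure L S"
      if "prob_space L" "sets L = sets borel" for L
    proof -
      interpret L: prob_space L by fact
      have mc: "borel_measurable L = (borel_measurable borel :: ('a \<Rightarrow> real) set)" using that(2) by (rule measurable_cong_sets) simp
      have SL: "S \<in> sets L" using S(1) that(2) by auto
      have "(\<lambda>n. integral\<^sup>L L (g n)) \<longlonglongrightarrow> integral\<^sup>L L (indicator S)"
      proof (rule integral_dominated_convergence[where w="\<lambda>_. 1"])
        show "indicator S \<in> borel_measurable L" using SL by simp
        show "g n \<in> borel_measurable L" for n using gm mc by simp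
        show "AE x in L. (\<lambda>n. g n x) \<longlonglongrightarrow> indicator S x" using lim by simp
        show "AE x in L. norm (g n x) \<le> 1" for n by (simp add: g_def infdist_nonneg)
      qed simp
      then show ?thesis using SL by simp
    qed
    note L = this
    have "integral\<^sup>L M (g n) = integral\<^sup>L N (g n)" for n
      using eq[OF gcl[of n]] by simp
    then show ?thesis using LIMSEQ_unique[OF L[OF M]] L[OF N] by simp
  qed
  show ?thesis
  proof (rule measure_eqI_generator_eq[where \<Omega>=UNIV and E="Collect closed" and A="\<lambda>_. UNIV"])
    show "Int_stable (Collect closed :: 'a set set)" by (auto simp: Int_stable_def)
    show "sets M = sigma_sets UNIV (Collect closed)" "sets N = sigma_sets UNIV (Collect closed)"
      using M(2) N(2) by (simp_all add: borel_eq_closed)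
    show "emeasure M X = emeasure N X" if "X \<in> Collect closed" for X
      using meq[of X] that by (cases "X = {}") (auto simp: M.emeasure_eq_measure N.emeasure_eq_measure)
  qed auto
qed

lemma totally_bounded_net:
  assumes "compact (UNIV :: 'a::metric_space set)" "0 < e"
  shows "\<exists>k::'a set. finite k \<and> (\<forall>z. \<exists>x\<in>k. dist x z < e)"
proof -
  from mp[OF spec[OF seq_compact_imp_totally_bounded[OF compact_imp_seq_compact[OF assms(1)]]] assms(2)]
  obtain k :: "'a set" where "finite k" "UNIV \<subseteq> (\<Union>x\<in>k. ball x e)" by (elim exE conjE)
  then show ?thesis by (intro exI[of _ k]) (auto simp: subset_iff)
qed

lemma Fclass_modulus_small:
  assumes "(w \<longlongrightarrow> 0) (at_right (0::real))" "0 < e"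
  obtains d where "0 < d" "\<And>(f :: 'a::metric_space \<Rightarrow> real) x x' B. f \<in> Fclass B w \<Longrightarrow> dist x x' < d \<Longrightarrow> \<bar>f x - f x'\<bar> < (e::real)"
proof -
  have "eventually (\<lambda>t. dist (w t) 0 < e) (at_right 0)" using assms by (rule tendstoD)
  then obtain d where d: "d > 0" "\<And>t. 0 < t \<Longrightarrow> t < d \<Longrightarrow> dist (w t) 0 < e"
    unfolding eventually_at_right_field by auto
  show ?thesis
  proof (rule that[OF d(1)])
    fix f :: "'a \<Rightarrow> real" and x x' :: 'a and B assume f: "f \<in> Fclass B w" and lt: "dist x x' < d"
    show "\<bar>f x - f x'\<bar> < e"
    \<comment> \<open>The limit at the right of 0 gives no information about
      \<open>w 0\<close>.\<close>
    proof (cases "x = x'")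
      case False
      then have "dist (w (dist x x')) 0 < e" using lt by (intro d(2)) auto
      moreover have "\<bar>f x - f x'\<bar> \<le> w (dist x x')" using f by (simp add: Fclass_def)
      ultimately show ?thesis by simp
    qed (use assms in simp)
  qed
qed

lemma Fclass_continuous:
  assumes "(w \<longlongrightarrow> 0) (at_right 0)" "f \<in> Fclass B w"
  shows "continuous_on UNIV f"
  unfolding continuous_on_iff
proof (intro ballI allI impI)
  fix x :: 'a and e :: real assume "0 < e"
  obtain d where "0 < d" "\<And>x x'. dist x x' < d \<Longrightarrow> \<bar>f x - f x'\<bar> < e"
    by (rule Fclass_modulus_small[OF assms(1) \<open>0 < e\<close>]) (use assms(2) in blast)
  then show "\<exists>d>0. \<forall>x'\<in>UNIV. dist x' x < d \<longrightarrow> dist (f x') (f x) < e"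
    by (auto simp: dist_real_def)
qed

text \<open>Arzela-Ascoli: a diagonal subsequence converges on a countable union of finite nets, and
  the common modulus makes it uniformly Cauchy.\<close>

lemma Fclass_convergent_subseq:
  fixes f :: "nat \<Rightarrow> 'a::metric_space \<Rightarrow> real"
  assumes cpt: "compact (UNIV :: 'a set)" and w: "(w \<longlongrightarrow> 0) (at_right 0)"
    and f: "\<And>n. f n \<in> Fclass B w"
  obtains r g where "strict_mono (r :: nat \<Rightarrow> nat)" "g \<in> Fclass B w"
    "uniform_limit UNIV (\<lambda>n. f (r n)) g sequentially"
proof -
  have "\<forall>m. \<exists>k::'a set. finite k \<and> (\<forall>z. \<exists>x\<in>k. dist x z < 1 / real (Suc m))"
    using totally_bounded_net[OF cpt] by simp
  then obtain k :: "nat \<Rightarrow> 'a set" where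
    k: "\<And>m. finite (k m)" "\<And>m z. \<exists>x\<in>k m. dist x z < 1 / real (Suc m)"
    unfolding choice_iff by blast
  have fb: "norm (f n x) \<le> 2 * B" for n x using f[of n] by (simp add: Fclass_def)
  have "countable (\<Union>m. k m)" using k(1) by (intro countable_UN) (auto intro: countable_finite)
  then obtain r where r: "strict_mono (r :: nat \<Rightarrow> nat)"
    and rl: "\<And>x. x \<in> (\<Union>m. k m) \<Longrightarrow> \<exists>l. (\<lambda>n. f (r n) x) \<longlonglongrightarrow> l"
    using function_convergent_subsequence[of "\<Union>m. k m" f "2*B"] fb by blast
  have "uniformly_Cauchy_on UNIV (\<lambda>n. f (r n))"
    unfolding uniformly_Cauchy_on_def
  proof (intro allI impI)
    fix e :: real assume "0 < e"
    then have "0 < e / 3" by simp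
    obtain d where d: "0 < d" "\<And>n x x'. dist x x' < d \<Longrightarrow> \<bar>f n x - f n x'\<bar> < e / 3"
      by (rule Fclass_modulus_small[OF w \<open>0 < e / 3\<close>]) (use f in blast)
    obtain m where m: "1 / real (Suc m) < d" using nat_approx_posE[OF d(1)] by blast
    have "\<exists>N. \<forall>p\<ge>N. \<forall>q\<ge>N. dist (f (r p) x) (f (r q) x) < e / 3" if "x \<in> k m" for x
    proof -
      have "Cauchy (\<lambda>n. f (r n) x)" using rl[of x] that by (auto intro: LIMSEQ_imp_Cauchy)
      then show ?thesis using \<open>0 < e / 3\<close> by (rule metric_CauchyD)
    qed
    then have "\<forall>x\<in>k m. \<exists>N. \<forall>p\<ge>N. \<forall>q\<ge>N. dist (f (r p) x) (f (r q) x) < e / 3" by simp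
    then obtain N where N: "\<forall>x\<in>k m. \<forall>p\<ge>N x. \<forall>q\<ge>N x. dist (f (r p) x) (f (r q) x) < e / 3"
      unfolding bchoice_iff by (elim exE)
    define N' where "N' = Max (insert 0 (N ` k m))"
    have N': "N x \<le> N'" if "x \<in> k m" for x unfolding N'_def using that k(1) by (intro Max_ge) auto
    have "dist (f (r p) x) (f (r q) x) < e" if "p \<ge> N'" "q \<ge> N'" for p q x
    proof -
      obtain y where y: "y \<in> k m" "dist y x < d" using k(2)[of m x] m by force
      have "dist (f (r p) y) (f (r q) y) < e / 3" using N y(1) N'[OF y(1)] that order_trans by blast
      moreover have "\<bar>f (r p) y - f (r p) x\<bar> < e / 3" "\<bar>f (r q) y - f (r q) x\<bar> < e / 3"
        using d(2) y(2) by auto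
      ultimately show ?thesis unfolding dist_real_def by linarith
    qed
    then show "\<exists>M. \<forall>x\<in>UNIV. \<forall>m\<ge>M. \<forall>n\<ge>M. dist (f (r m) x) (f (r n) x) < e" by blast
  qed
  then have "uniformly_convergent_on UNIV (\<lambda>n. f (r n))"
    by (rule Cauchy_uniformly_convergent)
  then obtain g where g: "uniform_limit UNIV (\<lambda>n. f (r n)) g sequentially"
    unfolding uniformly_convergent_on_def by blast
  have pt: "(\<lambda>n. f (r n) x) \<longlonglongrightarrow> g x" for x using tendsto_uniform_limitI[OF g] by simp
  have "g \<in> Fclass B w"
    unfolding Fclass_def
  proof (intro CollectI conjI allI)
    fix x x'
    show "\<bar>g x\<bar> \<le> 2 * B"
      using fb by (intro LIMSEQ_le_const2[OF tendsto_rabs[OF pt]]) auto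
    have "\<bar>f (r n) x - f (r n) x'\<bar> \<le> w (dist x x')" for n using f[of "r n"] by (simp add: Fclass_def)
    then show "\<bar>g x - g x'\<bar> \<le> w (dist x x')"
      by (intro LIMSEQ_le_const2[OF tendsto_rabs[OF tendsto_diff[OF pt pt]]]) auto
  qed
  with r g that show ?thesis by blast
qed

text \<open>Without a finite net, a recursive choice would give a sequence in the class whose
  members are pairwise at least \<open>e\<close> apart in the supremum norm, so that no subsequence
  could converge uniformly.\<close>

lemma Fclass_finite_net:
  fixes w :: "real \<Rightarrow> real"
  assumes cpt: "compact (UNIV :: 'a::metric_space set)" and w: "(w \<longlongrightarrow> 0) (at_right 0)" and e: "0 < e"
  shows "\<exists>T \<subseteq> (Fclass B w :: ('a \<Rightarrow> real) set). finite T \<and> (\<forall>f\<in>Fclass B w. \<exists>g\<in>T. \<forall>x. \<bar>f x - g x\<bar> < e)"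
proof (rule ccontr)
  assume no: "\<not> ?thesis"
  let ?F = "Fclass B w :: ('a \<Rightarrow> real) set"
  let ?Q = "\<lambda>(x :: nat \<Rightarrow> 'a \<Rightarrow> real) n r. r \<in> ?F \<and> (\<forall>m<n. \<not> (\<forall>z. \<bar>r z - x m z\<bar> < e))"
  have "\<exists>x. \<forall>n::nat. ?Q x n (x n)"
  proof (rule dependent_wellorder_choice)
    fix n x assume "\<And>y. y < n \<Longrightarrow> ?Q x y (x y)"
    then have "x ` {0..<n} \<subseteq> ?F" by auto
    with no have "\<not> (\<forall>f\<in>?F. \<exists>g\<in>x ` {0..<n}. \<forall>z. \<bar>f z - g z\<bar> < e)" by blast
    then obtain r where "r \<in> ?F" "\<forall>g\<in>x ` {0..<n}. \<not> (\<forall>z. \<bar>r z - g z\<bar> < e)" by blast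
    then show "\<exists>r. ?Q x n r" by (intro exI[of _ r]) auto
  qed simp
  then obtain x :: "nat \<Rightarrow> 'a \<Rightarrow> real" where "\<forall>n. ?Q x n (x n)" by (elim exE)
  then have x: "\<And>n. x n \<in> ?F" "\<And>m n. m < n \<Longrightarrow> \<not> (\<forall>z. \<bar>x n z - x m z\<bar> < e)" by simp_all
  obtain r g where r: "strict_mono (r :: nat \<Rightarrow> nat)"
    and g: "uniform_limit UNIV (\<lambda>n. x (r n)) g sequentially"
    by (rule Fclass_convergent_subseq[of w x B, OF cpt w x(1)])
  have "\<forall>\<^sub>F n in sequentially. \<forall>z\<in>UNIV. dist (x (r n) z) (g z) < e / 2"
    using uniform_limitD[OF g, of "e/2"] e by simp
  then obtain N where N: "\<And>n z. n \<ge> N \<Longrightarrow> dist (x (r n) z) (g z) < e / 2"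
    by (auto simp: eventually_sequentially)
  have "\<bar>x (r (Suc N)) z - x (r N) z\<bar> < e" for z
    using N[of N z] N[of "Suc N" z] unfolding dist_real_def by linarith
  moreover have "r N < r (Suc N)" using r by (simp add: strict_mono_Suc_iff)
  ultimately show False using x(2) by blast
qed

section \<open>Stability of infima, suprema and cost transforms\<close>

lemma abs_cINF_diff_le:
  fixes u v :: "'i \<Rightarrow> real"
  assumes "A \<noteq> {}" "bdd_below (u ` A)" "bdd_below (v ` A)" "\<And>i. i \<in> A \<Longrightarrow> \<bar>u i - v i\<bar> \<le> e"
  shows "\<bar>(INF i\<in>A. u i) - (INF i\<in>A. v i)\<bar> \<le> e"
proof -
  have "(INF i\<in>A. u i) - e \<le> (INF i\<in>A. v i)"
  proof (rule cINF_greatest[OF assms(1)])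
    fix i assume "i \<in> A"
    with assms(4)[OF this] cINF_lower[OF assms(2) this] show "(INF i\<in>A. u i) - e \<le> v i" by linarith
  qed
  moreover have "(INF i\<in>A. v i) - e \<le> (INF i\<in>A. u i)"
  proof (rule cINF_greatest[OF assms(1)])
    fix i assume "i \<in> A"
    with assms(4)[OF this] cINF_lower[OF assms(3) this] show "(INF i\<in>A. v i) - e \<le> u i" by linarith
  qed
  ultimately show ?thesis by linarith
qed

lemma abs_cSUP_diff_le:
  fixes u v :: "'i \<Rightarrow> real"
  assumes "A \<noteq> {}" "bdd_above (u ` A)" "bdd_above (v ` A)" "\<And>i. i \<in> A \<Longrightarrow> \<bar>u i - v i\<bar> \<le> e"
  shows "\<bar>(SUP i\<in>A. u i) - (SUP i\<in>A. v i)\<bar> \<le> e"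
proof -
  have "(SUP i\<in>A. u i) \<le> (SUP i\<in>A. v i) + e"
  proof (rule cSUP_least[OF assms(1)])
    fix i assume "i \<in> A"
    with assms(4)[OF this] cSUP_upper[OF this assms(3)] show "u i \<le> (SUP i\<in>A. v i) + e" by linarith
  qed
  moreover have "(SUP i\<in>A. v i) \<le> (SUP i\<in>A. u i) + e"
  proof (rule cSUP_least[OF assms(1)])
    fix i assume "i \<in> A"
    with assms(4)[OF this] cSUP_upper[OF this assms(2)] show "v i \<le> (SUP i\<in>A. u i) + e" by linarith
  qed
  ultimately show ?thesis by linarith
qed

lemma bdd_below_ctrans:
  fixes c :: "'x \<times> 'y \<Rightarrow> real"
  assumes "\<forall>p. \<bar>c p\<bar> \<le> C" "\<forall>x. \<bar>f x\<bar> \<le> D"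
  shows "bdd_below (range (\<lambda>x. c (x, y) - f x))"
proof (rule bdd_belowI2[where m="- C - D"])
  fix x show "- C - D \<le> c (x, y) - f x" using assms(1)[rule_format, of "(x,y)"] assms(2)[rule_format, of x] by linarith
qed

lemma ctrans_le:
  assumes "\<forall>p. \<bar>c p\<bar> \<le> C" "\<forall>x. \<bar>f x\<bar> \<le> D"
  shows "ctrans c f y \<le> c (x, y) - f x"
  unfolding ctrans_def by (rule cINF_lower[OF bdd_below_ctrans[OF assms]]) auto

lemma ctrans_ge:
  assumes "\<And>x. k \<le> c (x, y) - f x"
  shows "k \<le> ctrans c f y"
  unfolding ctrans_def using assms by (intro cINF_greatest) auto

lemma abs_ctrans_le:
  assumes "\<forall>p. \<bar>c p\<bar> \<le> C" "\<forall>x. \<bar>f x\<bar> \<le> D"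
  shows "\<bar>ctrans c f y\<bar> \<le> C + D"
proof -
  have "- C - D \<le> c (x, y) - f x" for x using assms(1)[rule_format, of "(x,y)"] assms(2)[rule_format, of x] by linarith
  then have "- C - D \<le> ctrans c f y" by (rule ctrans_ge)
  moreover have "ctrans c f y \<le> C + D"
    using ctrans_le[OF assms, of y undefined] assms(1)[rule_format, of "(undefined,y)"]
      assms(2)[rule_format, of undefined] by linarith
  ultimately show ?thesis by linarith
qed

text \<open>Exchanging the arguments of the cost turns the second infimum into an ordinary
  transform, so that bounds and continuity of \<open>ctrans\<close> carry over to
  \<open>cctrans\<close>.\<close>

lemma cctrans_eq_ctrans: "cctrans c f x = ctrans (\<lambda>(y, x). c (x, y)) (ctrans c f) x"
  by (simp add: cctrans_def ctrans_def)

lemma cctrans_le: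
  assumes "\<forall>p. \<bar>c p\<bar> \<le> C" "\<forall>x. \<bar>f x\<bar> \<le> D"
  shows "cctrans c f x \<le> c (x, y) - ctrans c f y"
  using ctrans_le[of "\<lambda>(y, x). c (x, y)" C "ctrans c f" "C + D" x y] abs_ctrans_le[OF assms] assms(1)
  by (simp add: cctrans_eq_ctrans)

lemma cctrans_ge:
  assumes "\<And>y. k \<le> c (x, y) - ctrans c f y"
  shows "k \<le> cctrans c f x"
  unfolding cctrans_def using assms by (intro cINF_greatest) auto

lemma le_cctrans:
  assumes "\<forall>p. \<bar>c p\<bar> \<le> C" "\<forall>x. \<bar>f x\<bar> \<le> D"
  shows "f x \<le> cctrans c f x"
proof (rule cctrans_ge)
  fix y show "f x \<le> c (x, y) - ctrans c f y" using ctrans_le[OF assms, of y x] by simp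
qed

lemma abs_cctrans_le:
  assumes "\<forall>p. \<bar>c p\<bar> \<le> C" "\<forall>x. \<bar>f x\<bar> \<le> D"
  shows "\<bar>cctrans c f x\<bar> \<le> 2 * C + D"
  using abs_ctrans_le[of "\<lambda>(y, x). c (x, y)" C "ctrans c f" "C + D" x] abs_ctrans_le[OF assms] assms(1)
  by (auto simp: cctrans_eq_ctrans)

text \<open>The points \<open>y\<close> and \<open>y'\<close> are kept apart so that one estimate
  yields both stability in the cost and the potential and continuity in \<open>y\<close>.\<close>

lemma ctrans_diff_le:
  assumes "\<forall>p. \<bar>c p\<bar> \<le> C" "\<forall>x. \<bar>f x\<bar> \<le> D" "\<forall>p. \<bar>c' p\<bar> \<le> C'" "\<forall>x. \<bar>f' x\<bar> \<le> D'"
    and "\<forall>x. \<bar>c (x, y) - c' (x, y')\<bar> \<le> e" "\<forall>x. \<bar>f x - f' x\<bar> \<le> d"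
  shows "\<bar>ctrans c f y - ctrans c' f' y'\<bar> \<le> e + d"
  unfolding ctrans_def
proof (rule abs_cINF_diff_le)
  show "bdd_below (range (\<lambda>x. c (x, y) - f x))" "bdd_below (range (\<lambda>x. c' (x, y') - f' x))"
    using bdd_below_ctrans[OF assms(1,2)] bdd_below_ctrans[OF assms(3,4)] by auto
  fix x
  show "\<bar>c (x, y) - f x - (c' (x, y') - f' x)\<bar> \<le> e + d"
    using assms(5)[rule_format, of x] assms(6)[rule_format, of x] by linarith
qed simp

lemma cctrans_diff_le:
  assumes c: "\<forall>p. \<bar>c p\<bar> \<le> C" and f: "\<forall>x. \<bar>f x\<bar> \<le> D" and c': "\<forall>p. \<bar>c' p\<bar> \<le> C'" and f': "\<forall>x. \<bar>f' x\<bar> \<le> D'"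
    and ce: "\<forall>p. \<bar>c p - c' p\<bar> \<le> e" and fd: "\<forall>x. \<bar>f x - f' x\<bar> \<le> d"
  shows "\<bar>cctrans c f x - cctrans c' f' x\<bar> \<le> 2 * e + d"
proof -
  \<comment> \<open>The cost error enters once in the inner transform, giving \<open>e + d\<close>,
    and once more in the outer one.\<close>
  have "\<bar>ctrans (\<lambda>(y, x). c (x, y)) (ctrans c f) x - ctrans (\<lambda>(y, x). c' (x, y)) (ctrans c' f') x\<bar> \<le> e + (e + d)"
  proof (rule ctrans_diff_le)
    show "\<forall>y. \<bar>ctrans c f y\<bar> \<le> C + D" "\<forall>y. \<bar>ctrans c' f' y\<bar> \<le> C' + D'"
      using abs_ctrans_le[OF c f] abs_ctrans_le[OF c' f'] by auto
    show "\<forall>y. \<bar>ctrans c f y - ctrans c' f' y\<bar> \<le> e + d"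
      using ctrans_diff_le[OF c f c' f' _ fd] ce by simp
  qed (use c c' ce in auto)
  then show ?thesis by (simp add: cctrans_eq_ctrans)
qed

text \<open>The modulus of the transform comes from the uniform continuity of the cost alone, so a
  bounded \<open>f\<close> suffices.\<close>

lemma continuous_ctrans:
  fixes c :: "'x::metric_space \<times> 'y::metric_space \<Rightarrow> real"
  assumes X: "compact (UNIV :: 'x set)" and Y: "compact (UNIV :: 'y set)"
    and c: "continuous_on UNIV c" and f: "\<forall>x. \<bar>f x\<bar> \<le> D"
  shows "continuous_on UNIV (ctrans c f)"
proof -
  have cXY: "compact (UNIV :: ('x \<times> 'y) set)" using compact_Times[OF X Y] by simp
  then have uc: "uniformly_continuous_on UNIV c" using c by (intro compact_uniformly_continuous)
  have "bounded (range c)" using cXY c by (intro compact_imp_bounded compact_continuous_image)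
  then obtain C where C: "\<forall>p. \<bar>c p\<bar> \<le> C" by (auto simp: bounded_iff)
  show ?thesis unfolding continuous_on_iff
  proof (intro ballI allI impI)
    fix y :: 'y and e :: real assume "0 < e"
    then obtain d where d: "0 < d" "\<And>p p'. dist p' p < d \<Longrightarrow> dist (c p') (c p) < e / 2"
      using uniformly_continuous_onE[OF uc, of "e/2"] by auto
    have "dist (ctrans c f y') (ctrans c f y) < e" if "dist y' y < d" for y'
    proof -
      have "\<bar>c (x, y') - c (x, y)\<bar> \<le> e / 2" for x
        using d(2)[of "(x, y')" "(x, y)"] that by (simp add: dist_Pair_Pair dist_real_def)
      then have "\<bar>ctrans c f y' - ctrans c f y\<bar> \<le> e / 2 + 0"
        by (intro ctrans_diff_le[OF C f C f]) auto
      then show ?thesis using \<open>0 < e\<close> by (simp add: dist_real_def)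
    qed
    then show "\<exists>d>0. \<forall>x'\<in>UNIV. dist x' y < d \<longrightarrow> dist (ctrans c f x') (ctrans c f y) < e"
      using d(1) by blast
  qed
qed

lemma continuous_cctrans:
  fixes c :: "'x::metric_space \<times> 'y::metric_space \<Rightarrow> real"
  assumes X: "compact (UNIV :: 'x set)" and Y: "compact (UNIV :: 'y set)"
    and c: "continuous_on UNIV c" and f: "\<forall>x. \<bar>f x\<bar> \<le> D"
  shows "continuous_on UNIV (cctrans c f)"
proof -
  have cXY: "compact (UNIV :: ('x \<times> 'y) set)" using compact_Times[OF X Y] by simp
  have "bounded (range c)" using cXY c by (intro compact_imp_bounded compact_continuous_image)
  then obtain C where C: "\<forall>p. \<bar>c p\<bar> \<le> C" by (auto simp: bounded_iff)
  have "continuous_on UNIV (\<lambda>(y, x). c (x, y))"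
    unfolding case_prod_beta by (intro continuous_on_compose2[OF c] continuous_intros) auto
  then have "continuous_on UNIV (ctrans (\<lambda>(y, x). c (x, y)) (ctrans c f))"
    using abs_ctrans_le[OF C f] by (intro continuous_ctrans[OF Y X]) auto
  moreover have "cctrans c f = ctrans (\<lambda>(y, x). c (x, y)) (ctrans c f)"
    by (rule ext) (rule cctrans_eq_ctrans)
  ultimately show ?thesis by simp
qed

section \<open>Discrete optimal transport\<close>

text \<open>Seen as the push-forward of the uniform law on the indices, the empirical measure
  inherits its integrals and image measures from general facts on \<open>distr\<close>.\<close>

lemma emp_meas_eq_distr:
  fixes x :: "nat \<Rightarrow> 'a::topological_space"
  assumes "0 < n"
  shows "emp_meas n x = distr (measure_pmf (pmf_of_set {..<n})) borel x" (is "_ = ?N")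
proof -
  have "emp_meas n x = measure_of (space ?N) (sets ?N) (emeasure ?N)"
    unfolding emp_meas_def space_distr sets_distr space_borel
  proof (rule measure_of_eq)
    fix A :: "'a set" assume "A \<in> sigma_sets UNIV (sets borel)"
    then have A: "A \<in> sets borel" using sets.sigma_sets_eq[of "borel :: 'a measure"] by simp
    have "emeasure ?N A = emeasure (measure_pmf (pmf_of_set {..<n})) (x -` A)"
      using A by (subst emeasure_distr) auto
    also have "\<dots> = ennreal (real (card ({..<n} \<inter> x -` A)) / real n)"
      using assms by (subst emeasure_pmf_of_set) (auto simp: lessThan_empty_iff)
    also have "{..<n} \<inter> x -` A = {i. i < n \<and> x i \<in> A}" by auto
    finally show "ennreal (real (card {i. i < n \<and> x i \<in> A}) / real n) = emeasure ?N A" by simp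
  qed simp
  then show ?thesis by (simp only: measure_of_of_measure)
qed

lemma sets_emp_meas [simp]: "sets (emp_meas n x) = sets borel"
  unfolding emp_meas_def by (subst sets_measure_of) (auto simp: sets.sigma_sets_eq[of borel, simplified])

lemma prob_space_emp_meas: "0 < n \<Longrightarrow> prob_space (emp_meas n x)"
  unfolding emp_meas_eq_distr by (intro prob_space.prob_space_distr) (auto simp: prob_space_measure_pmf)

lemma integral_emp_meas:
  fixes g :: "'a::topological_space \<Rightarrow> real"
  assumes "0 < n" "g \<in> borel_measurable borel"
  shows "integral\<^sup>L (emp_meas n x) g = (\<Sum>i<n. g (x i)) / real n"
  unfolding emp_meas_eq_distr[OF assms(1)] using assms
  by (subst integral_distr) (auto simp: integral_pmf_of_set lessThan_empty_iff)

lemma distr_emp_meas: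
  assumes "0 < n" "h \<in> measurable borel borel"
  shows "distr (emp_meas n x) borel h = emp_meas n (\<lambda>i. h (x i))"
  unfolding emp_meas_eq_distr[OF assms(1)] using assms by (subst distr_distr) (auto simp: o_def)

lemma emp_meas_cong_card:
  assumes "\<And>A. real (card {i. i < n \<and> x i \<in> A}) / real n = real (card {i. i < m \<and> y i \<in> A}) / real m"
  shows "emp_meas n x = emp_meas m y"
  unfolding emp_meas_def using assms by simp

text \<open>Every residue modulo \<open>n\<close> is hit exactly \<open>m\<close> times below
  \<open>n * m\<close>. This brings samples of different sizes to a common length, where transport
  becomes an assignment problem.\<close>

lemma emp_meas_mod:
  assumes "0 < n" "0 < m"
  shows "emp_meas (n * m) (\<lambda>i. x (i mod n)) = emp_meas n x"
proof (rule emp_meas_cong_card)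
  fix A
  have lt: "b * n + a < n * m" if "a < n" "b < m" for a b
  proof -
    have "b * n + a < Suc b * n" using that(1) by simp
    also have "\<dots> \<le> m * n" using that(2) by (intro mult_le_mono1) simp
    finally show ?thesis by (simp add: mult.commute)
  qed
  have "bij_betw (\<lambda>i. (i mod n, i div n)) {i. i < n * m \<and> x (i mod n) \<in> A} ({i. i < n \<and> x i \<in> A} \<times> {..<m})"
    using assms lt
    by (intro bij_betw_byWitness[where f'="\<lambda>(a, b). b * n + a"])
      (auto simp: less_mult_imp_div_less mult.commute)
  then have "card {i. i < n * m \<and> x (i mod n) \<in> A} = card {i. i < n \<and> x i \<in> A} * m"
    by (simp add: bij_betw_same_card card_cartesian_product)
  then show "real (card {i. i < n * m \<and> x (i mod n) \<in> A}) / real (n * m) = real (card {i. i < n \<and> x i \<in> A}) / real n"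
    using assms by simp
qed

lemma emp_meas_permute:
  assumes "p permutes {..<n}"
  shows "emp_meas n (\<lambda>i. x (p i)) = emp_meas n x"
proof (rule emp_meas_cong_card)
  fix A
  have inP: "p i < n \<longleftrightarrow> i < n" for i using permutes_in_image[OF assms, of i] by simp
  have "p ` {i. i < n \<and> x (p i) \<in> A} = {i. i < n \<and> x i \<in> A}"
  proof (intro equalityI subsetI)
    fix i assume i: "i \<in> {i. i < n \<and> x i \<in> A}"
    obtain j where "i = p j" using permutes_surj[OF assms] by (metis surjD)
    with i inP show "i \<in> p ` {i. i < n \<and> x (p i) \<in> A}" by auto
  qed (use inP in auto)
  then have "bij_betw p {i. i < n \<and> x (p i) \<in> A} {i. i < n \<and> x i \<in> A}"
    using permutes_inj_on[OF assms] by (auto simp: bij_betw_def)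
  then show "real (card {i. i < n \<and> x (p i) \<in> A}) / real n = real (card {i. i < n \<and> x i \<in> A}) / real n"
    by (simp add: bij_betw_same_card)
qed

text \<open>The potential of an index is the least weight of a simple path starting there; a path that
  returns to its start closes a simple cycle, whose weight is nonnegative by optimality.\<close>

lemma optimal_assignment_potential:
  fixes C :: "nat \<Rightarrow> nat \<Rightarrow> real"
  assumes opt: "\<And>p. p permutes {..<n} \<Longrightarrow> (\<Sum>i<n. C i i) \<le> (\<Sum>i<n. C i (p i))"
  shows "\<exists>u. \<forall>i<n. \<forall>j<n. u i \<le> u j + (C i j - C j j)"
proof -
  define A where "A i j = C i j - C j j" for i j
  define pw where "pw l = sum_list (map2 A l (tl l))" for l
  have pw_Cons: "pw (i # l) = A i (hd l) + pw l" if "l \<noteq> []" for i l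
    using that by (cases l) (auto simp: pw_def)
  have pw1: "pw [i] = 0" for i by (simp add: pw_def)
  have pw_append: "pw (xs @ a # ys) = pw (xs @ [a]) + pw (a # ys)" for xs a ys
  proof (induction xs)
    case (Cons b xs)
    have "hd (xs @ a # ys) = hd (xs @ [a])" by (cases xs) auto
    then show ?case using Cons pw_Cons[of "xs @ a # ys" b] pw_Cons[of "xs @ [a]" b] by simp
  qed (simp add: pw1)
  have cyc: "0 \<le> pw (h # t @ [h])" if d: "distinct (h # t)" "set (h # t) \<subseteq> {..<n}" for h t
  proof -
    define cs where "cs = h # t"
    define p where "p = cycle_of_list cs"
    have pc: "p permutes set cs" unfolding p_def by (rule cycle_permutes)
    then have pn: "p permutes {..<n}" using d(2) unfolding cs_def by (rule permutes_subset)
    \<comment> \<open>Reindexing the diagonal along the cycle turns optimality of the identity into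
      nonnegativity of the sum of \<open>A i (p i)\<close>. Indices off the cycle contribute zero
      because \<open>A i i = 0\<close>.\<close>
    have "(\<Sum>i<n. C (p i) (p i)) = (\<Sum>i<n. C i i)"
      using sum.permute[OF pn, of "\<lambda>i. C i i"] by (simp add: o_def)
    then have "0 \<le> (\<Sum>i<n. A i (p i))"
      using opt[OF pn] by (simp add: A_def sum_subtractf)
    also have "(\<Sum>i<n. A i (p i)) = (\<Sum>i\<in>set cs. A i (p i))"
      using d(2) permutes_not_in[OF pc] unfolding cs_def
      by (intro sum.mono_neutral_right) (auto simp: A_def)
    also have "\<dots> = sum_list (map (\<lambda>i. A i (p i)) cs)"
      using d(1) unfolding cs_def by (rule sum_list_distinct_conv_sum_set[symmetric])
    also have "map (\<lambda>i. A i (p i)) cs = map2 A cs (map p cs)"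
      by (simp add: map2_map_map[of A "\<lambda>i. i" cs p, simplified])
    \<comment> \<open>Along the list the cycle acts as a rotation by one place, so the sum is the
      weight of the closed path.\<close>
    also have "map p cs = t @ [h]"
      using cyclic_rotation[of cs 1] d(1) by (simp add: p_def cs_def)
    also have "map2 A cs (t @ [h]) = map2 A (h # t @ [h]) (t @ [h])"
    proof -
      have "zip ((h # t) @ [h]) (t @ [h]) = zip (h # t) (t @ [h])"
        by (subst zip_append1) auto
      then show ?thesis unfolding cs_def by simp
    qed
    finally show ?thesis by (simp add: pw_def)
  qed
  define S where "S i = {l. set l \<subseteq> {..<n} \<and> distinct l \<and> l \<noteq> [] \<and> hd l = i}" for i
  have finS: "finite (S i)" for i
    by (rule finite_subset[OF _ finite_subset_distinct[of "{..<n}"]]) (auto simp: S_def)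
  define u where "u i = Min (pw ` S i)" for i
  have u_le: "u i \<le> pw l" if "l \<in> S i" for i l
    unfolding u_def using that finS by (intro Min_le) auto
  have "u i \<le> u j + A i j" if ij: "i < n" "j < n" for i j
  proof -
    have "[j] \<in> S j" using ij by (simp add: S_def)
    then have "u j \<in> pw ` S j" unfolding u_def using finS by (intro Min_in) auto
    then obtain l where l: "l \<in> S j" "u j = pw l" by blast
    then have pil: "pw (i # l) = A i j + u j" using pw_Cons[of l i] by (simp add: S_def)
    show ?thesis
    proof (cases "i \<in> set l")
      case False
      then have "i # l \<in> S i" using l(1) ij by (simp add: S_def)
      from u_le[OF this] pil show ?thesis by simp
    next
      case True
      \<comment> \<open>The path from \<open>j\<close> already visits \<open>i\<close>: the part
        before this visit closes a cycle of nonnegative weight, and the rest is a simple path that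
        starts at \<open>i\<close>.\<close>
      then obtain q r where qr: "l = q @ i # r" by (meson split_list)
      have "i # r \<in> S i" using l(1) qr by (auto simp: S_def)
      then have 1: "u i \<le> pw (i # r)" by (rule u_le)
      have "0 \<le> pw (i # q @ [i])" using l(1) qr ij by (intro cyc) (auto simp: S_def)
      moreover have "pw (i # l) = pw (i # q @ [i]) + pw (i # r)"
        using pw_append[of "i # q" i r] qr by simp
      ultimately show ?thesis using 1 pil by linarith
    qed
  qed
  then show ?thesis unfolding A_def by blast
qed

text \<open>An optimal matching exists among finitely many permutations. The potential of its
  indices extends to the whole space as a finite minimum of translates of the cost, and therefore
  inherits the modulus and the oscillation bound of the cost. \<open>W\<close> is an arbitrary
  function, which permits a constant for a cost known only to be bounded.\<close>

lemma discrete_duality: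
  fixes c :: "'x::metric_space \<times> 'y \<Rightarrow> real" and x :: "nat \<Rightarrow> 'x" and y :: "nat \<Rightarrow> 'y"
  assumes n: "0 < n" and C: "\<forall>p. \<bar>c p\<bar> \<le> C"
    and W: "\<forall>x x' y. \<bar>c (x, y) - c (x', y)\<bar> \<le> W (dist x x')"
  obtains p f where "p permutes {..<n}" "f \<in> Fclass C W"
    "\<And>i. i < n \<Longrightarrow> cctrans c f (x i) + ctrans c f (y (p i)) = c (x i, y (p i))"
proof -
  define cost where "cost p = (\<Sum>i<n. c (x i, y (p i)))" for p
  let ?S = "{p. p permutes {..<n}}"
  have fS: "finite ?S" by (rule finite_permutations) simp
  have "id \<in> ?S" by (simp add: permutes_id)
  then have "cost ` ?S \<noteq> {}" by blast
  then have "Min (cost ` ?S) \<in> cost ` ?S" using fS by (intro Min_in) auto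
  then obtain p where p: "p permutes {..<n}" "Min (cost ` ?S) = cost p" by blast
  have pmin: "cost p \<le> cost q" if "q permutes {..<n}" for q
    unfolding p(2)[symmetric] using that fS by (intro Min_le) auto
  \<comment> \<open>Relabelling the second sample by \<open>p\<close> makes the identity the optimal
    permutation.\<close>
  have "\<exists>u. \<forall>i<n. \<forall>j<n. u i \<le> u j + (c (x i, y (p j)) - c (x j, y (p j)))"
  proof (rule optimal_assignment_potential)
    fix q assume "q permutes {..<n}"
    then have "(p \<circ> q) permutes {..<n}" using p(1) by (rule permutes_compose)
    from pmin[OF this] show "(\<Sum>i<n. c (x i, y (p i))) \<le> (\<Sum>i<n. c (x i, y (p (q i))))"
      by (simp add: cost_def)
  qed
  then obtain u where u: "\<And>i j. i < n \<Longrightarrow> j < n \<Longrightarrow> u i \<le> u j + (c (x i, y (p j)) - c (x j, y (p j)))"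
    by blast
  define g where "g z j = c (z, y (p j)) - c (x j, y (p j)) + u j" for z j
  define f0 where "f0 z = (INF j\<in>{..<n}. g z j)" for z
  \<comment> \<open>Normalising at \<open>x 0\<close> bounds \<open>f\<close> by the oscillation of
    \<open>c\<close>, hence by \<open>2 * C\<close>, which is the bound built into
    \<open>Fclass C W\<close>.\<close>
  define f where "f z = f0 z - f0 (x 0)" for z
  have ne: "{..<n} \<noteq> {}" using n by auto
  have f0_le: "f0 z \<le> g z j" if "j < n" for z j
    unfolding f0_def using that by (intro cINF_lower) auto
  have f0_diff: "\<bar>f0 z - f0 z'\<bar> \<le> e" if "\<And>y. \<bar>c (z, y) - c (z', y)\<bar> \<le> e" for z z' e
    unfolding f0_def using that by (intro abs_cINF_diff_le[OF ne]) (auto simp: g_def)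
  have f0x: "f0 (x i) = u i" if "i < n" for i
  proof (rule antisym)
    show "f0 (x i) \<le> u i" using f0_le[OF that, of "x i"] by (simp add: g_def)
    show "u i \<le> f0 (x i)" unfolding f0_def g_def
      using u[OF that] by (intro cINF_greatest[OF ne]) (auto simp: algebra_simps)
  qed
  have fb: "\<bar>f z\<bar> \<le> 2 * C" for z
    unfolding f_def
  proof (rule f0_diff)
    fix y show "\<bar>c (z, y) - c (x 0, y)\<bar> \<le> 2 * C"
      using C[rule_format, of "(z, y)"] C[rule_format, of "(x 0, y)"] by linarith
  qed
  then have fb': "\<forall>z. \<bar>f z\<bar> \<le> 2 * C" by simp
  have "\<bar>f z - f z'\<bar> \<le> W (dist z z')" for z z'
    using f0_diff[of z z' "W (dist z z')"] W by (simp add: f_def)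
  with fb have fF: "f \<in> Fclass C W" by (simp add: Fclass_def)
  have fc: "ctrans c f (y (p j)) = c (x j, y (p j)) - f (x j)" if "j < n" for j
  proof (rule antisym)
    show "ctrans c f (y (p j)) \<le> c (x j, y (p j)) - f (x j)" by (rule ctrans_le[OF C fb'])
    show "c (x j, y (p j)) - f (x j) \<le> ctrans c f (y (p j))"
    proof (rule ctrans_ge)
      fix z show "c (x j, y (p j)) - f (x j) \<le> c (z, y (p j)) - f z"
        using f0_le[OF that, of z] f0x[OF that] by (simp add: f_def g_def)
    qed
  qed
  \<comment> \<open>One inequality holds for every pair of points; at matched pairs
    \<open>f (x i) \<le> cctrans c f (x i)\<close> and the value of \<open>ctrans\<close> force
    equality.\<close>
  have "cctrans c f (x i) + ctrans c f (y (p i)) = c (x i, y (p i))" if "i < n" for i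
  proof -
    have "cctrans c f (x i) \<le> c (x i, y (p i)) - ctrans c f (y (p i))" by (rule cctrans_le[OF C fb'])
    moreover have "f (x i) \<le> cctrans c f (x i)" by (rule le_cctrans[OF C fb'])
    ultimately show ?thesis using fc[OF that] by linarith
  qed
  with p(1) fF that show ?thesis by blast
qed

lemma emp_meas_coupling:
  fixes x :: "nat \<Rightarrow> 'x::topological_space" and y :: "nat \<Rightarrow> 'y::topological_space"
  assumes "0 < n"
  shows "emp_meas n (\<lambda>i. (x i, y i)) \<in> couplings (emp_meas n x) (emp_meas n y)"
  unfolding couplings_def
proof (intro CollectI conjI)
  show "prob_space (emp_meas n (\<lambda>i. (x i, y i)))" using assms by (rule prob_space_emp_meas)
  have fst: "fst \<in> measurable (borel :: ('x \<times> 'y) measure) borel"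
    and snd: "snd \<in> measurable (borel :: ('x \<times> 'y) measure) borel"
    by (auto intro!: borel_measurable_continuous_onI continuous_intros)
  show "distr (emp_meas n (\<lambda>i. (x i, y i))) borel fst = emp_meas n x"
    using distr_emp_meas[OF assms fst, of "\<lambda>i. (x i, y i)"] by simp
  show "distr (emp_meas n (\<lambda>i. (x i, y i))) borel snd = emp_meas n y"
    using distr_emp_meas[OF assms snd, of "\<lambda>i. (x i, y i)"] by simp
qed simp

text \<open>Cutting the atoms into \<open>N * M\<close> pieces of equal mass reduces general sample
  sizes to a matching. Complementary slackness is kept pointwise on the atoms because it is later
  combined with pointwise errors between two costs.\<close>

lemma emp_meas_dual_coupling:
  fixes c :: "'x::metric_space \<times> 'y::metric_space \<Rightarrow> real" and x :: "nat \<Rightarrow> 'x" and y :: "nat \<Rightarrow> 'y"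
  assumes N: "0 < N" and M: "0 < M" and C: "\<forall>p. \<bar>c p\<bar> \<le> C"
    and W: "\<forall>x x' y. \<bar>c (x, y) - c (x', y)\<bar> \<le> W (dist x x')"
  obtains n x' y' f where "0 < n" "emp_meas n x' = emp_meas N x" "emp_meas n y' = emp_meas M y"
    "emp_meas n (\<lambda>i. (x' i, y' i)) \<in> couplings (emp_meas N x) (emp_meas M y)"
    "f \<in> Fclass C W" "\<And>i. i < n \<Longrightarrow> cctrans c f (x' i) + ctrans c f (y' i) = c (x' i, y' i)"
proof -
  define n where "n = N * M"
  have n: "0 < n" using N M by (simp add: n_def)
  define x' where "x' i = x (i mod N)" for i
  define y0 where "y0 i = y (i mod M)" for i
  obtain p f where p: "p permutes {..<n}" and f: "f \<in> Fclass C W"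
    and eq: "\<And>i. i < n \<Longrightarrow> cctrans c f (x' i) + ctrans c f (y0 (p i)) = c (x' i, y0 (p i))"
    by (rule discrete_duality[OF n C W, of x' y0]) blast
  have ex: "emp_meas n x' = emp_meas N x"
    unfolding n_def x'_def by (rule emp_meas_mod[OF N M])
  have ey: "emp_meas n (\<lambda>i. y0 (p i)) = emp_meas M y"
    using emp_meas_mod[OF M N, of y] emp_meas_permute[OF p, of y0]
    by (simp add: n_def mult.commute flip: y0_def)
  show ?thesis
    by (rule that[OF n ex ey _ f eq]) (use emp_meas_coupling[OF n, of x' "\<lambda>i. y0 (p i)"] ex ey in auto)
qed

section \<open>Duality on compact spaces\<close>

lemma compact_UNIV_prod:
  assumes "compact (UNIV :: 'x::topological_space set)" "compact (UNIV :: 'y::topological_space set)"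
  shows "compact (UNIV :: ('x \<times> 'y) set)"
  using compact_Times[OF assms] by simp

lemma continuous_compact_bounded:
  fixes h :: "'a::topological_space \<Rightarrow> real"
  assumes "compact (UNIV :: 'a set)" "continuous_on UNIV h"
  obtains B where "0 \<le> B" "\<forall>x. \<bar>h x\<bar> \<le> B"
proof -
  have "bounded (range h)" using assms by (intro compact_imp_bounded compact_continuous_image)
  then obtain B where B: "\<forall>x. \<bar>h x\<bar> \<le> B" by (auto simp: bounded_iff)
  then have "0 \<le> B" using abs_ge_zero order_trans by blast
  with B that show ?thesis by blast
qed

lemma integral_prob_le:
  fixes h h' :: "'a::metric_space \<Rightarrow> real"
  assumes cpt: "compact (UNIV :: 'a set)" and M: "prob_space M" "sets M = sets borel"
    and h: "continuous_on UNIV h" and h': "continuous_on UNIV h'" and le: "\<And>x. h x \<le> h' x + e"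
  shows "integral\<^sup>L M h \<le> integral\<^sup>L M h' + e"
proof -
  interpret prob_space M by fact
  have i: "integrable M h" "integrable M h'"
    using integrable_continuous_compact[OF cpt _ M(2)] h h' by (auto intro: finite_measure_axioms)
  have "integral\<^sup>L M h \<le> integral\<^sup>L M (\<lambda>x. h' x + e)"
    using i le by (intro integral_mono) auto
  also have "\<dots> = integral\<^sup>L M h' + e" using i by (simp add: prob_space)
  finally show ?thesis .
qed

lemma abs_integral_prob_diff_le:
  fixes h h' :: "'a::metric_space \<Rightarrow> real"
  assumes cpt: "compact (UNIV :: 'a set)" and M: "prob_space M" "sets M = sets borel"
    and h: "continuous_on UNIV h" and h': "continuous_on UNIV h'" and le: "\<And>x. \<bar>h x - h' x\<bar> \<le> e"
  shows "\<bar>integral\<^sup>L M h - integral\<^sup>L M h'\<bar> \<le> e"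
proof -
  have 1: "h x \<le> h' x + e" and 2: "h' x \<le> h x + e" for x using le[of x] by linarith+
  show ?thesis using integral_prob_le[OF cpt M h h' 1] integral_prob_le[OF cpt M h' h 2] by linarith
qed

lemma abs_integral_prob_le:
  fixes h :: "'a::metric_space \<Rightarrow> real"
  assumes cpt: "compact (UNIV :: 'a set)" and M: "prob_space M" "sets M = sets borel"
    and h: "continuous_on UNIV h" and le: "\<And>x. \<bar>h x\<bar> \<le> e"
  shows "\<bar>integral\<^sup>L M h\<bar> \<le> e"
  using abs_integral_prob_diff_le[OF cpt M h, of "\<lambda>_. 0" e] le by simp

lemma measurable_fst_snd_borel:
  fixes \<pi> :: "('x::topological_space \<times> 'y::topological_space) measure"
  assumes "sets \<pi> = sets borel"
  shows "fst \<in> measurable \<pi> borel" "snd \<in> measurable \<pi> borel"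
  unfolding measurable_cong_sets[OF assms refl]
  by (auto intro!: borel_measurable_continuous_onI continuous_intros)

lemma couplingsD:
  assumes "\<pi> \<in> couplings \<mu> \<nu>"
  shows "prob_space \<pi>" "sets \<pi> = sets borel" "prob_space \<mu>" "sets \<mu> = sets borel"
    "prob_space \<nu>" "sets \<nu> = sets borel"
proof -
  have \<pi>: "prob_space \<pi>" "sets \<pi> = sets borel" "distr \<pi> borel fst = \<mu>" "distr \<pi> borel snd = \<nu>"
    using assms by (auto simp: couplings_def)
  have fst: "fst \<in> measurable \<pi> borel" and snd: "snd \<in> measurable \<pi> borel"
    using measurable_fst_snd_borel[OF \<pi>(2)] by auto
  show "prob_space \<pi>" "sets \<pi> = sets borel" "prob_space \<mu>" "sets \<mu> = sets borel"
    "prob_space \<nu>" "sets \<nu> = sets borel"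
    using \<pi> prob_space.prob_space_distr[OF \<pi>(1) fst] prob_space.prob_space_distr[OF \<pi>(1) snd]
    by (auto simp flip: \<pi>(3,4))
qed

lemma integral_distr_fst_snd:
  fixes \<pi> :: "('x::topological_space \<times> 'y::topological_space) measure"
    and g :: "'x \<Rightarrow> real" and h :: "'y \<Rightarrow> real"
  assumes \<pi>: "sets \<pi> = sets borel"
  shows "continuous_on UNIV g \<Longrightarrow> integral\<^sup>L (distr \<pi> borel fst) g = integral\<^sup>L \<pi> (\<lambda>p. g (fst p))"
    and "continuous_on UNIV h \<Longrightarrow> integral\<^sup>L (distr \<pi> borel snd) h = integral\<^sup>L \<pi> (\<lambda>p. h (snd p))"
proof -
  have fst: "fst \<in> measurable \<pi> borel" and snd: "snd \<in> measurable \<pi> borel"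
    using measurable_fst_snd_borel[OF \<pi>] by auto
  show "integral\<^sup>L (distr \<pi> borel fst) g = integral\<^sup>L \<pi> (\<lambda>p. g (fst p))" if "continuous_on UNIV g"
    using that fst by (intro integral_distr borel_measurable_continuous_onI)
  show "integral\<^sup>L (distr \<pi> borel snd) h = integral\<^sup>L \<pi> (\<lambda>p. h (snd p))" if "continuous_on UNIV h"
    using that snd by (intro integral_distr borel_measurable_continuous_onI)
qed

lemma integral_coupling:
  assumes "\<pi> \<in> couplings \<mu> \<nu>"
  shows "continuous_on UNIV g \<Longrightarrow> integral\<^sup>L \<pi> (\<lambda>p. g (fst p)) = (integral\<^sup>L \<mu> g :: real)"
    and "continuous_on UNIV h \<Longrightarrow> integral\<^sup>L \<pi> (\<lambda>p. h (snd p)) = (integral\<^sup>L \<nu> h :: real)"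
  using integral_distr_fst_snd[of \<pi>] assms by (auto simp: couplings_def)

lemma weak_duality:
  fixes c :: "'x::metric_space \<times> 'y::metric_space \<Rightarrow> real"
  assumes X: "compact (UNIV :: 'x set)" and Y: "compact (UNIV :: 'y set)"
    and c: "continuous_on UNIV c" and f: "\<forall>x. \<bar>f x\<bar> \<le> D" and \<pi>: "\<pi> \<in> couplings \<mu> \<nu>"
  shows "integral\<^sup>L \<mu> (cctrans c f) + integral\<^sup>L \<nu> (ctrans c f) \<le> integral\<^sup>L \<pi> c"
proof -
  note XY = compact_UNIV_prod[OF X Y]
  obtain C where C: "\<forall>p. \<bar>c p\<bar> \<le> C" by (rule continuous_compact_bounded[OF XY c])
  note \<pi>' = couplingsD[OF \<pi>]
  interpret prob_space \<pi> by fact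
  note fc = continuous_ctrans[OF X Y c f] and fcc = continuous_cctrans[OF X Y c f]
  have c1: "continuous_on UNIV (\<lambda>p :: 'x \<times> 'y. cctrans c f (fst p))"
    by (intro continuous_on_compose2[OF fcc] continuous_intros) auto
  have c2: "continuous_on UNIV (\<lambda>p :: 'x \<times> 'y. ctrans c f (snd p))"
    by (intro continuous_on_compose2[OF fc] continuous_intros) auto
  have i: "integrable \<pi> h" if "continuous_on UNIV h" for h :: "'x \<times> 'y \<Rightarrow> real"
    using finite_measure_axioms \<pi>'(2) that by (rule integrable_continuous_compact[OF XY])
  have "integral\<^sup>L \<mu> (cctrans c f) + integral\<^sup>L \<nu> (ctrans c f)
      = integral\<^sup>L \<pi> (\<lambda>p. cctrans c f (fst p)) + integral\<^sup>L \<pi> (\<lambda>p. ctrans c f (snd p))"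
    using integral_coupling[OF \<pi>] fc fcc by simp
  also have "\<dots> = integral\<^sup>L \<pi> (\<lambda>p. cctrans c f (fst p) + ctrans c f (snd p))"
    using i[OF c1] i[OF c2] by simp
  also have "\<dots> \<le> integral\<^sup>L \<pi> c"
  proof (rule integral_mono)
    show "integrable \<pi> (\<lambda>p. cctrans c f (fst p) + ctrans c f (snd p))" using i[OF c1] i[OF c2] by simp
    show "integrable \<pi> c" using c by (rule i)
    fix p show "cctrans c f (fst p) + ctrans c f (snd p) \<le> c p"
      using cctrans_le[OF C f, of "fst p" "snd p"] by simp
  qed
  finally show ?thesis .
qed

lemma OT_le:
  fixes c :: "'x::metric_space \<times> 'y::metric_space \<Rightarrow> real"
  assumes X: "compact (UNIV :: 'x set)" and Y: "compact (UNIV :: 'y set)"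
    and c: "continuous_on UNIV c" and \<pi>: "\<pi> \<in> couplings \<mu> \<nu>"
  shows "OT \<mu> \<nu> c \<le> integral\<^sup>L \<pi> c"
proof -
  note XY = compact_UNIV_prod[OF X Y]
  obtain C where C: "\<forall>p. \<bar>c p\<bar> \<le> C" by (rule continuous_compact_bounded[OF XY c])
  have "bdd_below ((\<lambda>\<pi>. integral\<^sup>L \<pi> c) ` couplings \<mu> \<nu>)"
  proof (rule bdd_belowI2[where m="-C"])
    fix \<pi> assume "\<pi> \<in> couplings \<mu> \<nu>"
    from abs_integral_prob_le[OF XY couplingsD(1,2)[OF this] c C[rule_format]]
    show "- C \<le> integral\<^sup>L \<pi> c" by (simp add: abs_le_iff)
  qed
  then show ?thesis unfolding OT_def using \<pi> by (rule cINF_lower)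
qed

lemma OT_ge:
  assumes "couplings \<mu> \<nu> \<noteq> {}" "\<And>\<pi>. \<pi> \<in> couplings \<mu> \<nu> \<Longrightarrow> k \<le> integral\<^sup>L \<pi> c"
  shows "k \<le> OT \<mu> \<nu> c"
  unfolding OT_def using assms by (rule cINF_greatest)

text \<open>Weak duality puts the optimal value between two equal numbers, so a plan and a potential
  with the same value certify each other.\<close>

lemma dual_attained_imp_opt:
  fixes c :: "'x::metric_space \<times> 'y::metric_space \<Rightarrow> real"
  assumes X: "compact (UNIV :: 'x set)" and Y: "compact (UNIV :: 'y set)"
    and c: "continuous_on UNIV c" and f: "\<forall>x. \<bar>f x\<bar> \<le> D" and \<pi>: "\<pi> \<in> couplings \<mu> \<nu>"
    and eq: "integral\<^sup>L \<pi> c = integral\<^sup>L \<mu> (cctrans c f) + integral\<^sup>L \<nu> (ctrans c f)"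
  shows "\<pi> \<in> opt_plans \<mu> \<nu> c" "OT \<mu> \<nu> c = integral\<^sup>L \<mu> (cctrans c f) + integral\<^sup>L \<nu> (ctrans c f)"
proof -
  have "integral\<^sup>L \<pi> c \<le> OT \<mu> \<nu> c"
    unfolding eq using \<pi> by (intro OT_ge weak_duality[OF X Y c f]) auto
  with OT_le[OF X Y c \<pi>] have "OT \<mu> \<nu> c = integral\<^sup>L \<pi> c" by simp
  with \<pi> eq show "\<pi> \<in> opt_plans \<mu> \<nu> c"
    "OT \<mu> \<nu> c = integral\<^sup>L \<mu> (cctrans c f) + integral\<^sup>L \<nu> (ctrans c f)"
    by (auto simp: opt_plans_def)
qed

lemma Fclass_bounded: "f \<in> Fclass B w \<Longrightarrow> \<forall>x. \<bar>f x\<bar> \<le> 2 * B"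
  by (simp add: Fclass_def)

lemma emp_meas_duality:
  fixes c :: "'x::metric_space \<times> 'y::metric_space \<Rightarrow> real" and x :: "nat \<Rightarrow> 'x" and y :: "nat \<Rightarrow> 'y"
  assumes X: "compact (UNIV :: 'x set)" and Y: "compact (UNIV :: 'y set)"
    and c: "continuous_on UNIV c" and N: "0 < N" and M: "0 < M" and C: "\<forall>p. \<bar>c p\<bar> \<le> C"
    and W: "\<forall>x x' y. \<bar>c (x, y) - c (x', y)\<bar> \<le> W (dist x x')"
  obtains \<pi> f where "\<pi> \<in> couplings (emp_meas N x) (emp_meas M y)" "f \<in> Fclass C W"
    "integral\<^sup>L \<pi> c = integral\<^sup>L (emp_meas N x) (cctrans c f) + integral\<^sup>L (emp_meas M y) (ctrans c f)"
proof -
  obtain n x' y' f where n: "0 < n" and ex: "emp_meas n x' = emp_meas N x" and ey: "emp_meas n y' = emp_meas M y"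
    and \<pi>: "emp_meas n (\<lambda>i. (x' i, y' i)) \<in> couplings (emp_meas N x) (emp_meas M y)"
    and f: "f \<in> Fclass C W"
    and eq: "\<And>i. i < n \<Longrightarrow> cctrans c f (x' i) + ctrans c f (y' i) = c (x' i, y' i)"
    by (rule emp_meas_dual_coupling[OF N M C W, of x y]) blast
  note fb = Fclass_bounded[OF f]
  have "integral\<^sup>L (emp_meas n (\<lambda>i. (x' i, y' i))) c = (\<Sum>i<n. c (x' i, y' i)) / real n"
    using n borel_measurable_continuous_onI[OF c] by (rule integral_emp_meas)
  also have "\<dots> = (\<Sum>i<n. cctrans c f (x' i)) / real n + (\<Sum>i<n. ctrans c f (y' i)) / real n"
    using eq by (simp flip: add_divide_distrib sum.distrib)
  also have "\<dots> = integral\<^sup>L (emp_meas n x') (cctrans c f) + integral\<^sup>L (emp_meas n y') (ctrans c f)"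
    using integral_emp_meas[OF n borel_measurable_continuous_onI[OF continuous_cctrans[OF X Y c fb]]]
      integral_emp_meas[OF n borel_measurable_continuous_onI[OF continuous_ctrans[OF X Y c fb]]] by simp
  finally show ?thesis using that[OF \<pi> f] ex ey by simp
qed

text \<open>The plans \<open>\<rho> j\<close> need not couple \<open>\<mu>\<close> and
  \<open>\<nu>\<close>: it suffices that their marginals converge on bounded Lipschitz functions,
  which determine the marginals of the limit. This covers empirical plans as well as nearly optimal
  ones.\<close>

lemma weak_limit_coupling:
  fixes \<mu> :: "'x::metric_space measure" and \<nu> :: "'y::metric_space measure"
  assumes \<mu>: "prob_space \<mu>" "sets \<mu> = sets borel" and \<nu>: "prob_space \<nu>" "sets \<nu> = sets borel"
    and \<pi>: "prob_space \<pi>" "sets \<pi> = sets borel"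
    and lim: "\<And>h::'x \<times> 'y \<Rightarrow> real. continuous_on UNIV h \<Longrightarrow> (\<lambda>j. integral\<^sup>L (\<rho> j) h) \<longlonglongrightarrow> integral\<^sup>L \<pi> h"
    and l1: "\<And>g. g \<in> Fclass (1/2) (\<lambda>t. t) \<Longrightarrow> (\<lambda>j. integral\<^sup>L (\<rho> j) (\<lambda>p. g (fst p))) \<longlonglongrightarrow> integral\<^sup>L \<mu> g"
    and l2: "\<And>g. g \<in> Fclass (1/2) (\<lambda>t. t) \<Longrightarrow> (\<lambda>j. integral\<^sup>L (\<rho> j) (\<lambda>p. g (snd p))) \<longlonglongrightarrow> integral\<^sup>L \<nu> g"
  shows "\<pi> \<in> couplings \<mu> \<nu>"
proof -
  have w: "((\<lambda>t. t) \<longlongrightarrow> 0) (at_right (0::real))" by (rule tendsto_ident_at)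
  have fst: "fst \<in> measurable \<pi> borel" and snd: "snd \<in> measurable \<pi> borel"
    using measurable_fst_snd_borel[OF \<pi>(2)] by auto
  have "distr \<pi> borel fst = \<mu>"
  proof (rule measure_eqI_bounded_Lipschitz[OF prob_space.prob_space_distr[OF \<pi>(1) fst] _ \<mu>])
    fix g :: "'x \<Rightarrow> real" assume g: "g \<in> Fclass (1/2) (\<lambda>t. t)"
    note gc = Fclass_continuous[OF w g]
    have "continuous_on UNIV (\<lambda>p :: 'x \<times> 'y. g (fst p))"
      by (intro continuous_on_compose2[OF gc] continuous_intros) auto
    from LIMSEQ_unique[OF lim[OF this] l1[OF g]]
    show "integral\<^sup>L (distr \<pi> borel fst) g = integral\<^sup>L \<mu> g"
      using integral_distr_fst_snd(1)[OF \<pi>(2) gc] by simp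
  qed simp
  moreover have "distr \<pi> borel snd = \<nu>"
  proof (rule measure_eqI_bounded_Lipschitz[OF prob_space.prob_space_distr[OF \<pi>(1) snd] _ \<nu>])
    fix g :: "'y \<Rightarrow> real" assume g: "g \<in> Fclass (1/2) (\<lambda>t. t)"
    note gc = Fclass_continuous[OF w g]
    have "continuous_on UNIV (\<lambda>p :: 'x \<times> 'y. g (snd p))"
      by (intro continuous_on_compose2[OF gc] continuous_intros) auto
    from LIMSEQ_unique[OF lim[OF this] l2[OF g]]
    show "integral\<^sup>L (distr \<pi> borel snd) g = integral\<^sup>L \<nu> g"
      using integral_distr_fst_snd(2)[OF \<pi>(2) gc] by simp
  qed simp
  ultimately show ?thesis using \<pi> by (simp add: couplings_def)
qed

lemma tendsto_if_abs_diff_le_inverse: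
  assumes "\<And>j. \<bar>a j - l\<bar> \<le> 1 / real (Suc j)"
  shows "a \<longlonglongrightarrow> (l::real)"
proof -
  have "(\<lambda>j. 1 / real (Suc j)) \<longlonglongrightarrow> 0" by (rule LIMSEQ_Suc[OF lim_1_over_n])
  then have "(\<lambda>j. a j - l) \<longlonglongrightarrow> 0"
    by (rule Lim_null_comparison[rotated]) (use assms in auto)
  then show ?thesis by (simp add: LIM_zero_iff)
qed

text \<open>Plans and potentials pass to the limit along one subsequence, the plans weakly and the
  potentials uniformly, so that equality of primal and dual values survives. The conclusion contains
  strong duality and both attainments at once.\<close>

lemma duality_by_approximation:
  fixes c :: "'x::metric_space \<times> 'y::metric_space \<Rightarrow> real"
  assumes X: "compact (UNIV :: 'x set)" and Y: "compact (UNIV :: 'y set)"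
    and c: "continuous_on UNIV c" and C: "\<forall>p. \<bar>c p\<bar> \<le> C"
    and W: "\<forall>x x' y. \<bar>c (x, y) - c (x', y)\<bar> \<le> W (dist x x')" and W0: "(W \<longlongrightarrow> 0) (at_right 0)"
    and \<mu>: "prob_space \<mu>" "sets \<mu> = sets borel" and \<nu>: "prob_space \<nu>" "sets \<nu> = sets borel"
    and approx: "\<forall>j. \<exists>n x y. 0 < n \<and>
      (\<forall>g\<in>Fclass (1/2) (\<lambda>t. t). \<bar>integral\<^sup>L (emp_meas n x) g - integral\<^sup>L \<mu> g\<bar> \<le> 1 / real (Suc j)) \<and>
      (\<forall>g\<in>Fclass (1/2) (\<lambda>t. t). \<bar>integral\<^sup>L (emp_meas n y) g - integral\<^sup>L \<nu> g\<bar> \<le> 1 / real (Suc j))"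
  obtains \<pi> f where "\<pi> \<in> couplings \<mu> \<nu>" "f \<in> Fclass C W"
    "integral\<^sup>L \<pi> c = integral\<^sup>L \<mu> (cctrans c f) + integral\<^sup>L \<nu> (ctrans c f)"
proof -
  note XY = compact_UNIV_prod[OF X Y]
  obtain n x y where n: "\<And>j. 0 < n j"
    and ax: "\<And>j. \<forall>g\<in>Fclass (1/2) (\<lambda>t. t). \<bar>integral\<^sup>L (emp_meas (n j) (x j)) g - integral\<^sup>L \<mu> g\<bar> \<le> 1 / real (Suc j)"
    and ay: "\<And>j. \<forall>g\<in>Fclass (1/2) (\<lambda>t. t). \<bar>integral\<^sup>L (emp_meas (n j) (y j)) g - integral\<^sup>L \<nu> g\<bar> \<le> 1 / real (Suc j)"
    using approx unfolding choice_iff by blast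
  have "\<forall>j. \<exists>\<pi> f. \<pi> \<in> couplings (emp_meas (n j) (x j)) (emp_meas (n j) (y j)) \<and> f \<in> Fclass C W \<and>
    integral\<^sup>L \<pi> c = integral\<^sup>L (emp_meas (n j) (x j)) (cctrans c f) + integral\<^sup>L (emp_meas (n j) (y j)) (ctrans c f)"
  proof
    fix j
    show "\<exists>\<pi> f. \<pi> \<in> couplings (emp_meas (n j) (x j)) (emp_meas (n j) (y j)) \<and> f \<in> Fclass C W \<and>
    integral\<^sup>L \<pi> c = integral\<^sup>L (emp_meas (n j) (x j)) (cctrans c f) + integral\<^sup>L (emp_meas (n j) (y j)) (ctrans c f)"
      by (rule emp_meas_duality[OF X Y c n[of j] n[of j] C W, of "x j" "y j"]) blast
  qed
  then obtain \<rho> f where \<rho>: "\<And>j. \<rho> j \<in> couplings (emp_meas (n j) (x j)) (emp_meas (n j) (y j))"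
    and f: "\<And>j. f j \<in> Fclass C W"
    and eq: "\<And>j. integral\<^sup>L (\<rho> j) c = integral\<^sup>L (emp_meas (n j) (x j)) (cctrans c (f j)) + integral\<^sup>L (emp_meas (n j) (y j)) (ctrans c (f j))"
    unfolding choice_iff by blast
  obtain r g where r: "strict_mono (r :: nat \<Rightarrow> nat)" and g: "g \<in> Fclass C W"
    and ul: "uniform_limit UNIV (\<lambda>j. f (r j)) g sequentially"
    by (rule Fclass_convergent_subseq[of W f C, OF X W0 f])
  have "\<exists>r' \<pi>. strict_mono (r' :: nat \<Rightarrow> nat) \<and> prob_space \<pi> \<and> sets \<pi> = sets borel \<and>
    (\<forall>h::'x \<times> 'y \<Rightarrow> real. continuous_on UNIV h \<longrightarrow>
       (\<lambda>j. integral\<^sup>L (\<rho> (r (r' j))) h) \<longlonglongrightarrow> integral\<^sup>L \<pi> h)"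
    using couplingsD(1,2)[OF \<rho>] by (intro compact_prob_weak_limit[OF XY]) auto
  then obtain r' \<pi> where r': "strict_mono (r' :: nat \<Rightarrow> nat)" and \<pi>: "prob_space \<pi>" "sets \<pi> = sets borel"
    and lim: "\<And>h::'x \<times> 'y \<Rightarrow> real. continuous_on UNIV h \<Longrightarrow> (\<lambda>j. integral\<^sup>L (\<rho> (r (r' j))) h) \<longlonglongrightarrow> integral\<^sup>L \<pi> h"
    by blast
  define q where "q = r \<circ> r'"
  have q: "strict_mono q" unfolding q_def using r r' by (rule strict_mono_o)
  have w: "((\<lambda>t. t) \<longlongrightarrow> 0) (at_right (0::real))" by (rule tendsto_ident_at)
  have limq: "(\<lambda>j. integral\<^sup>L (\<rho> (q j)) h) \<longlonglongrightarrow> integral\<^sup>L \<pi> h" if "continuous_on UNIV h" for h :: "'x \<times> 'y \<Rightarrow> real"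
    using lim[OF that] by (simp add: q_def)
  have \<pi>c: "\<pi> \<in> couplings \<mu> \<nu>"
  proof (rule weak_limit_coupling[OF \<mu> \<nu> \<pi> limq])
    fix g :: "'x \<Rightarrow> real" assume g: "g \<in> Fclass (1/2) (\<lambda>t. t)"
    have "(\<lambda>j. integral\<^sup>L (\<rho> j) (\<lambda>p. g (fst p))) \<longlonglongrightarrow> integral\<^sup>L \<mu> g"
      using ax g integral_coupling(1)[OF \<rho> Fclass_continuous[OF w g]]
      by (intro tendsto_if_abs_diff_le_inverse) simp
    from LIMSEQ_subseq_LIMSEQ[OF this q]
    show "(\<lambda>j. integral\<^sup>L (\<rho> (q j)) (\<lambda>p. g (fst p))) \<longlonglongrightarrow> integral\<^sup>L \<mu> g" by (simp add: o_def)
  next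
    fix g :: "'y \<Rightarrow> real" assume g: "g \<in> Fclass (1/2) (\<lambda>t. t)"
    have "(\<lambda>j. integral\<^sup>L (\<rho> j) (\<lambda>p. g (snd p))) \<longlonglongrightarrow> integral\<^sup>L \<nu> g"
      using ay g integral_coupling(2)[OF \<rho> Fclass_continuous[OF w g]]
      by (intro tendsto_if_abs_diff_le_inverse) simp
    from LIMSEQ_subseq_LIMSEQ[OF this q]
    show "(\<lambda>j. integral\<^sup>L (\<rho> (q j)) (\<lambda>p. g (snd p))) \<longlonglongrightarrow> integral\<^sup>L \<nu> g" by (simp add: o_def)
  qed
  note gb = Fclass_bounded[OF g]
  note gc = continuous_ctrans[OF X Y c gb] and gcc = continuous_cctrans[OF X Y c gb]
  have L1: "(\<lambda>j. integral\<^sup>L (emp_meas (n (q j)) (x (q j))) (cctrans c g)) \<longlonglongrightarrow> integral\<^sup>L \<mu> (cctrans c g)"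
  proof -
    have "continuous_on UNIV (\<lambda>p :: 'x \<times> 'y. cctrans c g (fst p))"
      by (intro continuous_on_compose2[OF gcc] continuous_intros) auto
    from limq[OF this] show ?thesis
      using integral_coupling(1)[OF \<rho> gcc] integral_coupling(1)[OF \<pi>c gcc] by simp
  qed
  have L2: "(\<lambda>j. integral\<^sup>L (emp_meas (n (q j)) (y (q j))) (ctrans c g)) \<longlonglongrightarrow> integral\<^sup>L \<nu> (ctrans c g)"
  proof -
    have "continuous_on UNIV (\<lambda>p :: 'x \<times> 'y. ctrans c g (snd p))"
      by (intro continuous_on_compose2[OF gc] continuous_intros) auto
    from limq[OF this] show ?thesis
      using integral_coupling(2)[OF \<rho> gc] integral_coupling(2)[OF \<pi>c gc] by simp
  qed
  have ulq: "uniform_limit UNIV (\<lambda>j. f (q j)) g sequentially"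
    unfolding q_def o_def using ul r' filterlim_subseq
    by (auto intro: filterlim_compose[of "\<lambda>j. f (r j)"])
  \<comment> \<open>Measures and potentials both vary with \<open>j\<close>. Replacing
    \<open>f (q j)\<close> by \<open>g\<close> costs at most \<open>e / 3\<close> in each of the two
    integrals, whatever the measures are; for the fixed \<open>g\<close> the limits are
    known.\<close>
  have "(\<lambda>j. integral\<^sup>L (\<rho> (q j)) c) \<longlonglongrightarrow> integral\<^sup>L \<mu> (cctrans c g) + integral\<^sup>L \<nu> (ctrans c g)"
  proof (rule Lim_transform2[OF tendsto_add[OF L1 L2]], rule LIMSEQ_I)
    fix e :: real assume "0 < e"
    then have "0 < e / 3" by simp
    from uniform_limitD[OF ulq this] obtain j0 where j0: "\<And>j z. j \<ge> j0 \<Longrightarrow> dist (f (q j) z) (g z) < e / 3"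
      unfolding eventually_sequentially by blast
    have "norm (integral\<^sup>L (emp_meas (n (q j)) (x (q j))) (cctrans c g) + integral\<^sup>L (emp_meas (n (q j)) (y (q j))) (ctrans c g)
        - integral\<^sup>L (\<rho> (q j)) c - 0) < e" if j: "j \<ge> j0" for j
    proof -
      note fb = Fclass_bounded[OF f[of "q j"]]
      have d: "\<forall>z. \<bar>g z - f (q j) z\<bar> \<le> e / 3" using j0[OF j] by (auto simp: dist_real_def less_imp_le abs_minus_commute)
      have z: "\<forall>p. \<bar>c p - c p\<bar> \<le> 0" by simp
      have "\<bar>integral\<^sup>L (emp_meas (n (q j)) (x (q j))) (cctrans c g) - integral\<^sup>L (emp_meas (n (q j)) (x (q j))) (cctrans c (f (q j)))\<bar> \<le> 2 * 0 + e / 3"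
        by (rule abs_integral_prob_diff_le[OF X prob_space_emp_meas[OF n] sets_emp_meas gcc continuous_cctrans[OF X Y c fb]
            cctrans_diff_le[OF C gb C fb z d]])
      moreover have "\<bar>integral\<^sup>L (emp_meas (n (q j)) (y (q j))) (ctrans c g) - integral\<^sup>L (emp_meas (n (q j)) (y (q j))) (ctrans c (f (q j)))\<bar> \<le> 0 + e / 3"
        by (rule abs_integral_prob_diff_le[OF Y prob_space_emp_meas[OF n] sets_emp_meas gc continuous_ctrans[OF X Y c fb]
            ctrans_diff_le[OF C gb C fb _ d]]) auto
      ultimately show ?thesis using eq[of "q j"] \<open>0 < e\<close> by (simp only: real_norm_def)
    qed
    then show "\<exists>no. \<forall>j\<ge>no. norm (integral\<^sup>L (emp_meas (n (q j)) (x (q j))) (cctrans c g) + integral\<^sup>L (emp_meas (n (q j)) (y (q j))) (ctrans c g)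
        - integral\<^sup>L (\<rho> (q j)) c - 0) < e" by blast
  qed
  from LIMSEQ_unique[OF limq[OF c] this] show ?thesis using that \<pi>c g by blast
qed

section \<open>Nearly optimal plans and the uniform law of large numbers\<close>

text \<open>Marginals are prescribed only up to \<open>e\<close> on bounded Lipschitz functions,
  because a plan between empirical measures does not couple \<open>\<mu>\<close> and
  \<open>\<nu>\<close>. The sets shrink with \<open>e\<close>, which makes infima over them
  monotone.\<close>

definition near_opt_plans :: "'x::metric_space measure \<Rightarrow> 'y::metric_space measure
    \<Rightarrow> ('x \<times> 'y \<Rightarrow> real) \<Rightarrow> real \<Rightarrow> ('x \<times> 'y) measure set" where
  "near_opt_plans \<mu> \<nu> c e = {\<pi>. prob_space \<pi> \<and> sets \<pi> = sets borel \<and>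
     (\<forall>g\<in>Fclass (1/2) (\<lambda>t. t). \<bar>integral\<^sup>L \<pi> (\<lambda>p. g (fst p)) - integral\<^sup>L \<mu> g\<bar> \<le> e) \<and>
     (\<forall>g\<in>Fclass (1/2) (\<lambda>t. t). \<bar>integral\<^sup>L \<pi> (\<lambda>p. g (snd p)) - integral\<^sup>L \<nu> g\<bar> \<le> e) \<and>
     integral\<^sup>L \<pi> c \<le> OT \<mu> \<nu> c + e}"

lemma tendsto_id_at_right: "((\<lambda>t. t) \<longlongrightarrow> 0) (at_right (0::real))"
  by (rule tendsto_ident_at)

lemma opt_plans_subset_near:
  fixes \<mu> :: "'x::metric_space measure" and \<nu> :: "'y::metric_space measure"
  assumes "0 \<le> e"
  shows "opt_plans \<mu> \<nu> c \<subseteq> near_opt_plans \<mu> \<nu> c e"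
proof
  fix \<pi> assume "\<pi> \<in> opt_plans \<mu> \<nu> c"
  then have \<pi>: "\<pi> \<in> couplings \<mu> \<nu>" "integral\<^sup>L \<pi> c = OT \<mu> \<nu> c" by (auto simp: opt_plans_def)
  show "\<pi> \<in> near_opt_plans \<mu> \<nu> c e"
    unfolding near_opt_plans_def
  proof (intro CollectI conjI ballI)
    show "\<bar>integral\<^sup>L \<pi> (\<lambda>p. g (fst p)) - integral\<^sup>L \<mu> g\<bar> \<le> e" if "g \<in> Fclass (1/2) (\<lambda>t. t)" for g
      using integral_coupling(1)[OF \<pi>(1) Fclass_continuous[OF tendsto_id_at_right that]] assms by simp
    show "\<bar>integral\<^sup>L \<pi> (\<lambda>p. g (snd p)) - integral\<^sup>L \<nu> g\<bar> \<le> e" if "g \<in> Fclass (1/2) (\<lambda>t. t)" for g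
      using integral_coupling(2)[OF \<pi>(1) Fclass_continuous[OF tendsto_id_at_right that]] assms by simp
  qed (use couplingsD[OF \<pi>(1)] assms \<pi>(2) in auto)
qed

lemma near_opt_plans_mono:
  assumes "e \<le> e'"
  shows "near_opt_plans \<mu> \<nu> c e \<subseteq> near_opt_plans \<mu> \<nu> c e'"
proof
  fix \<pi> assume \<pi>: "\<pi> \<in> near_opt_plans \<mu> \<nu> c e"
  show "\<pi> \<in> near_opt_plans \<mu> \<nu> c e'"
    unfolding near_opt_plans_def
  proof (intro CollectI conjI ballI)
    show "prob_space \<pi>" "sets \<pi> = sets borel" using \<pi> by (simp_all add: near_opt_plans_def)
    have "integral\<^sup>L \<pi> c \<le> OT \<mu> \<nu> c + e" using \<pi> by (simp add: near_opt_plans_def)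
    then show "integral\<^sup>L \<pi> c \<le> OT \<mu> \<nu> c + e'" using assms by linarith
  next
    fix g :: "'a \<Rightarrow> real" assume "g \<in> Fclass (1/2) (\<lambda>t. t)"
    then have "\<bar>integral\<^sup>L \<pi> (\<lambda>p. g (fst p)) - integral\<^sup>L \<mu> g\<bar> \<le> e" using \<pi> by (simp add: near_opt_plans_def)
    then show "\<bar>integral\<^sup>L \<pi> (\<lambda>p. g (fst p)) - integral\<^sup>L \<mu> g\<bar> \<le> e'" using assms by linarith
  next
    fix g :: "'b \<Rightarrow> real" assume "g \<in> Fclass (1/2) (\<lambda>t. t)"
    then have "\<bar>integral\<^sup>L \<pi> (\<lambda>p. g (snd p)) - integral\<^sup>L \<nu> g\<bar> \<le> e" using \<pi> by (simp add: near_opt_plans_def)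
    then show "\<bar>integral\<^sup>L \<pi> (\<lambda>p. g (snd p)) - integral\<^sup>L \<nu> g\<bar> \<le> e'" using assms by linarith
  qed
qed

lemma near_opt_limit:
  fixes c :: "'x::metric_space \<times> 'y::metric_space \<Rightarrow> real"
  assumes X: "compact (UNIV :: 'x set)" and Y: "compact (UNIV :: 'y set)"
    and c: "continuous_on UNIV c"
    and \<mu>: "prob_space \<mu>" "sets \<mu> = sets borel" and \<nu>: "prob_space \<nu>" "sets \<nu> = sets borel"
    and \<rho>: "\<And>j. \<rho> j \<in> near_opt_plans \<mu> \<nu> c (1 / real (Suc j))"
  obtains r \<pi> where "strict_mono (r :: nat \<Rightarrow> nat)" "\<pi> \<in> opt_plans \<mu> \<nu> c"
    "\<And>h::'x \<times> 'y \<Rightarrow> real. continuous_on UNIV h \<Longrightarrow> (\<lambda>j. integral\<^sup>L (\<rho> (r j)) h) \<longlonglongrightarrow> integral\<^sup>L \<pi> h"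
proof -
  note XY = compact_UNIV_prod[OF X Y]
  have "\<exists>r \<pi>. strict_mono (r :: nat \<Rightarrow> nat) \<and> prob_space \<pi> \<and> sets \<pi> = sets borel \<and>
    (\<forall>h::'x \<times> 'y \<Rightarrow> real. continuous_on UNIV h \<longrightarrow>
       (\<lambda>j. integral\<^sup>L (\<rho> (r j)) h) \<longlonglongrightarrow> integral\<^sup>L \<pi> h)"
    using \<rho> by (intro compact_prob_weak_limit[OF XY]) (auto simp: near_opt_plans_def)
  then obtain r \<pi> where r: "strict_mono (r :: nat \<Rightarrow> nat)" and \<pi>: "prob_space \<pi>" "sets \<pi> = sets borel"
    and lim: "\<And>h::'x \<times> 'y \<Rightarrow> real. continuous_on UNIV h \<Longrightarrow> (\<lambda>j. integral\<^sup>L (\<rho> (r j)) h) \<longlonglongrightarrow> integral\<^sup>L \<pi> h"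
    by blast
  have \<pi>c: "\<pi> \<in> couplings \<mu> \<nu>"
  proof (rule weak_limit_coupling[OF \<mu> \<nu> \<pi> lim])
    fix g :: "'x \<Rightarrow> real" assume g: "g \<in> Fclass (1/2) (\<lambda>t. t)"
    have "(\<lambda>j. integral\<^sup>L (\<rho> j) (\<lambda>p. g (fst p))) \<longlonglongrightarrow> integral\<^sup>L \<mu> g"
      using \<rho> g by (intro tendsto_if_abs_diff_le_inverse) (simp add: near_opt_plans_def)
    from LIMSEQ_subseq_LIMSEQ[OF this r]
    show "(\<lambda>j. integral\<^sup>L (\<rho> (r j)) (\<lambda>p. g (fst p))) \<longlonglongrightarrow> integral\<^sup>L \<mu> g" by (simp add: o_def)
  next
    fix g :: "'y \<Rightarrow> real" assume g: "g \<in> Fclass (1/2) (\<lambda>t. t)"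
    have "(\<lambda>j. integral\<^sup>L (\<rho> j) (\<lambda>p. g (snd p))) \<longlonglongrightarrow> integral\<^sup>L \<nu> g"
      using \<rho> g by (intro tendsto_if_abs_diff_le_inverse) (simp add: near_opt_plans_def)
    from LIMSEQ_subseq_LIMSEQ[OF this r]
    show "(\<lambda>j. integral\<^sup>L (\<rho> (r j)) (\<lambda>p. g (snd p))) \<longlonglongrightarrow> integral\<^sup>L \<nu> g" by (simp add: o_def)
  qed
  have "integral\<^sup>L \<pi> c \<le> OT \<mu> \<nu> c + 0"
  proof (rule LIMSEQ_le[OF lim[OF c]])
    have "(\<lambda>j. 1 / real (Suc j)) \<longlonglongrightarrow> 0" by (rule LIMSEQ_Suc[OF lim_1_over_n])
    from LIMSEQ_subseq_LIMSEQ[OF this r]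
    show "(\<lambda>j. OT \<mu> \<nu> c + 1 / real (Suc (r j))) \<longlonglongrightarrow> OT \<mu> \<nu> c + 0"
      by (intro tendsto_add tendsto_const) (simp add: o_def)
    show "\<exists>N. \<forall>j\<ge>N. integral\<^sup>L (\<rho> (r j)) c \<le> OT \<mu> \<nu> c + 1 / real (Suc (r j))"
      using \<rho> by (simp add: near_opt_plans_def)
  qed
  with OT_le[OF X Y c \<pi>c] have "\<pi> \<in> opt_plans \<mu> \<nu> c" using \<pi>c by (simp add: opt_plans_def)
  with r lim that show ?thesis by blast
qed

lemma bdd_plan_integrals:
  fixes h :: "'a::metric_space \<Rightarrow> real"
  assumes cpt: "compact (UNIV :: 'a set)" and h: "continuous_on UNIV h"
    and S: "\<And>\<pi>. \<pi> \<in> S \<Longrightarrow> prob_space \<pi> \<and> sets \<pi> = sets borel"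
  shows "bdd_below ((\<lambda>\<pi>. integral\<^sup>L \<pi> h) ` S)"
proof -
  obtain C where C: "\<forall>p. \<bar>h p\<bar> \<le> C" by (rule continuous_compact_bounded[OF cpt h])
  show ?thesis
  proof (rule bdd_belowI2[where m="-C"])
    fix \<pi> assume "\<pi> \<in> S"
    then have "prob_space \<pi>" "sets \<pi> = sets borel" using S by auto
    from abs_integral_prob_le[OF cpt this h C[rule_format]]
    show "- C \<le> integral\<^sup>L \<pi> h" by (simp add: abs_le_iff)
  qed
qed

lemma near_opt_plansD:
  "\<pi> \<in> near_opt_plans \<mu> \<nu> c e \<Longrightarrow> prob_space \<pi> \<and> sets \<pi> = sets borel"
  by (simp add: near_opt_plans_def)

lemma opt_plansD: "\<pi> \<in> opt_plans \<mu> \<nu> c \<Longrightarrow> prob_space \<pi> \<and> sets \<pi> = sets borel"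
  by (simp add: opt_plans_def couplings_def)

text \<open>The infima increase with \<open>j\<close> and stay below the one over optimal plans. If
  they stayed away from it, witnesses \<open>\<rho> j\<close> would cluster at an optimal plan whose
  integral is too small.\<close>

lemma INF_near_opt_tendsto:
  fixes c :: "'x::metric_space \<times> 'y::metric_space \<Rightarrow> real"
  assumes X: "compact (UNIV :: 'x set)" and Y: "compact (UNIV :: 'y set)"
    and c: "continuous_on UNIV c"
    and \<mu>: "prob_space \<mu>" "sets \<mu> = sets borel" and \<nu>: "prob_space \<nu>" "sets \<nu> = sets borel"
    and ne: "opt_plans \<mu> \<nu> c \<noteq> {}" and h: "continuous_on UNIV (h :: 'x \<times> 'y \<Rightarrow> real)"
  shows "(\<lambda>j. INF \<pi>\<in>near_opt_plans \<mu> \<nu> c (1 / real (Suc j)). integral\<^sup>L \<pi> h)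
    \<longlonglongrightarrow> (INF \<pi>\<in>opt_plans \<mu> \<nu> c. integral\<^sup>L \<pi> h)"
proof -
  note XY = compact_UNIV_prod[OF X Y]
  define S where "S j = near_opt_plans \<mu> \<nu> c (1 / real (Suc j))" for j
  define I where "I = (INF \<pi>\<in>opt_plans \<mu> \<nu> c. integral\<^sup>L \<pi> h)"
  define J where "J j = (INF \<pi>\<in>S j. integral\<^sup>L \<pi> h)" for j
  have bS: "bdd_below ((\<lambda>\<pi>. integral\<^sup>L \<pi> h) ` S j)" for j
    unfolding S_def by (rule bdd_plan_integrals[OF XY h near_opt_plansD])
  have bO: "bdd_below ((\<lambda>\<pi>. integral\<^sup>L \<pi> h) ` opt_plans \<mu> \<nu> c)"
    by (rule bdd_plan_integrals[OF XY h opt_plansD])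
  have sub: "opt_plans \<mu> \<nu> c \<subseteq> S j" for j unfolding S_def by (rule opt_plans_subset_near) simp
  have neS: "S j \<noteq> {}" for j using ne sub[of j] by blast
  have le: "J j \<le> I" for j unfolding J_def I_def by (rule cINF_superset_mono[OF ne bS sub]) simp
  have dec: "S j' \<subseteq> S j" if "j \<le> j'" for j j'
  proof -
    have "1 / real (Suc j') \<le> 1 / real (Suc j)" using that by (intro divide_left_mono) auto
    then show ?thesis unfolding S_def by (rule near_opt_plans_mono)
  qed
  have mono: "J j \<le> J j'" if "j \<le> j'" for j j'
    unfolding J_def by (rule cINF_superset_mono[OF neS bS dec[OF that]]) simp
  have ex: "\<exists>j. J j > I - e" if "0 < e" for e
  proof (rule ccontr)
    assume "\<not> ?thesis"
    then have "J j \<le> I - e" for j by (simp add: not_less)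
    \<comment> \<open>Half of \<open>e\<close> is given away to obtain strict inequalities, which
      provide witnesses whether or not the infimum is attained.\<close>
    then have lt: "J j < I - e / 2" for j using \<open>0 < e\<close> order.strict_trans1[of "J j" "I - e" "I - e / 2"] by simp
    have "\<forall>j. \<exists>\<pi>. \<pi> \<in> S j \<and> integral\<^sup>L \<pi> h < I - e / 2"
    proof
      fix j show "\<exists>\<pi>. \<pi> \<in> S j \<and> integral\<^sup>L \<pi> h < I - e / 2"
        using lt[of j] unfolding J_def cINF_less_iff[OF neS bS] by blast
    qed
    then obtain \<rho> where \<rho>: "\<And>j. \<rho> j \<in> S j" "\<And>j. integral\<^sup>L (\<rho> j) h < I - e / 2"
      unfolding choice_iff by blast
    obtain r \<pi> where \<pi>: "\<pi> \<in> opt_plans \<mu> \<nu> c" and lim: "(\<lambda>j. integral\<^sup>L (\<rho> (r j)) h) \<longlonglongrightarrow> integral\<^sup>L \<pi> h"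
      by (rule near_opt_limit[OF X Y c \<mu> \<nu> \<rho>(1)[unfolded S_def]]) (use h in blast)
    have "integral\<^sup>L \<pi> h \<le> I - e / 2"
      using \<rho>(2) by (intro LIMSEQ_le_const2[OF lim]) (auto intro: less_imp_le)
    moreover have "I \<le> integral\<^sup>L \<pi> h" unfolding I_def by (rule cINF_lower[OF bO \<pi>])
    ultimately show False using \<open>0 < e\<close> by linarith
  qed
  have "\<exists>no. \<forall>j\<ge>no. norm (J j - I) < e" if "0 < e" for e
  proof -
    obtain j0 where j0: "J j0 > I - e" using ex[OF \<open>0 < e\<close>] by blast
    have "norm (J j - I) < e" if "j0 \<le> j" for j
      using j0 mono[OF that] le[of j] by (simp add: abs_less_iff)
    then show ?thesis by blast
  qed
  then have "J \<longlonglongrightarrow> I" by (intro LIMSEQ_I)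
  then show ?thesis by (simp add: J_def[abs_def] I_def S_def)
qed

text \<open>Hoeffding's inequality and a union bound over a finite net of the Lipschitz class. The
  exceptional set serves all \<open>g\<close> at once and is measurable as a finite union.\<close>

lemma emp_meas_uniform_LLN:
  fixes X :: "nat \<Rightarrow> 'o \<Rightarrow> 'a::metric_space"
  assumes P: "prob_space P" and cpt: "compact (UNIV :: 'a set)"
    and X: "\<forall>i. X i \<in> borel_measurable P \<and> distr P borel (X i) = \<mu>"
    and indep: "prob_space.indep_vars P (\<lambda>_. borel) X UNIV" and e: "0 < e"
  obtains B where "\<And>n. B n \<in> sets P" "(\<lambda>n. measure P (B n)) \<longlonglongrightarrow> 0"
    "\<And>n \<omega> g. 0 < n \<Longrightarrow> \<omega> \<in> space P - B n \<Longrightarrow> g \<in> Fclass (1/2) (\<lambda>t. t) \<Longrightarrow>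
      \<bar>integral\<^sup>L (emp_meas n (\<lambda>i. X i \<omega>)) g - integral\<^sup>L \<mu> g\<bar> \<le> e"
proof -
  interpret prob_space P by fact
  let ?F = "Fclass (1/2) (\<lambda>t. t) :: ('a \<Rightarrow> real) set"
  have Xm: "X i \<in> borel_measurable P" for i using X by simp
  have e3: "0 < e / 3" using e by simp
  \<comment> \<open>One third of \<open>e\<close> is spent on replacing \<open>f\<close> by its
    neighbour in the net under the empirical measure, one third on the same under
    \<open>\<mu>\<close>, and one third on the deviation.\<close>
  obtain T where T: "T \<subseteq> ?F" "finite T" "\<forall>f\<in>?F. \<exists>g\<in>T. \<forall>x. \<bar>f x - g x\<bar> < e / 3"
    using Fclass_finite_net[OF cpt tendsto_id_at_right e3, of "1/2"] by blast
  have \<mu>: "prob_space \<mu>" "sets \<mu> = sets borel"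
  proof -
    have "\<mu> = distr P borel (X 0)" using X by simp
    then show "prob_space \<mu>" "sets \<mu> = sets borel" using prob_space_distr[OF Xm] by auto
  qed
  have Fc: "continuous_on UNIV g" if "g \<in> ?F" for g by (rule Fclass_continuous[OF tendsto_id_at_right that])
  define A where "A g n = {\<omega> \<in> space P. \<bar>(\<Sum>i<n. g (X i \<omega>)) / real n - integral\<^sup>L \<mu> g\<bar> \<ge> e / 3}" for g n
  have gX: "(\<lambda>\<omega>. g (X i \<omega>)) \<in> borel_measurable P" if "g \<in> ?F" for g i
    using Xm borel_measurable_continuous_onI[OF Fc[OF that]] by (rule measurable_compose)
  have Am: "A g n \<in> sets P" if "g \<in> ?F" for g n
  proof -
    have "(\<lambda>\<omega>. \<bar>(\<Sum>i<n. g (X i \<omega>)) / real n - integral\<^sup>L \<mu> g\<bar>) \<in> borel_measurable P"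
      using gX[OF that]
      by (intro borel_measurable_abs borel_measurable_diff borel_measurable_divide borel_measurable_sum borel_measurable_const)
    then show ?thesis unfolding A_def by (intro borel_measurable_le borel_measurable_const)
  qed
  \<comment> \<open>The 4 is the square of the width of the interval \<open>{- 1..1}\<close> that
    contains the values of \<open>g\<close>.\<close>
  have Ale: "measure P (A g n) \<le> 2 * exp (-2 * real n * (e/3)\<^sup>2 / 4)" if g: "g \<in> ?F" and n: "0 < n" for g n
  proof -
    have gm: "g \<in> borel_measurable borel" using borel_measurable_continuous_onI[OF Fc[OF g]] .
    interpret H: Hoeffding_ineq_iid P "{..<n}" "\<lambda>i \<omega>. g (X i \<omega>)" "\<lambda>\<omega>. g (X 0 \<omega>)" "-1" "1" "expectation (\<lambda>\<omega>. g (X 0 \<omega>))"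
    proof unfold_locales
      show "indep_vars (\<lambda>_. borel) (\<lambda>i \<omega>. g (X i \<omega>)) {..<n}"
        using gm by (intro indep_vars_compose2[OF indep_vars_subset[OF indep]]) auto
      show "distr P borel (\<lambda>\<omega>. g (X i \<omega>)) = distr P borel (\<lambda>\<omega>. g (X 0 \<omega>))" for i
        using distr_distr[OF gm Xm, of i] distr_distr[OF gm Xm, of 0] X by (simp add: o_def)
      show "AE \<omega> in P. g (X 0 \<omega>) \<in> {- 1..1}"
      proof (rule AE_I2)
        fix \<omega>
        have "\<bar>g (X 0 \<omega>)\<bar> \<le> 1" using Fclass_bounded[OF g] by simp
        then show "g (X 0 \<omega>) \<in> {- 1..1}" by auto
      qed
      show "random_variable borel (\<lambda>\<omega>. g (X 0 \<omega>))" by (rule gX[OF g])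
    qed auto
    have "expectation (\<lambda>\<omega>. g (X 0 \<omega>)) = integral\<^sup>L \<mu> g"
      using integral_distr[OF Xm gm, of 0] X by simp
    moreover have "{..<n} \<noteq> {}" using n by auto
    ultimately show ?thesis
      using H.Hoeffding_ineq_abs_ge'[of "e / 3"] e3 by (simp add: A_def)
  qed
  define B where "B n = (\<Union>g\<in>T. A g n)" for n
  have Bm: "B n \<in> sets P" for n unfolding B_def using T(1,2) Am by (intro sets.finite_UN) auto
  have Ble: "measure P (B n) \<le> real (card T) * (2 * exp (-2 * real n * (e/3)\<^sup>2 / 4))" if n: "0 < n" for n
  proof -
    have "measure P (B n) \<le> (\<Sum>g\<in>T. measure P (A g n))"
      unfolding B_def using T(1,2) Am by (intro finite_measure_subadditive_finite) auto
    also have "\<dots> \<le> (\<Sum>g\<in>T. 2 * exp (-2 * real n * (e/3)\<^sup>2 / 4))"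
      using Ale[OF _ n] T(1) by (intro sum_mono) auto
    finally show ?thesis by simp
  qed
  have "(\<lambda>n. real (card T) * (2 * exp (-2 * real n * (e/3)\<^sup>2 / 4))) \<longlonglongrightarrow> 0"
  proof -
    have "exp (-2 * real n * (e/3)\<^sup>2 / 4) = exp (- ((e/3)\<^sup>2 / 2)) ^ n" for n
      by (subst exp_of_nat_mult[symmetric]) simp
    moreover have "(\<lambda>n. exp (- ((e/3)\<^sup>2 / 2)) ^ n) \<longlonglongrightarrow> 0"
      using e3 by (intro LIMSEQ_realpow_zero) auto
    ultimately have "(\<lambda>n. exp (-2 * real n * (e/3)\<^sup>2 / 4)) \<longlonglongrightarrow> 0" by simp
    then show ?thesis by (intro tendsto_mult_right_zero)
  qed
  then have "(\<lambda>n. measure P (B n)) \<longlonglongrightarrow> 0"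
  proof (rule Lim_null_comparison[rotated])
    show "\<forall>\<^sub>F n in sequentially. norm (measure P (B n)) \<le> real (card T) * (2 * exp (-2 * real n * (e/3)\<^sup>2 / 4))"
      by (rule eventually_sequentiallyI[of 1]) (use Ble in simp)
  qed
  moreover have "\<bar>integral\<^sup>L (emp_meas n (\<lambda>i. X i \<omega>)) f - integral\<^sup>L \<mu> f\<bar> \<le> e"
    if n: "0 < n" and \<omega>: "\<omega> \<in> space P - B n" and f: "f \<in> ?F" for n \<omega> f
  proof -
    obtain g where g: "g \<in> T" "\<forall>x. \<bar>f x - g x\<bar> < e / 3" using T(3) f by blast
    have gF: "g \<in> ?F" using g(1) T(1) by blast
    have le: "\<bar>f x - g x\<bar> \<le> e / 3" for x using g(2) by (simp add: less_imp_le)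
    have "\<bar>integral\<^sup>L (emp_meas n (\<lambda>i. X i \<omega>)) f - integral\<^sup>L (emp_meas n (\<lambda>i. X i \<omega>)) g\<bar> \<le> e / 3"
      by (rule abs_integral_prob_diff_le[OF cpt prob_space_emp_meas[OF n] sets_emp_meas Fc[OF f] Fc[OF gF] le])
    moreover have "\<bar>integral\<^sup>L \<mu> f - integral\<^sup>L \<mu> g\<bar> \<le> e / 3"
      by (rule abs_integral_prob_diff_le[OF cpt \<mu> Fc[OF f] Fc[OF gF] le])
    moreover have "integral\<^sup>L (emp_meas n (\<lambda>i. X i \<omega>)) g = (\<Sum>i<n. g (X i \<omega>)) / real n"
      using n borel_measurable_continuous_onI[OF Fc[OF gF]] by (rule integral_emp_meas)
    moreover have "\<omega> \<notin> A g n" using \<omega> g(1) by (auto simp: B_def)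
    then have "\<bar>(\<Sum>i<n. g (X i \<omega>)) / real n - integral\<^sup>L \<mu> g\<bar> < e / 3" using \<omega> by (simp add: A_def)
    ultimately show ?thesis by linarith
  qed
  ultimately show ?thesis by (rule that[OF Bm])
qed

section \<open>Outer expectations and weak convergence\<close>

lemma pm_cont_compose:
  assumes "pm_cont d D h" "continuous_on UNIV (g :: real \<Rightarrow> real)"
  shows "pm_cont d D (\<lambda>x. g (h x))"
  unfolding pm_cont_def
proof (intro ballI allI impI)
  fix x e assume x: "x \<in> D" and "(0::real) < e"
  then obtain s where s: "0 < s" "\<And>t. \<bar>t - h x\<bar> < s \<Longrightarrow> \<bar>g t - g (h x)\<bar> < e"
    using assms(2) unfolding continuous_on_iff dist_real_def by (metis UNIV_I)
  obtain d' where "d' > 0" "\<forall>y\<in>D. d x y < d' \<longrightarrow> \<bar>h y - h x\<bar> < s"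
    using assms(1) x s(1) unfolding pm_cont_def by blast
  then show "\<exists>d'>0. \<forall>y\<in>D. d x y < d' \<longrightarrow> \<bar>g (h y) - g (h x)\<bar> < e"
    using s(2) by blast
qed

lemma pm_cont_add:
  assumes "pm_cont d D h" "pm_cont d D k"
  shows "pm_cont d D (\<lambda>x. h x + k x)"
  unfolding pm_cont_def
proof (intro ballI allI impI)
  fix x e assume x: "x \<in> D" and "(0::real) < e"
  then have e2: "0 < e / 2" by simp
  obtain d1 where d1: "d1 > 0" "\<forall>y\<in>D. d x y < d1 \<longrightarrow> \<bar>h y - h x\<bar> < e / 2"
    using assms(1) x e2 unfolding pm_cont_def by blast
  obtain d2 where d2: "d2 > 0" "\<forall>y\<in>D. d x y < d2 \<longrightarrow> \<bar>k y - k x\<bar> < e / 2"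
    using assms(2) x e2 unfolding pm_cont_def by blast
  have "\<bar>h y + k y - (h x + k x)\<bar> < e" if "y \<in> D" "d x y < min d1 d2" for y
  proof -
    have "\<bar>h y - h x\<bar> < e / 2" "\<bar>k y - k x\<bar> < e / 2" using that d1 d2 by auto
    then show ?thesis by linarith
  qed
  then show "\<exists>d'>0. \<forall>y\<in>D. d x y < d' \<longrightarrow> \<bar>h y + k y - (h x + k x)\<bar> < e"
    using d1 d2 by (intro exI[of _ "min d1 d2"]) auto
qed

lemma pm_cont_diff:
  assumes "pm_cont d D h" "pm_cont d D k"
  shows "pm_cont d D (\<lambda>x. h x - k x)"
proof -
  have "pm_cont d D (\<lambda>x. - k x)"
    using assms(2) by (rule pm_cont_compose) (intro continuous_intros)
  from pm_cont_add[OF assms(1) this] show ?thesis by simp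
qed

lemma pm_cont_Lipschitz:
  assumes "0 \<le> K" "\<And>x y. x \<in> D \<Longrightarrow> y \<in> D \<Longrightarrow> \<bar>h y - h x\<bar> \<le> K * d x y"
  shows "pm_cont d D h"
  unfolding pm_cont_def
proof (intro ballI allI impI)
  fix x e assume x: "x \<in> D" and e: "(0::real) < e"
  \<comment> \<open>The \<open>+ 1\<close> in the denominator covers the case
    \<open>K = 0\<close>.\<close>
  have "\<bar>h y - h x\<bar> < e" if y: "y \<in> D" "d x y < e / (K + 1)" for y
  proof -
    have "\<bar>h y - h x\<bar> \<le> K * d x y" using assms(2) x y(1) by blast
    also have "K * d x y \<le> K * (e / (K + 1))" using y(2) assms(1) by (intro mult_left_mono) auto
    also have "\<dots> < e" using assms(1) e by (simp add: divide_less_eq algebra_simps)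
    finally show ?thesis .
  qed
  then show "\<exists>d'>0. \<forall>y\<in>D. d x y < d' \<longrightarrow> \<bar>h y - h x\<bar> < e"
    using e assms(1) by (intro exI[of _ "e / (K + 1)"]) auto
qed

lemma borel_measurable_pm_cont:
  assumes "borel_into Q d D L" "pm_cont d D h"
  shows "(\<lambda>q. h (L q)) \<in> borel_measurable Q"
proof (rule borel_measurableI)
  fix S :: "real set" assume S: "open S"
  have "pm_open d D {x \<in> D. h x \<in> S}"
    unfolding pm_open_def
  proof (intro conjI ballI)
    fix x assume x: "x \<in> {x \<in> D. h x \<in> S}"
    then obtain e where e: "e > 0" "\<And>t. dist t (h x) < e \<Longrightarrow> t \<in> S" using S unfolding open_dist by blast
    then obtain d' where "d' > 0" "\<forall>y\<in>D. d x y < d' \<longrightarrow> \<bar>h y - h x\<bar> < e"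
      using assms(2) x unfolding pm_cont_def by blast
    then show "\<exists>e>0. \<forall>y\<in>D. d x y < e \<longrightarrow> y \<in> {x \<in> D. h x \<in> S}"
      using e(2) by (auto simp: dist_real_def)
  qed auto
  then have "{q \<in> space Q. L q \<in> {x \<in> D. h x \<in> S}} \<in> sets Q"
    using assms(1) unfolding borel_into_def by blast
  also have "{q \<in> space Q. L q \<in> {x \<in> D. h x \<in> S}} = (\<lambda>q. h (L q)) -` S \<inter> space Q"
    using assms(1) unfolding borel_into_def by auto
  finally show "(\<lambda>q. h (L q)) -` S \<inter> space Q \<in> sets Q" .
qed

section \<open>Outer expectation and outer probability\<close>

context prob_space
begin

lemma outer_exp_le:
  assumes U: "integrable M U" "\<And>x. x \<in> space M \<Longrightarrow> f x \<le> U x" and f: "\<And>x. x \<in> space M \<Longrightarrow> \<bar>f x\<bar> \<le> K"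
  shows "outer_exp M f \<le> integral\<^sup>L M U"
  unfolding outer_exp_def
proof (rule cInf_lower)
  show "integral\<^sup>L M U \<in> {integral\<^sup>L M U |U. U \<in> borel_measurable M \<and> integrable M U \<and> (\<forall>x\<in>space M. f x \<le> U x)}"
    using U by blast
  show "bdd_below {integral\<^sup>L M U |U. U \<in> borel_measurable M \<and> integrable M U \<and> (\<forall>x\<in>space M. f x \<le> U x)}"
  proof (rule bdd_belowI[where m="-K"])
    fix v assume "v \<in> {integral\<^sup>L M U |U. U \<in> borel_measurable M \<and> integrable M U \<and> (\<forall>x\<in>space M. f x \<le> U x)}"
    then obtain V where V: "v = integral\<^sup>L M V" "integrable M V" "\<And>x. x \<in> space M \<Longrightarrow> f x \<le> V x" by blast
    have "integral\<^sup>L M (\<lambda>x. - K) \<le> integral\<^sup>L M V"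
    proof (rule integral_mono)
      fix x assume x: "x \<in> space M" show "- K \<le> V x" using f[OF x] V(3)[OF x] by linarith
    qed (use V in auto)
    then show "- K \<le> v" using V by (simp add: prob_space)
  qed
qed

lemma outer_exp_ge:
  assumes f: "\<And>x. x \<in> space M \<Longrightarrow> \<bar>f x\<bar> \<le> K"
    and "\<And>U. integrable M U \<Longrightarrow> (\<And>x. x \<in> space M \<Longrightarrow> f x \<le> U x) \<Longrightarrow> k \<le> integral\<^sup>L M U"
  shows "k \<le> outer_exp M f"
  unfolding outer_exp_def
proof (rule cInf_greatest)
  have "integral\<^sup>L M (\<lambda>_. K) \<in> {integral\<^sup>L M U |U. U \<in> borel_measurable M \<and> integrable M U \<and> (\<forall>x\<in>space M. f x \<le> U x)}"
    using f by (intro CollectI exI[of _ "\<lambda>_. K"]) (auto simp: abs_le_iff)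
  then show "{integral\<^sup>L M U |U. U \<in> borel_measurable M \<and> integrable M U \<and> (\<forall>x\<in>space M. f x \<le> U x)} \<noteq> {}" by blast
qed (use assms(2) in blast)

text \<open>An integrable majorant of \<open>g\<close> becomes one of \<open>f\<close> after adding
  \<open>e\<close> everywhere and \<open>2 * K\<close> on the measurable set \<open>B\<close>; this
  works for functions that are not measurable.\<close>

lemma outer_exp_le_off_set:
  assumes f: "\<And>x. x \<in> space M \<Longrightarrow> \<bar>f x\<bar> \<le> K" and g: "\<And>x. x \<in> space M \<Longrightarrow> \<bar>g x\<bar> \<le> K"
    and B: "B \<in> sets M" and le: "\<And>x. x \<in> space M - B \<Longrightarrow> f x \<le> g x + e" and e: "0 \<le> e"
  shows "outer_exp M f \<le> outer_exp M g + e + 2 * K * measure M B"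
proof -
  have "outer_exp M f - e - 2 * K * measure M B \<le> outer_exp M g"
  proof (rule outer_exp_ge[OF g])
    fix U assume U: "integrable M U" "\<And>x. x \<in> space M \<Longrightarrow> g x \<le> U x"
    have ib: "integrable M (\<lambda>x. 2 * K * indicator B x)" using B by (intro integrable_mult_right) (simp add: emeasure_eq_measure)
    have "outer_exp M f \<le> integral\<^sup>L M (\<lambda>x. U x + e + 2 * K * indicator B x)"
    proof (rule outer_exp_le[OF _ _ f])
      show "integrable M (\<lambda>x. U x + e + 2 * K * indicator B x)" using U ib by simp
      fix x assume x: "x \<in> space M"
      show "f x \<le> U x + e + 2 * K * indicator B x"
      proof (cases "x \<in> B")
        case True then show ?thesis using f[OF x] g[OF x] U(2)[OF x] e by simp
      next
        case False then show ?thesis using le[of x] x U(2)[OF x] by simp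
      qed
    qed
    also have "\<dots> = integral\<^sup>L M U + e + 2 * K * measure M B"
      using U ib B by (simp add: prob_space)
    finally show "outer_exp M f - e - 2 * K * measure M B \<le> integral\<^sup>L M U" by linarith
  qed
  then show ?thesis by linarith
qed

lemma outer_prob_le:
  assumes "B \<in> sets M" "A \<inter> space M \<subseteq> B"
  shows "outer_prob M A \<le> measure M B"
  unfolding outer_prob_def
proof (rule cInf_lower)
  show "bdd_below {measure M B |B. B \<in> events \<and> A \<inter> space M \<subseteq> B}"
    by (rule bdd_belowI[where m=0]) auto
qed (use assms in blast)

lemma outer_prob_nonneg: "0 \<le> outer_prob M A"
  unfolding outer_prob_def by (rule cInf_greatest) auto

lemma outer_prob_cover:
  assumes "0 < e"
  obtains B where "B \<in> sets M" "A \<inter> space M \<subseteq> B" "measure M B < outer_prob M A + e"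
proof -
  have "Inf {measure M B |B. B \<in> sets M \<and> A \<inter> space M \<subseteq> B} < outer_prob M A + e"
    using assms by (simp add: outer_prob_def)
  moreover have "measure M (space M) \<in> {measure M B |B. B \<in> sets M \<and> A \<inter> space M \<subseteq> B}" by auto
  then have "{measure M B |B. B \<in> sets M \<and> A \<inter> space M \<subseteq> B} \<noteq> {}" by blast
  ultimately obtain b where "b \<in> {measure M B |B. B \<in> sets M \<and> A \<inter> space M \<subseteq> B}" "b < outer_prob M A + e"
    by (meson cInf_lessD)
  then show ?thesis using that by blast
qed

lemma outer_prob_mono:
  assumes "A \<inter> space M \<subseteq> A'"
  shows "outer_prob M A \<le> outer_prob M A'"
proof (rule field_le_epsilon)
  fix e :: real assume "0 < e"
  then obtain B where "B \<in> sets M" "A' \<inter> space M \<subseteq> B" "measure M B < outer_prob M A' + e"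
    by (rule outer_prob_cover)
  moreover have "outer_prob M A \<le> measure M B"
    using calculation assms by (intro outer_prob_le) auto
  ultimately show "outer_prob M A \<le> outer_prob M A' + e" by linarith
qed

lemma outer_prob_Un: "outer_prob M (A \<union> A') \<le> outer_prob M A + outer_prob M A'"
proof (rule field_le_epsilon)
  fix e :: real assume "0 < e"
  then have "0 < e / 2" by simp
  obtain B where B: "B \<in> sets M" "A \<inter> space M \<subseteq> B" "measure M B < outer_prob M A + e / 2"
    using \<open>0 < e / 2\<close> by (rule outer_prob_cover)
  obtain B' where B': "B' \<in> sets M" "A' \<inter> space M \<subseteq> B'" "measure M B' < outer_prob M A' + e / 2"
    using \<open>0 < e / 2\<close> by (rule outer_prob_cover)
  have "outer_prob M (A \<union> A') \<le> measure M (B \<union> B')" using B B' by (intro outer_prob_le) auto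
  also have "\<dots> \<le> measure M B + measure M B'" using B B' by (intro measure_Un_le)
  finally show "outer_prob M (A \<union> A') \<le> outer_prob M A + outer_prob M A' + e" using B B' by linarith
qed

text \<open>Markov's inequality applies to each integrable majorant \<open>U\<close>, whose
  superlevel set is measurable and covers that of \<open>f\<close>; the infimum over
  \<open>U\<close> gives the outer version.\<close>

lemma outer_prob_Markov:
  assumes f: "\<And>x. x \<in> space M \<Longrightarrow> 0 \<le> f x \<and> f x \<le> K" and e: "0 < e"
  shows "outer_prob M {x \<in> space M. e \<le> f x} \<le> outer_exp M f / e"
proof -
  have "e * outer_prob M {x \<in> space M. e \<le> f x} \<le> outer_exp M f"
  proof (rule outer_exp_ge)
    show "\<bar>f x\<bar> \<le> K" if "x \<in> space M" for x using f[OF that] by simp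
    fix U assume U: "integrable M U" "\<And>x. x \<in> space M \<Longrightarrow> f x \<le> U x"
    have meas: "U \<in> borel_measurable M" using U(1) by auto
    define B where "B = {x \<in> space M. e \<le> U x}"
    have B: "B \<in> sets M" unfolding B_def using meas by measurable
    have U0: "0 \<le> U x" if "x \<in> space M" for x using f[OF that] U(2)[OF that] by linarith
    have "outer_prob M {x \<in> space M. e \<le> f x} \<le> measure M B"
      using B U(2) by (intro outer_prob_le) (auto simp: B_def intro: order_trans)
    also have "measure M B \<le> integral\<^sup>L M U / e"
      unfolding B_def using U(1) U0 e by (intro integral_Markov_inequality_measure[where A="{}" and u=U, simplified]) auto
    finally show "e * outer_prob M {x \<in> space M. e \<le> f x} \<le> integral\<^sup>L M U"
      using e by (simp add: field_simps)
  qed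
  then show ?thesis using e by (simp add: field_simps)
qed

end

section \<open>Convergence in the sense of Hoffmann-Jorgensen\<close>

lemma HJ_convD:
  assumes "HJ_conv P Z d D Q L" "pm_cont d D h" "\<And>x. x \<in> D \<Longrightarrow> \<bar>h x\<bar> \<le> B"
  shows "(\<lambda>k. outer_exp P (\<lambda>\<omega>. h (Z k \<omega>))) \<longlonglongrightarrow> integral\<^sup>L Q (\<lambda>q. h (L q))"
  using assms unfolding HJ_conv_def by blast

lemma HJ_conv_in:
  assumes "HJ_conv P Z d D Q L"
  shows "\<omega> \<in> space P \<Longrightarrow> Z k \<omega> \<in> D" "q \<in> space Q \<Longrightarrow> L q \<in> D"
  using assms unfolding HJ_conv_def borel_into_def by auto

lemma HJ_conv_outer_prob_limit:
  assumes P: "prob_space P" and HJ: "HJ_conv P Z d D Q L"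
    and \<psi>: "pm_cont d D \<psi>" "\<And>x. x \<in> D \<Longrightarrow> 0 \<le> \<psi> x \<and> \<psi> x \<le> 1" and e: "0 < e"
    and lt: "integral\<^sup>L Q (\<lambda>q. \<psi> (L q)) < \<eta> * e"
  shows "\<forall>\<^sub>F k in sequentially. outer_prob P {\<omega> \<in> space P. e \<le> \<psi> (Z k \<omega>)} < \<eta>"
proof -
  interpret prob_space P by fact
  have "(\<lambda>k. outer_exp P (\<lambda>\<omega>. \<psi> (Z k \<omega>))) \<longlonglongrightarrow> integral\<^sup>L Q (\<lambda>q. \<psi> (L q))"
    using \<psi>(2) by (intro HJ_convD[OF HJ \<psi>(1), of 1]) auto
  then have "\<forall>\<^sub>F k in sequentially. outer_exp P (\<lambda>\<omega>. \<psi> (Z k \<omega>)) < \<eta> * e"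
    using lt by (rule order_tendstoD)
  then show ?thesis
  proof eventually_elim
    case (elim k)
    have "outer_prob P {\<omega> \<in> space P. e \<le> \<psi> (Z k \<omega>)} \<le> outer_exp P (\<lambda>\<omega>. \<psi> (Z k \<omega>)) / e"
      using \<psi>(2) HJ_conv_in(1)[OF HJ] e by (intro outer_prob_Markov[where K=1]) auto
    also have "\<dots> < \<eta>" using elim e by (simp add: divide_less_eq)
    finally show ?case .
  qed
qed

text \<open>Dominated convergence under the limit law selects \<open>j\<close>, and weak convergence
  tested on the single function \<open>\<psi> j\<close> brings the smallness back to all large
  \<open>k\<close>. The order matters: \<open>j\<close> is fixed before \<open>k\<close>
  grows.\<close>

lemma HJ_conv_vanishing:
  assumes P: "prob_space P" and Q: "prob_space Q" and HJ: "HJ_conv P Z d D Q L"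
    and \<psi>: "\<And>j. pm_cont d D (\<psi> j)" "\<And>j x. x \<in> D \<Longrightarrow> 0 \<le> \<psi> j x \<and> \<psi> j x \<le> 1"
    and lim: "AE q in Q. (\<lambda>j. \<psi> j (L q)) \<longlonglongrightarrow> 0" and e: "0 < e" and \<eta>: "0 < \<eta>"
  shows "\<exists>j. \<forall>\<^sub>F k in sequentially. outer_prob P {\<omega> \<in> space P. e \<le> \<psi> j (Z k \<omega>)} < \<eta>"
proof -
  interpret Q: prob_space Q by fact
  have bi: "borel_into Q d D L" using HJ by (simp add: HJ_conv_def)
  have "(\<lambda>j. integral\<^sup>L Q (\<lambda>q. \<psi> j (L q))) \<longlonglongrightarrow> integral\<^sup>L Q (\<lambda>q. 0)"
  proof (rule integral_dominated_convergence[where w="\<lambda>_. 1"])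
    show "(\<lambda>q. \<psi> j (L q)) \<in> borel_measurable Q" for j by (rule borel_measurable_pm_cont[OF bi \<psi>(1)])
    show "AE q in Q. norm (\<psi> j (L q)) \<le> 1" for j
      using \<psi>(2) HJ_conv_in(2)[OF HJ] by (intro AE_I2) auto
  qed (use lim in auto)
  moreover have "0 < \<eta> * e" using e \<eta> by simp
  ultimately have "\<forall>\<^sub>F j in sequentially. integral\<^sup>L Q (\<lambda>q. \<psi> j (L q)) < \<eta> * e"
    by (simp add: order_tendstoD)
  then obtain j where "integral\<^sup>L Q (\<lambda>q. \<psi> j (L q)) < \<eta> * e" by (auto simp: eventually_sequentially)
  from HJ_conv_outer_prob_limit[OF P HJ \<psi> e this] show ?thesis by blast
qed

text \<open>A substitute for a continuous mapping theorem with functionals that depend on the sample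
  size. Up to events of vanishing outer probability \<open>\<Delta> k\<close> lies between
  \<open>lo j\<close> and \<open>up j\<close>, and these meet at \<open>\<phi>\<close> almost surely
  in the limit. Hence \<open>\<Delta> k\<close> is close to \<open>\<phi> (Z k)\<close>, to which
  weak convergence applies directly.\<close>

lemma HJ_conv_sandwich:
  fixes \<Delta> :: "nat \<Rightarrow> 'o \<Rightarrow> real"
  assumes P: "prob_space P" and Q: "prob_space Q" and HJ: "HJ_conv P Z d D Q L"
    and \<phi>: "pm_cont d D \<phi>" and up: "\<And>j. pm_cont d D (up j)" and lo: "\<And>j. pm_cont d D (lo j)"
    and uplim: "AE q in Q. (\<lambda>j. up j (L q)) \<longlonglongrightarrow> \<phi> (L q)"
    and lolim: "AE q in Q. (\<lambda>j. lo j (L q)) \<longlonglongrightarrow> \<phi> (L q)"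
    and upper: "\<And>j \<epsilon>. 0 < \<epsilon> \<Longrightarrow> (\<lambda>k. outer_prob P {\<omega> \<in> space P. \<Delta> k \<omega> > up j (Z k \<omega>) + \<epsilon>}) \<longlonglongrightarrow> 0"
    and lower: "\<And>j \<epsilon>. 0 < \<epsilon> \<Longrightarrow> (\<lambda>k. outer_prob P {\<omega> \<in> space P. \<Delta> k \<omega> < lo j (Z k \<omega>) - \<epsilon>}) \<longlonglongrightarrow> 0"
  shows "HJ_conv P \<Delta> dist UNIV Q (\<lambda>q. \<phi> (L q))"
proof -
  interpret P: prob_space P by fact
  interpret Q: prob_space Q by fact
  have bi: "borel_into Q d D L" using HJ by (simp add: HJ_conv_def)
  note ZD = HJ_conv_in(1)[OF HJ] and LD = HJ_conv_in(2)[OF HJ]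
  have \<phi>m: "(\<lambda>q. \<phi> (L q)) \<in> borel_measurable Q" by (rule borel_measurable_pm_cont[OF bi \<phi>])
  have close: "\<forall>\<^sub>F k in sequentially. outer_prob P {\<omega> \<in> space P. \<bar>\<Delta> k \<omega> - \<phi> (Z k \<omega>)\<bar> > \<epsilon>} < \<eta>"
    if \<epsilon>: "0 < \<epsilon>" "\<epsilon> < 1" and \<eta>: "0 < \<eta>" for \<epsilon> \<eta>
  proof -
    \<comment> \<open>The truncated width of the bracket; truncation makes it a bounded test
      function.\<close>
    define \<psi> where "\<psi> j x = min 1 (\<bar>up j x - \<phi> x\<bar> + \<bar>lo j x - \<phi> x\<bar>)" for j x
    have c\<psi>: "pm_cont d D (\<psi> j)" for j
    proof -
      have "pm_cont d D (\<lambda>x. \<bar>up j x - \<phi> x\<bar>)" "pm_cont d D (\<lambda>x. \<bar>lo j x - \<phi> x\<bar>)"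
        using pm_cont_diff[OF up \<phi>, of j] pm_cont_diff[OF lo \<phi>, of j]
        by (auto intro!: pm_cont_compose[where g=abs] continuous_intros)
      from pm_cont_add[OF this] show ?thesis unfolding \<psi>_def
        by (rule pm_cont_compose[where g="min 1"]) (intro continuous_intros)
    qed
    have lim: "AE q in Q. (\<lambda>j. \<psi> j (L q)) \<longlonglongrightarrow> 0"
      using uplim lolim
    proof eventually_elim
      case (elim q)
      have "(\<lambda>j. \<psi> j (L q)) \<longlonglongrightarrow> min 1 (\<bar>\<phi> (L q) - \<phi> (L q)\<bar> + \<bar>\<phi> (L q) - \<phi> (L q)\<bar>)"
        unfolding \<psi>_def by (intro tendsto_intros elim)
      then show ?case by simp
    qed
    have \<psi>01: "0 \<le> \<psi> j x \<and> \<psi> j x \<le> 1" for j x by (auto simp: \<psi>_def)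
    have h: "0 < \<epsilon> / 2" "0 < \<eta> / 3" using \<epsilon> \<eta> by auto
    obtain j where j: "\<forall>\<^sub>F k in sequentially. outer_prob P {\<omega> \<in> space P. \<epsilon> / 2 \<le> \<psi> j (Z k \<omega>)} < \<eta> / 3"
      using HJ_conv_vanishing[of P Q Z d D L \<psi>, OF P Q HJ c\<psi> \<psi>01 lim h] by blast
    have "\<forall>\<^sub>F k in sequentially. outer_prob P {\<omega> \<in> space P. \<Delta> k \<omega> > up j (Z k \<omega>) + \<epsilon> / 2} < \<eta> / 3"
      using upper[OF h(1), of j] h(2) by (rule order_tendstoD)
    moreover have "\<forall>\<^sub>F k in sequentially. outer_prob P {\<omega> \<in> space P. \<Delta> k \<omega> < lo j (Z k \<omega>) - \<epsilon> / 2} < \<eta> / 3"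
      using lower[OF h(1), of j] h(2) by (rule order_tendstoD)
    ultimately show ?thesis using j
    proof eventually_elim
      case (elim k)
      let ?A = "{\<omega> \<in> space P. \<Delta> k \<omega> > up j (Z k \<omega>) + \<epsilon> / 2}"
      let ?B = "{\<omega> \<in> space P. \<Delta> k \<omega> < lo j (Z k \<omega>) - \<epsilon> / 2}"
      let ?C = "{\<omega> \<in> space P. \<epsilon> / 2 \<le> \<psi> j (Z k \<omega>)}"
      have "outer_prob P {\<omega> \<in> space P. \<bar>\<Delta> k \<omega> - \<phi> (Z k \<omega>)\<bar> > \<epsilon>} \<le> outer_prob P (?A \<union> (?B \<union> ?C))"
      proof (rule P.outer_prob_mono, rule subsetI)
        fix \<omega> assume "\<omega> \<in> {\<omega> \<in> space P. \<bar>\<Delta> k \<omega> - \<phi> (Z k \<omega>)\<bar> > \<epsilon>} \<inter> space P"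
        then have \<omega>: "\<omega> \<in> space P" "\<bar>\<Delta> k \<omega> - \<phi> (Z k \<omega>)\<bar> > \<epsilon>" by auto
        show "\<omega> \<in> ?A \<union> (?B \<union> ?C)"
        proof (rule ccontr)
          assume n: "\<omega> \<notin> ?A \<union> (?B \<union> ?C)"
          then have "\<Delta> k \<omega> \<le> up j (Z k \<omega>) + \<epsilon> / 2" "lo j (Z k \<omega>) - \<epsilon> / 2 \<le> \<Delta> k \<omega>" "\<psi> j (Z k \<omega>) < \<epsilon> / 2"
            using \<omega>(1) by auto
          moreover from this(3) have "\<bar>up j (Z k \<omega>) - \<phi> (Z k \<omega>)\<bar> + \<bar>lo j (Z k \<omega>) - \<phi> (Z k \<omega>)\<bar> < \<epsilon> / 2"
            using \<epsilon> unfolding \<psi>_def by linarith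
          ultimately show False using \<omega>(2) by linarith
        qed
      qed
      also have "\<dots> \<le> outer_prob P ?A + (outer_prob P ?B + outer_prob P ?C)"
        using P.outer_prob_Un[of ?A "?B \<union> ?C"] P.outer_prob_Un[of ?B ?C] by linarith
      also have "\<dots> < \<eta>" using elim by linarith
      finally show ?case .
    qed
  qed
  show ?thesis
    unfolding HJ_conv_def
  proof (intro conjI allI impI)
    show "borel_into Q dist UNIV (\<lambda>q. \<phi> (L q))"
      unfolding borel_into_def
    proof (intro conjI allI impI)
      fix U :: "real set" assume "pm_open dist UNIV U"
      then have "open U" unfolding pm_open_def open_dist by (auto simp: dist_commute)
      with \<phi>m have "(\<lambda>q. \<phi> (L q)) -` U \<inter> space Q \<in> sets Q" by (intro measurable_sets) auto
      also have "(\<lambda>q. \<phi> (L q)) -` U \<inter> space Q = {q \<in> space Q. \<phi> (L q) \<in> U}" by auto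
      finally show "{q \<in> space Q. \<phi> (L q) \<in> U} \<in> sets Q" .
    qed auto
  next
    fix h :: "real \<Rightarrow> real" assume "pm_cont dist UNIV h \<and> (\<exists>B. \<forall>x\<in>UNIV. \<bar>h x\<bar> \<le> B)"
    then obtain B where hc': "pm_cont dist UNIV h" and "\<forall>x. \<bar>h x\<bar> \<le> B" by auto
    then have B: "\<bar>h x\<bar> \<le> B" for x by simp
    have B0: "0 \<le> B" using B[of 0] abs_ge_zero order_trans by blast
    have hc: "continuous_on UNIV h"
      using hc' unfolding pm_cont_def continuous_on_iff dist_real_def by (simp add: abs_minus_commute)
    have main: "(\<lambda>k. outer_exp P (\<lambda>\<omega>. h (\<phi> (Z k \<omega>)))) \<longlonglongrightarrow> integral\<^sup>L Q (\<lambda>q. h (\<phi> (L q)))"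
      using B by (intro HJ_convD[OF HJ pm_cont_compose[OF \<phi> hc], of B]) auto
    show "(\<lambda>k. outer_exp P (\<lambda>\<omega>. h (\<Delta> k \<omega>))) \<longlonglongrightarrow> integral\<^sup>L Q (\<lambda>q. h (\<phi> (L q)))"
    proof (rule LIMSEQ_I)
      fix s :: real assume s: "0 < s"
      \<comment> \<open>Chosen so that an error \<open>\<eta>\<close> off a set of measure below
        \<open>2 * \<eta>\<close>, plus \<open>2 * B\<close> times that measure, stays within
        \<open>s / 2\<close>. A further \<open>s / 4\<close> is spent on the convergence for
        \<open>\<phi> (Z k)\<close>.\<close>
      define \<eta> where "\<eta> = s / (4 * (1 + 2 * B))"
      have \<eta>: "0 < \<eta>" using s B0 by (simp add: \<eta>_def)
      \<comment> \<open>\<open>\<theta> j\<close> is zero where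
        \<open>\<bar>\<phi> x\<bar> \<le> j\<close> and one where
        \<open>\<bar>\<phi> x\<bar> \<ge> j + 1\<close>. It confines \<open>\<phi> (Z k)\<close> to
        a compact interval, on which \<open>h\<close> is uniformly continuous.\<close>
      define \<theta> where "\<theta> j x = min 1 (max 0 (\<bar>\<phi> x\<bar> - real j))" for j x
      have c\<theta>: "pm_cont d D (\<theta> j)" for j
        unfolding \<theta>_def by (rule pm_cont_compose[OF \<phi>]) (intro continuous_intros)
      have \<theta>01: "0 \<le> \<theta> j x \<and> \<theta> j x \<le> 1" for j x by (auto simp: \<theta>_def)
      have lim: "AE q in Q. (\<lambda>j. \<theta> j (L q)) \<longlonglongrightarrow> 0"
      proof (rule AE_I2)
        fix q
        obtain j0 :: nat where "\<bar>\<phi> (L q)\<bar> < real j0" using reals_Archimedean2 by blast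
        then have "\<theta> j (L q) = 0" if "j \<ge> j0" for j using that by (auto simp: \<theta>_def max_def)
        then show "(\<lambda>j. \<theta> j (L q)) \<longlonglongrightarrow> 0"
          by (intro tendsto_eventually) (auto simp: eventually_sequentially)
      qed
      obtain R where R: "\<forall>\<^sub>F k in sequentially. outer_prob P {\<omega> \<in> space P. 1 \<le> \<theta> R (Z k \<omega>)} < \<eta>"
        using HJ_conv_vanishing[of P Q Z d D L \<theta> 1 \<eta>, OF P Q HJ c\<theta> \<theta>01 lim _ \<eta>] by auto
      \<comment> \<open>Off the bad events \<open>\<bar>\<phi> (Z k)\<bar> < R + 1\<close>, and
        \<open>\<Delta> k\<close> differs from \<open>\<phi> (Z k)\<close> by less than 1, so both
        values lie in \<open>I\<close>.\<close>
      define I where "I = {- real R - 2 .. real R + 2}"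
      have "uniformly_continuous_on I h"
        using hc by (intro compact_uniformly_continuous continuous_on_subset[OF hc]) (auto simp: I_def)
      then obtain \<delta>0 where \<delta>0: "0 < \<delta>0" "\<And>x y. x \<in> I \<Longrightarrow> y \<in> I \<Longrightarrow> dist y x < \<delta>0 \<Longrightarrow> dist (h y) (h x) < \<eta>"
        by (rule uniformly_continuous_onE[OF _ \<eta>]) blast
      define \<epsilon> where "\<epsilon> = min (\<delta>0 / 2) (1 / 2)"
      have \<epsilon>: "0 < \<epsilon>" "\<epsilon> < 1" "\<epsilon> < \<delta>0" using \<delta>0(1) by (auto simp: \<epsilon>_def)
      have "\<forall>\<^sub>F k in sequentially. dist (outer_exp P (\<lambda>\<omega>. h (\<phi> (Z k \<omega>)))) (integral\<^sup>L Q (\<lambda>q. h (\<phi> (L q)))) < s / 4"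
        using s by (intro tendstoD[OF main]) simp
      with R close[OF \<epsilon>(1,2) \<eta>]
      have "\<forall>\<^sub>F k in sequentially. norm (outer_exp P (\<lambda>\<omega>. h (\<Delta> k \<omega>)) - integral\<^sup>L Q (\<lambda>q. h (\<phi> (L q)))) < s"
      proof eventually_elim
        case (elim k)
        let ?A = "{\<omega> \<in> space P. 1 \<le> \<theta> R (Z k \<omega>)}"
        let ?B = "{\<omega> \<in> space P. \<bar>\<Delta> k \<omega> - \<phi> (Z k \<omega>)\<bar> > \<epsilon>}"
        have "outer_prob P (?A \<union> ?B) < 2 * \<eta>" using P.outer_prob_Un[of ?A ?B] elim by linarith
        then have "0 < 2 * \<eta> - outer_prob P (?A \<union> ?B)" by simp
        then obtain E where E: "E \<in> sets P" "(?A \<union> ?B) \<inter> space P \<subseteq> E"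
          "measure P E < outer_prob P (?A \<union> ?B) + (2 * \<eta> - outer_prob P (?A \<union> ?B))"
          by (rule P.outer_prob_cover)
        have d: "\<bar>h (\<Delta> k \<omega>) - h (\<phi> (Z k \<omega>))\<bar> \<le> \<eta>" if \<omega>: "\<omega> \<in> space P - E" for \<omega>
        proof -
          have "\<omega> \<notin> ?A" "\<omega> \<notin> ?B" using \<omega> E(2) by auto
          then have "\<theta> R (Z k \<omega>) < 1" and b: "\<bar>\<Delta> k \<omega> - \<phi> (Z k \<omega>)\<bar> \<le> \<epsilon>" using \<omega> by auto
          then have "\<bar>\<phi> (Z k \<omega>)\<bar> < real R + 1" unfolding \<theta>_def by linarith
          then have "\<phi> (Z k \<omega>) \<in> I" "\<Delta> k \<omega> \<in> I" using b \<epsilon>(2) unfolding I_def atLeastAtMost_iff by linarith+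
          then have "dist (h (\<Delta> k \<omega>)) (h (\<phi> (Z k \<omega>))) < \<eta>"
            using b \<epsilon>(3) by (intro \<delta>0(2)) (auto simp: dist_real_def)
          then show ?thesis by (simp add: dist_real_def)
        qed
        have "h (\<Delta> k \<omega>) \<le> h (\<phi> (Z k \<omega>)) + \<eta>" "h (\<phi> (Z k \<omega>)) \<le> h (\<Delta> k \<omega>) + \<eta>"
          if "\<omega> \<in> space P - E" for \<omega> using d[OF that] by linarith+
        note d' = this
        have "outer_exp P (\<lambda>\<omega>. h (\<Delta> k \<omega>)) \<le> outer_exp P (\<lambda>\<omega>. h (\<phi> (Z k \<omega>))) + \<eta> + 2 * B * measure P E"
          by (rule P.outer_exp_le_off_set[OF B B E(1) d'(1) less_imp_le[OF \<eta>]])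
        moreover have "outer_exp P (\<lambda>\<omega>. h (\<phi> (Z k \<omega>))) \<le> outer_exp P (\<lambda>\<omega>. h (\<Delta> k \<omega>)) + \<eta> + 2 * B * measure P E"
          by (rule P.outer_exp_le_off_set[OF B B E(1) d'(2) less_imp_le[OF \<eta>]])
        moreover have "2 * B * measure P E \<le> 2 * B * (2 * \<eta>)" using E(3) B0 by (intro mult_left_mono) auto
        moreover have "\<eta> + 2 * B * (2 * \<eta>) \<le> s / 2"
        proof -
          have "\<eta> + 2 * B * (2 * \<eta>) \<le> 2 * (\<eta> * (1 + 2 * B))" using \<eta> by (simp add: algebra_simps)
          also have "\<eta> * (1 + 2 * B) = s / 4" using B0 by (simp add: \<eta>_def divide_simps)
          finally show ?thesis by simp
        qed
        ultimately show ?case using elim(3) unfolding dist_real_def real_norm_def by linarith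
      qed
      then show "\<exists>no. \<forall>k\<ge>no. norm (outer_exp P (\<lambda>\<omega>. h (\<Delta> k \<omega>)) - integral\<^sup>L Q (\<lambda>q. h (\<phi> (L q)))) < s"
        by (simp add: eventually_sequentially)
    qed
  qed auto
qed

section \<open>The limit functionals\<close>

text \<open>The truncated distance to \<open>E\<close> is a bounded continuous test function whose
  outer expectations are eventually nonpositive, so its integral in the limit is zero. In this way a
  property of all samples passes to almost every limit. As \<open>d\<close> may be a pseudometric,
  closedness is phrased through distances.\<close>

lemma AE_limit_in_closed:
  assumes P: "prob_space P" and Q: "prob_space Q" and HJ: "HJ_conv P Z d D Q L"
    and tri: "\<And>x y z. x \<in> D \<Longrightarrow> y \<in> D \<Longrightarrow> z \<in> D \<Longrightarrow> d x z \<le> d x y + d y z"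
    and sym: "\<And>x y. d x y = d y x" and refl: "\<And>x. x \<in> D \<Longrightarrow> d x x = 0"
    and nonneg: "\<And>x y. x \<in> D \<Longrightarrow> y \<in> D \<Longrightarrow> 0 \<le> d x y"
    and E: "E \<subseteq> D" "E \<noteq> {}"
    and ev: "\<forall>\<^sub>F k in sequentially. \<forall>\<omega>\<in>space P. Z k \<omega> \<in> E"
    and closed: "\<And>x. x \<in> D \<Longrightarrow> (\<And>e. 0 < e \<Longrightarrow> \<exists>y\<in>E. d x y < e) \<Longrightarrow> x \<in> E"
  shows "AE q in Q. L q \<in> E"
proof -
  interpret P: prob_space P by fact
  interpret Q: prob_space Q by fact
  have bi: "borel_into Q d D L" using HJ by (simp add: HJ_conv_def)
  define i where "i x = (INF y\<in>E. d x y)" for x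
  have bdd: "bdd_below (d x ` E)" if "x \<in> D" for x
    using nonneg[OF that] E(1) by (intro bdd_belowI2[where m=0]) auto
  have lip: "\<bar>i y - i x\<bar> \<le> d x y" if "x \<in> D" "y \<in> D" for x y
    unfolding i_def
  proof (rule abs_cINF_diff_le[OF E(2) bdd[OF that(2)] bdd[OF that(1)]])
    fix z assume "z \<in> E"
    then have z: "z \<in> D" using E(1) by blast
    show "\<bar>d y z - d x z\<bar> \<le> d x y"
      using tri[OF that z] tri[OF that(2,1) z] sym[of x y] by linarith
  qed
  define h where "h x = min 1 (i x)" for x
  have hc: "pm_cont d D h"
  proof (rule pm_cont_Lipschitz[of 1])
    fix x y assume "x \<in> D" "y \<in> D"
    from lip[OF this] show "\<bar>h y - h x\<bar> \<le> 1 * d x y" unfolding h_def by linarith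
  qed simp
  have i0: "0 \<le> i x" if "x \<in> D" for x
    unfolding i_def using nonneg[OF that] E by (intro cINF_greatest) auto
  have h01: "0 \<le> h x" "\<bar>h x\<bar> \<le> 1" if "x \<in> D" for x using i0[OF that] by (auto simp: h_def)
  have iE: "i x = 0" if "x \<in> E" for x
  proof (rule antisym)
    have "i x \<le> d x x" unfolding i_def using E(1) that by (intro cINF_lower bdd) auto
    then show "i x \<le> 0" using refl E(1) that by auto
    show "0 \<le> i x" using i0 E(1) that by auto
  qed
  have "integral\<^sup>L Q (\<lambda>q. h (L q)) \<le> 0"
  proof (rule LIMSEQ_le_const2[OF HJ_convD[OF HJ hc h01(2)]])
    from ev obtain k0 where k0: "\<And>k \<omega>. k \<ge> k0 \<Longrightarrow> \<omega> \<in> space P \<Longrightarrow> Z k \<omega> \<in> E"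
      by (auto simp: eventually_sequentially)
    have "outer_exp P (\<lambda>\<omega>. h (Z k \<omega>)) \<le> 0" if "k \<ge> k0" for k
    proof -
      have "h (Z k \<omega>) = 0" if "\<omega> \<in> space P" for \<omega>
        using iE[OF k0[OF \<open>k \<ge> k0\<close> that]] by (simp add: h_def)
      then have "outer_exp P (\<lambda>\<omega>. h (Z k \<omega>)) \<le> integral\<^sup>L P (\<lambda>_. 0)"
        by (intro P.outer_exp_le[where K=0]) auto
      then show ?thesis by simp
    qed
    then show "\<exists>N. \<forall>k\<ge>N. outer_exp P (\<lambda>\<omega>. h (Z k \<omega>)) \<le> 0" by blast
  qed
  moreover have nn: "AE q in Q. 0 \<le> h (L q)" using h01(1) HJ_conv_in(2)[OF HJ] by (intro AE_I2) auto
  then have "0 \<le> integral\<^sup>L Q (\<lambda>q. h (L q))" by (rule integral_nonneg_AE)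
  ultimately have "integral\<^sup>L Q (\<lambda>q. h (L q)) = 0" by simp
  moreover have "integrable Q (\<lambda>q. h (L q))"
    using borel_measurable_pm_cont[OF bi hc] h01(2) HJ_conv_in(2)[OF HJ]
    by (intro Q.integrable_const_bound[of _ 1]) auto
  ultimately have "AE q in Q. h (L q) = 0"
    using nn by (subst (asm) integral_nonneg_eq_0_iff_AE) auto
  then show ?thesis
  proof (rule AE_mp[OF _ AE_I2], intro impI)
    fix q assume q: "q \<in> space Q" and "h (L q) = 0"
    then have i: "i (L q) = 0" by (auto simp: h_def min_def split: if_splits)
    have LD: "L q \<in> D" using q by (rule HJ_conv_in(2)[OF HJ])
    show "L q \<in> E"
    proof (rule closed[OF LD])
      fix e :: real assume "0 < e"
      then have "(INF y\<in>E. d (L q) y) < e" using i unfolding i_def by simp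
      then show "\<exists>y\<in>E. d (L q) y < e" unfolding cINF_less_iff[OF E(2) bdd[OF LD]] .
    qed
  qed
qed

text \<open>The modulus of continuity of \<open>h\<close> in its first variable, uniformly in the
  second.\<close>

definition osc :: "real \<Rightarrow> ('x::metric_space \<times> 'y \<Rightarrow> real) \<Rightarrow> real" where
  "osc \<delta> h = (SUP (x, x', y)\<in>{(x, x', y). dist x x' \<le> \<delta>}. \<bar>h (x, y) - h (x', y)\<bar>)"

lemma osc_ge:
  assumes "\<forall>p. \<bar>h p\<bar> \<le> K" "dist x x' \<le> \<delta>"
  shows "\<bar>h (x, y) - h (x', y)\<bar> \<le> osc \<delta> h"
proof -
  have "bdd_above ((\<lambda>(x, x', y). \<bar>h (x, y) - h (x', y)\<bar>) ` {(x, x', y). dist x x' \<le> \<delta>})"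
  proof (rule bdd_aboveI2[where M="2 * K"])
    fix p :: "'a \<times> 'a \<times> 'b"
    obtain x x' y where p: "p = (x, x', y)" by (cases p)
    show "(case p of (x, x', y) \<Rightarrow> \<bar>h (x, y) - h (x', y)\<bar>) \<le> 2 * K"
      using assms(1)[rule_format, of "(x, y)"] assms(1)[rule_format, of "(x', y)"] unfolding p by simp
  qed
  from cSUP_upper[OF _ this, of "(x, x', y)"] assms(2) show ?thesis unfolding osc_def by simp
qed

lemma osc_le:
  assumes "0 \<le> \<delta>" "\<And>x x' y. dist x x' \<le> \<delta> \<Longrightarrow> \<bar>h (x, y) - h (x', y)\<bar> \<le> e"
  shows "osc \<delta> h \<le> e"
  unfolding osc_def
proof (rule cSUP_least)
  have "(undefined, undefined, undefined) \<in> {(x, x', y). dist x x' \<le> \<delta>}" using assms(1) by simp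
  then show "{(x::'a, x', y::'b). dist x x' \<le> \<delta>} \<noteq> {}"
    by (rule ex_in_conv[THEN iffD1, OF exI])
qed (use assms(2) in auto)

lemma osc_nonneg:
  assumes "\<forall>p. \<bar>h p\<bar> \<le> K" "0 \<le> \<delta>"
  shows "0 \<le> osc \<delta> h"
  using osc_ge[OF assms(1), of undefined undefined \<delta> undefined] assms(2) by simp

lemma osc_tendsto_0:
  fixes h :: "'x::metric_space \<times> 'y::metric_space \<Rightarrow> real"
  assumes X: "compact (UNIV :: 'x set)" and Y: "compact (UNIV :: 'y set)" and h: "continuous_on UNIV h"
  shows "(\<lambda>j. osc (1 / real (Suc j)) h) \<longlonglongrightarrow> 0"
proof (rule LIMSEQ_I)
  fix e :: real assume "0 < e"
  then have e2: "0 < e / 2" by simp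
  note XY = compact_UNIV_prod[OF X Y]
  obtain K where K: "\<forall>p. \<bar>h p\<bar> \<le> K" by (rule continuous_compact_bounded[OF XY h])
  have "uniformly_continuous_on UNIV h" using XY h by (intro compact_uniformly_continuous)
  then obtain d where d: "0 < d" "\<And>p p'. dist p' p < d \<Longrightarrow> dist (h p') (h p) < e / 2"
    by (rule uniformly_continuous_onE[OF _ e2]) blast
  obtain j0 where j0: "1 / real (Suc j0) < d" using nat_approx_posE[OF d(1)] by blast
  have "norm (osc (1 / real (Suc j)) h - 0) < e" if "j0 \<le> j" for j
  proof -
    have "1 / real (Suc j) \<le> 1 / real (Suc j0)" using that by (intro divide_left_mono) auto
    then have lt: "1 / real (Suc j) < d" using j0 by linarith
    have "osc (1 / real (Suc j)) h \<le> e / 2"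
    proof (rule osc_le)
      fix x x' :: 'x and y :: 'y assume "dist x x' \<le> 1 / real (Suc j)"
      then have "dist (x, y) (x', y) < d" using lt by (simp add: dist_Pair_Pair)
      from d(2)[OF this] show "\<bar>h (x, y) - h (x', y)\<bar> \<le> e / 2" by (simp add: dist_real_def)
    qed simp
    then show ?thesis using osc_nonneg[OF K, of "1 / real (Suc j)"] \<open>0 < e\<close> by simp
  qed
  then show "\<exists>no. \<forall>j\<ge>no. norm (osc (1 / real (Suc j)) h - 0) < e" by blast
qed

text \<open>The deterministic setting. Attained duality is assumed here because it is itself
  obtained from samples; \<open>B\<close> and \<open>W\<close> describe the class of potentials and
  are kept apart from the bound \<open>C\<close> of the cost.\<close>

locale compact_ot =
  fixes \<mu> :: "'x::metric_space measure" and \<nu> :: "'y::metric_space measure"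
    and c :: "'x \<times> 'y \<Rightarrow> real" and W :: "real \<Rightarrow> real" and B C :: real
  assumes X_cpt: "compact (UNIV :: 'x set)" and Y_cpt: "compact (UNIV :: 'y set)"
    and c_cont: "continuous_on UNIV c" and W0: "(W \<longlongrightarrow> 0) (at_right 0)"
    and mu: "prob_space \<mu>" "sets \<mu> = sets borel" and nu: "prob_space \<nu>" "sets \<nu> = sets borel"
    and C: "\<forall>p. \<bar>c p\<bar> \<le> C"
    and dual_attained: "\<exists>\<pi> f. \<pi> \<in> couplings \<mu> \<nu> \<and> f \<in> Fclass B W \<and>
      integral\<^sup>L \<pi> c = integral\<^sup>L \<mu> (cctrans c f) + integral\<^sup>L \<nu> (ctrans c f)"
begin

definition F :: "('x \<Rightarrow> real) set" where "F = Fclass B W"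

definition J :: "('x \<Rightarrow> real) \<Rightarrow> real" where
  "J f = integral\<^sup>L \<mu> (cctrans c f) + integral\<^sup>L \<nu> (ctrans c f)"

abbreviation G1 where "G1 \<equiv> cctrans c ` F"
abbreviation G2 where "G2 \<equiv> ctrans c ` F"
abbreviation D where "D \<equiv> D3 G1 G2"
abbreviation dD where "dD \<equiv> dist3 G1 G2"
abbreviation OTc where "OTc \<equiv> OT \<mu> \<nu> c"

lemmas XY_cpt = compact_UNIV_prod[OF X_cpt Y_cpt]

lemma F_bounded: "f \<in> F \<Longrightarrow> \<forall>x. \<bar>f x\<bar> \<le> 2 * B"
  unfolding F_def by (rule Fclass_bounded)

lemma cont_c: "f \<in> F \<Longrightarrow> continuous_on UNIV (ctrans c f)"
  by (rule continuous_ctrans[OF X_cpt Y_cpt c_cont F_bounded])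

lemma cont_cc: "f \<in> F \<Longrightarrow> continuous_on UNIV (cctrans c f)"
  by (rule continuous_cctrans[OF X_cpt Y_cpt c_cont F_bounded])

lemma J_le_OT: "f \<in> F \<Longrightarrow> J f \<le> OTc"
  unfolding J_def using dual_attained
  by (intro OT_ge weak_duality[OF X_cpt Y_cpt c_cont F_bounded]) auto

lemma opt_ne: "opt_plans \<mu> \<nu> c \<noteq> {}" and J_attained: "\<exists>f\<in>F. J f = OTc"
proof -
  obtain \<pi> f where \<pi>: "\<pi> \<in> couplings \<mu> \<nu>" and f: "f \<in> F"
    and eq: "integral\<^sup>L \<pi> c = integral\<^sup>L \<mu> (cctrans c f) + integral\<^sup>L \<nu> (ctrans c f)"
    using dual_attained unfolding F_def by blast
  from dual_attained_imp_opt[OF X_cpt Y_cpt c_cont F_bounded[OF f] \<pi> eq] f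
  show "opt_plans \<mu> \<nu> c \<noteq> {}" "\<exists>f\<in>F. J f = OTc" by (auto simp: J_def)
qed

text \<open>Since the transport value is attained within \<open>F\<close>, the gap
  \<open>OTc - J f\<close> is a nonnegative penalty on \<open>F\<close> that vanishes exactly at the
  maximizers.\<close>

lemma Sc_iff: "f \<in> Sc F \<mu> \<nu> c \<longleftrightarrow> f \<in> F \<and> J f = OTc"
proof
  assume "f \<in> Sc F \<mu> \<nu> c"
  then have f: "f \<in> F" "\<And>g. g \<in> F \<Longrightarrow> J g \<le> J f" by (auto simp: Sc_def J_def)
  obtain g where "g \<in> F" "J g = OTc" using J_attained by blast
  then show "f \<in> F \<and> J f = OTc" using f J_le_OT[OF f(1)] by force
next
  assume "f \<in> F \<and> J f = OTc"
  then show "f \<in> Sc F \<mu> \<nu> c" using J_le_OT by (auto simp: Sc_def J_def)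
qed

lemma Sc_ne: "Sc F \<mu> \<nu> c \<noteq> {}" using J_attained Sc_iff by blast

lemma F_ne: "F \<noteq> {}" using J_attained by blast

lemma J_diff:
  assumes f: "f \<in> F" and g: "g \<in> F" and d: "\<forall>x. \<bar>f x - g x\<bar> \<le> e"
  shows "\<bar>J f - J g\<bar> \<le> 2 * e"
proof -
  have z: "\<forall>p. \<bar>c p - c p\<bar> \<le> 0" by simp
  have "\<bar>integral\<^sup>L \<mu> (cctrans c f) - integral\<^sup>L \<mu> (cctrans c g)\<bar> \<le> 2 * 0 + e"
    by (rule abs_integral_prob_diff_le[OF X_cpt mu cont_cc[OF f] cont_cc[OF g]
        cctrans_diff_le[OF C F_bounded[OF f] C F_bounded[OF g] z d]])
  moreover have "\<bar>integral\<^sup>L \<nu> (ctrans c f) - integral\<^sup>L \<nu> (ctrans c g)\<bar> \<le> 0 + e"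
    by (rule abs_integral_prob_diff_le[OF Y_cpt nu cont_c[OF f] cont_c[OF g]
        ctrans_diff_le[OF C F_bounded[OF f] C F_bounded[OF g] _ d]]) auto
  ultimately show ?thesis unfolding J_def by linarith
qed

section \<open>The space of triples and its pseudometric\<close>

lemma D_bounds:
  assumes "(a, b, h) \<in> D"
  obtains K where "0 \<le> K" "\<forall>f\<in>F. \<bar>a (cctrans c f)\<bar> \<le> K" "\<forall>f\<in>F. \<bar>b (ctrans c f)\<bar> \<le> K"
    "\<forall>p. \<bar>h p\<bar> \<le> K"
proof -
  have "bounded (a ` G1)" "bounded (b ` G2)" and h: "continuous_on UNIV h" using assms by (auto simp: D3_def)
  then obtain K1 K2 where K1: "\<forall>x\<in>a ` G1. norm x \<le> K1" and K2: "\<forall>x\<in>b ` G2. norm x \<le> K2"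
    unfolding bounded_iff by blast
  obtain K3 where K3: "0 \<le> K3" "\<forall>p. \<bar>h p\<bar> \<le> K3" by (rule continuous_compact_bounded[OF XY_cpt h])
  define K where "K = max K1 (max K2 K3)"
  show ?thesis
  proof (rule that[of K])
    show "0 \<le> K" using K3(1) by (simp add: K_def)
    show "\<forall>f\<in>F. \<bar>a (cctrans c f)\<bar> \<le> K"
    proof
      fix f assume "f \<in> F"
      then have "norm (a (cctrans c f)) \<le> K1" using K1 by blast
      then show "\<bar>a (cctrans c f)\<bar> \<le> K" by (simp add: K_def)
    qed
    show "\<forall>f\<in>F. \<bar>b (ctrans c f)\<bar> \<le> K"
    proof
      fix f assume "f \<in> F"
      then have "norm (b (ctrans c f)) \<le> K2" using K2 by blast
      then show "\<bar>b (ctrans c f)\<bar> \<le> K" by (simp add: K_def)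
    qed
    show "\<forall>p. \<bar>h p\<bar> \<le> K" using K3(2) by (auto simp: K_def le_max_iff_disj)
  qed
qed

lemma D_cont: "(a, b, h) \<in> D \<Longrightarrow> continuous_on UNIV h"
  by (simp add: D3_def)

lemma dD_bdd:
  assumes "(a, b, h) \<in> D" "(a', b', h') \<in> D"
  shows "bdd_above ((\<lambda>g. \<bar>a g - a' g\<bar>) ` G1)" "bdd_above ((\<lambda>g. \<bar>b g - b' g\<bar>) ` G2)"
    "bdd_above (range (\<lambda>p. \<bar>h p - h' p\<bar>))"
proof -
  obtain K where K: "\<forall>f\<in>F. \<bar>a (cctrans c f)\<bar> \<le> K" "\<forall>f\<in>F. \<bar>b (ctrans c f)\<bar> \<le> K" "\<forall>p. \<bar>h p\<bar> \<le> K"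
    by (rule D_bounds[OF assms(1)])
  obtain K' where K': "\<forall>f\<in>F. \<bar>a' (cctrans c f)\<bar> \<le> K'" "\<forall>f\<in>F. \<bar>b' (ctrans c f)\<bar> \<le> K'" "\<forall>p. \<bar>h' p\<bar> \<le> K'"
    by (rule D_bounds[OF assms(2)])
  have t: "\<bar>u - v\<bar> \<le> K + K'" if "\<bar>u\<bar> \<le> K" "\<bar>v\<bar> \<le> K'" for u v :: real using that by linarith
  show "bdd_above ((\<lambda>g. \<bar>a g - a' g\<bar>) ` G1)" using t K(1) K'(1) by (intro bdd_aboveI2[where M="K + K'"]) auto
  show "bdd_above ((\<lambda>g. \<bar>b g - b' g\<bar>) ` G2)" using t K(2) K'(2) by (intro bdd_aboveI2[where M="K + K'"]) auto
  show "bdd_above (range (\<lambda>p. \<bar>h p - h' p\<bar>))" using t K(3) K'(3) by (intro bdd_aboveI2[where M="K + K'"]) auto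
qed

lemma dD_ge:
  assumes "(a, b, h) \<in> D" "(a', b', h') \<in> D"
  shows "f \<in> F \<Longrightarrow> \<bar>a (cctrans c f) - a' (cctrans c f)\<bar> \<le> dD (a, b, h) (a', b', h')"
    "f \<in> F \<Longrightarrow> \<bar>b (ctrans c f) - b' (ctrans c f)\<bar> \<le> dD (a, b, h) (a', b', h')"
    "\<bar>h p - h' p\<bar> \<le> dD (a, b, h) (a', b', h')"
proof -
  show "\<bar>a (cctrans c f) - a' (cctrans c f)\<bar> \<le> dD (a, b, h) (a', b', h')" if "f \<in> F"
    using cSUP_upper[OF imageI[OF that] dD_bdd(1)[OF assms]] unfolding dist3_def by simp
  show "\<bar>b (ctrans c f) - b' (ctrans c f)\<bar> \<le> dD (a, b, h) (a', b', h')" if "f \<in> F"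
    using cSUP_upper[OF imageI[OF that] dD_bdd(2)[OF assms]] unfolding dist3_def by simp
  show "\<bar>h p - h' p\<bar> \<le> dD (a, b, h) (a', b', h')"
    using cSUP_upper[OF UNIV_I dD_bdd(3)[OF assms], of p] unfolding dist3_def by simp
qed

lemma dD_le:
  assumes "\<And>f. f \<in> F \<Longrightarrow> \<bar>a (cctrans c f) - a' (cctrans c f)\<bar> \<le> e"
    "\<And>f. f \<in> F \<Longrightarrow> \<bar>b (ctrans c f) - b' (ctrans c f)\<bar> \<le> e" "\<And>p. \<bar>h p - h' p\<bar> \<le> e"
  shows "dD (a, b, h) (a', b', h') \<le> e"
proof -
  have "(SUP g\<in>G1. \<bar>a g - a' g\<bar>) \<le> e" "(SUP g\<in>G2. \<bar>b g - b' g\<bar>) \<le> e" "(SUP p. \<bar>h p - h' p\<bar>) \<le> e"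
    using F_ne assms by (auto intro!: cSUP_least)
  then show ?thesis unfolding dist3_def by simp
qed

lemma dD_nonneg:
  assumes "z \<in> D" "z' \<in> D"
  shows "0 \<le> dD z z'"
proof -
  obtain a b h where z1: "z = (a, b, h)" by (rule prod_cases3)
  obtain a' b' h' where z2: "z' = (a', b', h')" by (rule prod_cases3)
  note z = z1 z2
  from dD_ge(3)[of a b h a' b' h' undefined] assms show ?thesis unfolding z by simp
qed

lemma dD_sym: "dD z z' = dD z' z"
  unfolding dist3_def by (simp add: abs_minus_commute split: prod.splits)

lemma dD_refl: "dD z z = 0"
proof -
  have "(SUP g\<in>G1. 0::real) = 0" "(SUP g\<in>G2. 0::real) = 0" using F_ne by (auto intro!: cSUP_const)
  then show ?thesis unfolding dist3_def by (simp split: prod.splits)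
qed

lemma dD_triangle:
  assumes "z1 \<in> D" "z2 \<in> D" "z3 \<in> D"
  shows "dD z1 z3 \<le> dD z1 z2 + dD z2 z3"
proof -
  obtain a b h where z1: "z1 = (a, b, h)" by (rule prod_cases3)
  obtain a' b' h' where z2: "z2 = (a', b', h')" by (rule prod_cases3)
  obtain a'' b'' h'' where z3: "z3 = (a'', b'', h'')" by (rule prod_cases3)
  note z = z1 z2 z3
  note d1 = dD_ge[OF assms(1,2)[unfolded z]] and d2 = dD_ge[OF assms(2,3)[unfolded z]]
  show ?thesis unfolding z
  proof (rule dD_le)
    fix f assume f: "f \<in> F"
    show "\<bar>a (cctrans c f) - a'' (cctrans c f)\<bar> \<le> dD (a, b, h) (a', b', h') + dD (a', b', h') (a'', b'', h'')"
      using d1(1)[OF f] d2(1)[OF f] by linarith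
    show "\<bar>b (ctrans c f) - b'' (ctrans c f)\<bar> \<le> dD (a, b, h) (a', b', h') + dD (a', b', h') (a'', b'', h'')"
      using d1(2)[OF f] d2(2)[OF f] by linarith
  next
    fix p show "\<bar>h p - h'' p\<bar> \<le> dD (a, b, h) (a', b', h') + dD (a', b', h') (a'', b'', h'')"
      using d1(3)[of p] d2(3)[of p] by linarith
  qed
qed

text \<open>The distance \<open>dD\<close> is only a pseudometric: it ignores the values of \<open>a\<close> and \<open>b\<close> outside the
  two classes of transforms, as does the continuity condition in \<open>D0\<close>.\<close>

definition D0 where
  "D0 = {(a, b, h). (a, b, h) \<in> D \<and> (\<forall>f\<in>F. \<forall>e>0. \<exists>\<delta>>0. \<forall>g\<in>F. (\<forall>x. \<bar>f x - g x\<bar> \<le> \<delta>) \<longrightarrow>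
     \<bar>a (cctrans c f) - a (cctrans c g)\<bar> \<le> e \<and> \<bar>b (ctrans c f) - b (ctrans c g)\<bar> \<le> e)}"

text \<open>At each \<open>f\<close> a nearby triple in \<open>D0\<close> lends its
  \<open>\<delta>\<close>, and two approximation errors below \<open>e / 3\<close> are added. The
  pseudometric controls both errors uniformly over the classes.\<close>

lemma D0_closed:
  assumes z: "z \<in> D" and ex: "\<And>e. 0 < e \<Longrightarrow> \<exists>z'\<in>D0. dD z z' < e"
  shows "z \<in> D0"
proof -
  obtain a b h where zz: "z = (a, b, h)" by (rule prod_cases3)
  have "\<exists>\<delta>>0. \<forall>g\<in>F. (\<forall>x. \<bar>f x - g x\<bar> \<le> \<delta>) \<longrightarrow>
     \<bar>a (cctrans c f) - a (cctrans c g)\<bar> \<le> e \<and> \<bar>b (ctrans c f) - b (ctrans c g)\<bar> \<le> e"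
    if f: "f \<in> F" and e: "0 < e" for f e
  proof -
    have e3: "0 < e / 3" using e by simp
    from ex[OF e3] obtain z' where z'0: "z' \<in> D0" "dD z z' < e / 3" by blast
    obtain a' b' h' where "z' = (a', b', h')" by (rule prod_cases3)
    with z'0 zz have z': "(a', b', h') \<in> D0" and lt: "dD (a, b, h) (a', b', h') < e / 3" by simp_all
    have zD': "(a', b', h') \<in> D" using z' by (simp add: D0_def)
    have "\<exists>\<delta>>0. \<forall>g\<in>F. (\<forall>x. \<bar>f x - g x\<bar> \<le> \<delta>) \<longrightarrow>
       \<bar>a' (cctrans c f) - a' (cctrans c g)\<bar> \<le> e / 3 \<and> \<bar>b' (ctrans c f) - b' (ctrans c g)\<bar> \<le> e / 3"
      using z' f e3 unfolding D0_def by blast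
    then obtain \<delta> where \<delta>: "\<delta> > 0" "\<And>g. g \<in> F \<Longrightarrow> \<forall>x. \<bar>f x - g x\<bar> \<le> \<delta> \<Longrightarrow>
       \<bar>a' (cctrans c f) - a' (cctrans c g)\<bar> \<le> e / 3 \<and> \<bar>b' (ctrans c f) - b' (ctrans c g)\<bar> \<le> e / 3" by blast
    note d = dD_ge[OF z[unfolded zz] zD']
    have "\<bar>a (cctrans c f) - a (cctrans c g)\<bar> \<le> e \<and> \<bar>b (ctrans c f) - b (ctrans c g)\<bar> \<le> e"
      if g: "g \<in> F" "\<forall>x. \<bar>f x - g x\<bar> \<le> \<delta>" for g
      using \<delta>(2)[OF g] d(1)[OF f] d(1)[OF g(1)] d(2)[OF f] d(2)[OF g(1)] lt by linarith
    then show ?thesis using \<delta>(1) by blast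
  qed
  then show ?thesis using z unfolding zz D0_def by simp
qed

section \<open>Limit and bounding functionals\<close>

definition Ipl :: "('x \<times> 'y \<Rightarrow> real) \<Rightarrow> real" where
  "Ipl h = (INF \<pi>\<in>opt_plans \<mu> \<nu> c. integral\<^sup>L \<pi> h)"

definition Inear :: "nat \<Rightarrow> ('x \<times> 'y \<Rightarrow> real) \<Rightarrow> real" where
  "Inear j h = (INF \<pi>\<in>near_opt_plans \<mu> \<nu> c (1 / real (Suc j)). integral\<^sup>L \<pi> h)"

definition Ssup :: "(('x \<Rightarrow> real) \<Rightarrow> real) \<Rightarrow> (('y \<Rightarrow> real) \<Rightarrow> real) \<Rightarrow> real" where
  "Ssup a b = (SUP f\<in>Sc F \<mu> \<nu> c. a (cctrans c f) + b (ctrans c f))"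

text \<open>\<open>s\<close> bounds the contribution of the cost perturbation at optimal potentials and the cruder \<open>t\<close>
  the one at arbitrary potentials, which pay for their suboptimality at the rate \<open>\<rho>\<close>.\<close>

definition Usup :: "real \<Rightarrow> real \<Rightarrow> real \<Rightarrow> (('x \<Rightarrow> real) \<Rightarrow> real) \<Rightarrow> (('y \<Rightarrow> real) \<Rightarrow> real) \<Rightarrow> real" where
  "Usup \<rho> s t a b = (SUP f\<in>F. min s (t - \<rho> * (OTc - J f)) + (a (cctrans c f) + b (ctrans c f)))"

lemma near_ne: "near_opt_plans \<mu> \<nu> c (1 / real (Suc j)) \<noteq> {}"
  using opt_plans_subset_near[of "1 / real (Suc j)" \<mu> \<nu> c] opt_ne by auto

lemma INF_plans_Lipschitz:
  assumes S: "\<And>\<pi>. \<pi> \<in> S \<Longrightarrow> prob_space \<pi> \<and> sets \<pi> = sets borel" "S \<noteq> {}"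
    and h: "continuous_on UNIV h" and h': "continuous_on UNIV h'" and d: "\<And>p. \<bar>h p - h' p\<bar> \<le> e"
  shows "\<bar>(INF \<pi>\<in>S. integral\<^sup>L \<pi> h) - (INF \<pi>\<in>S. integral\<^sup>L \<pi> (h' :: 'x \<times> 'y \<Rightarrow> real))\<bar> \<le> e"
proof (rule abs_cINF_diff_le[OF S(2) bdd_plan_integrals[OF XY_cpt h S(1)] bdd_plan_integrals[OF XY_cpt h' S(1)]])
  fix \<pi> assume "\<pi> \<in> S"
  then have "prob_space \<pi>" "sets \<pi> = sets borel" using S(1) by auto
  then show "\<bar>integral\<^sup>L \<pi> h - integral\<^sup>L \<pi> h'\<bar> \<le> e" by (rule abs_integral_prob_diff_le[OF XY_cpt _ _ h h' d])
qed

lemma Ipl_Lipschitz: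
  assumes "continuous_on UNIV h" "continuous_on UNIV h'" "\<And>p. \<bar>h p - h' p\<bar> \<le> e"
  shows "\<bar>Ipl h - Ipl h'\<bar> \<le> e"
  unfolding Ipl_def using assms by (intro INF_plans_Lipschitz[OF opt_plansD opt_ne])

lemma Inear_Lipschitz:
  assumes "continuous_on UNIV h" "continuous_on UNIV h'" "\<And>p. \<bar>h p - h' p\<bar> \<le> e"
  shows "\<bar>Inear j h - Inear j h'\<bar> \<le> e"
  unfolding Inear_def using assms by (intro INF_plans_Lipschitz[OF near_opt_plansD near_ne])

lemma Inear_tendsto: "continuous_on UNIV h \<Longrightarrow> (\<lambda>j. Inear j h) \<longlonglongrightarrow> Ipl h"
  unfolding Inear_def Ipl_def by (rule INF_near_opt_tendsto[OF X_cpt Y_cpt c_cont mu nu opt_ne])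

lemma Inear_le:
  assumes "continuous_on UNIV h" "\<pi> \<in> near_opt_plans \<mu> \<nu> c (1 / real (Suc j))"
  shows "Inear j h \<le> integral\<^sup>L \<pi> h"
  unfolding Inear_def
  by (rule cINF_lower[OF bdd_plan_integrals[OF XY_cpt assms(1) near_opt_plansD] assms(2)])

lemma Ipl_le_norm:
  assumes h: "continuous_on UNIV h" and K: "\<forall>p. \<bar>h p\<bar> \<le> K"
  shows "Ipl h \<le> K"
proof -
  obtain \<pi> where \<pi>: "\<pi> \<in> opt_plans \<mu> \<nu> c" using opt_ne by blast
  have "Ipl h \<le> integral\<^sup>L \<pi> h" unfolding Ipl_def
    by (rule cINF_lower[OF bdd_plan_integrals[OF XY_cpt h opt_plansD] \<pi>])
  also have "\<dots> \<le> K"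
    using abs_integral_prob_le[OF XY_cpt _ _ h K[rule_format], of \<pi>] opt_plansD[OF \<pi>] by simp
  finally show ?thesis .
qed

lemma Ssup_bdd:
  assumes "(a, b, h) \<in> D"
  shows "bdd_above ((\<lambda>f. a (cctrans c f) + b (ctrans c f)) ` Sc F \<mu> \<nu> c)"
proof -
  obtain K where K: "\<forall>f\<in>F. \<bar>a (cctrans c f)\<bar> \<le> K" "\<forall>f\<in>F. \<bar>b (ctrans c f)\<bar> \<le> K"
    by (rule D_bounds[OF assms])
  show ?thesis
  proof (rule bdd_aboveI2[where M="K + K"])
    fix f assume "f \<in> Sc F \<mu> \<nu> c"
    then have "f \<in> F" by (simp add: Sc_iff)
    from bspec[OF K(1) this] bspec[OF K(2) this] show "a (cctrans c f) + b (ctrans c f) \<le> K + K" by linarith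
  qed
qed

lemma Usup_bdd:
  assumes "(a, b, h) \<in> D"
  shows "bdd_above ((\<lambda>f. min s (t - \<rho> * (OTc - J f)) + (a (cctrans c f) + b (ctrans c f))) ` F)"
proof -
  obtain K where K: "\<forall>f\<in>F. \<bar>a (cctrans c f)\<bar> \<le> K" "\<forall>f\<in>F. \<bar>b (ctrans c f)\<bar> \<le> K"
    by (rule D_bounds[OF assms])
  show ?thesis
  proof (rule bdd_aboveI2[where M="s + (K + K)"])
    fix f assume "f \<in> F"
    from bspec[OF K(1) this] bspec[OF K(2) this] show "min s (t - \<rho> * (OTc - J f)) + (a (cctrans c f) + b (ctrans c f)) \<le> s + (K + K)"
      by linarith
  qed
qed

lemma Ssup_Lipschitz:
  assumes "(a, b, h) \<in> D" "(a', b', h') \<in> D"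
  shows "\<bar>Ssup a b - Ssup a' b'\<bar> \<le> 2 * dD (a, b, h) (a', b', h')"
  unfolding Ssup_def
proof (rule abs_cSUP_diff_le[OF Sc_ne Ssup_bdd[OF assms(1)] Ssup_bdd[OF assms(2)]])
  fix f assume "f \<in> Sc F \<mu> \<nu> c"
  then have f: "f \<in> F" by (simp add: Sc_iff)
  show "\<bar>a (cctrans c f) + b (ctrans c f) - (a' (cctrans c f) + b' (ctrans c f))\<bar> \<le> 2 * dD (a, b, h) (a', b', h')"
    using dD_ge(1)[OF assms f] dD_ge(2)[OF assms f] by linarith
qed

lemma Usup_Lipschitz:
  assumes "(a, b, h) \<in> D" "(a', b', h') \<in> D" and s: "\<bar>s - s'\<bar> \<le> es" and t: "\<bar>t - t'\<bar> \<le> et"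
  shows "\<bar>Usup \<rho> s t a b - Usup \<rho> s' t' a' b'\<bar> \<le> es + et + 2 * dD (a, b, h) (a', b', h')"
  unfolding Usup_def
proof (rule abs_cSUP_diff_le[OF F_ne Usup_bdd[OF assms(1)] Usup_bdd[OF assms(2)]])
  fix f assume f: "f \<in> F"
  define R where "R = \<rho> * (OTc - J f)"
  have "\<bar>min s (t - R) - min s' (t' - R)\<bar> \<le> es + et" using s t by linarith
  then show "\<bar>min s (t - \<rho> * (OTc - J f)) + (a (cctrans c f) + b (ctrans c f))
      - (min s' (t' - \<rho> * (OTc - J f)) + (a' (cctrans c f) + b' (ctrans c f)))\<bar>
      \<le> es + et + 2 * dD (a, b, h) (a', b', h')"
    using dD_ge(1)[OF assms(1,2) f] dD_ge(2)[OF assms(1,2) f] unfolding R_def by linarith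
qed

lemma Usup_ge:
  assumes "(a, b, h) \<in> D" "f \<in> F" "v \<le> min s (t - \<rho> * (OTc - J f)) + (a (cctrans c f) + b (ctrans c f))"
  shows "v \<le> Usup \<rho> s t a b"
  unfolding Usup_def using assms(3) by (rule order_trans[OF _ cSUP_upper[OF assms(2) Usup_bdd[OF assms(1)]]])

text \<open>At a maximizer the penalty vanishes and \<open>s \<le> t\<close> makes the minimum equal
  to \<open>s\<close>; this gives the lower bound. Conversely, near-maximizers of the penalised
  problem have a gap \<open>OTc - J f\<close> of order \<open>1 / j\<close>. By compactness of
  \<open>F\<close> they cluster at a maximizer, and continuity in \<open>D0\<close> carries the
  values of \<open>a\<close> and \<open>b\<close> there.\<close>

lemma Usup_tendsto:
  assumes z: "(a, b, h) \<in> D0" and st: "s \<le> t"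
  shows "(\<lambda>j. Usup (real j) s t a b) \<longlonglongrightarrow> s + Ssup a b"
proof -
  have zD: "(a, b, h) \<in> D" using z by (simp add: D0_def)
  obtain K where K: "0 \<le> K" "\<forall>f\<in>F. \<bar>a (cctrans c f)\<bar> \<le> K" "\<forall>f\<in>F. \<bar>b (ctrans c f)\<bar> \<le> K"
    by (rule D_bounds[OF zD])
  define T where "T f = a (cctrans c f) + b (ctrans c f)" for f
  have TS: "T f \<le> Ssup a b" if "f \<in> Sc F \<mu> \<nu> c" for f
    unfolding T_def Ssup_def by (rule cSUP_upper[OF that Ssup_bdd[OF zD]])
  have low: "s + Ssup a b \<le> Usup (real j) s t a b" for j
  proof -
    have "Ssup a b \<le> Usup (real j) s t a b - s"
      unfolding Ssup_def
    proof (rule cSUP_least[OF Sc_ne])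
      fix f assume "f \<in> Sc F \<mu> \<nu> c"
      then have f: "f \<in> F" "J f = OTc" by (simp_all add: Sc_iff)
      have "s + T f \<le> Usup (real j) s t a b"
        by (rule Usup_ge[OF zD f(1)]) (use st f(2) in \<open>simp add: T_def\<close>)
      then show "a (cctrans c f) + b (ctrans c f) \<le> Usup (real j) s t a b - s" by (simp add: T_def)
    qed
    then show ?thesis by linarith
  qed
  have dec: "Usup (real j') s t a b \<le> Usup (real j) s t a b" if "j \<le> j'" for j j'
    unfolding Usup_def
  proof (rule cSUP_mono[OF F_ne Usup_bdd[OF zD]])
    fix f assume f: "f \<in> F"
    have "real j * (OTc - J f) \<le> real j' * (OTc - J f)"
      using that J_le_OT[OF f] by (intro mult_right_mono) auto
    then show "\<exists>g\<in>F. min s (t - real j' * (OTc - J f)) + (a (cctrans c f) + b (ctrans c f))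
        \<le> min s (t - real j * (OTc - J g)) + (a (cctrans c g) + b (ctrans c g))"
      by (intro bexI[OF _ f]) linarith
  qed
  have ex: "\<exists>j. Usup (real j) s t a b < s + Ssup a b + e" if e: "0 < e" for e
  proof (rule ccontr)
    assume "\<not> ?thesis"
    then have ge: "s + Ssup a b + e \<le> Usup (real j) s t a b" for j by (simp add: not_less)
    have "\<forall>j. \<exists>f. f \<in> F \<and> s + Ssup a b + e / 2 < min s (t - real j * (OTc - J f)) + T f"
    proof
      fix j
      have "s + Ssup a b + e / 2 < Usup (real j) s t a b" using ge[of j] e by linarith
      then show "\<exists>f. f \<in> F \<and> s + Ssup a b + e / 2 < min s (t - real j * (OTc - J f)) + T f"
        unfolding Usup_def less_cSUP_iff[OF F_ne Usup_bdd[OF zD]] T_def by blast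
    qed
    then obtain f where f: "\<And>j. f j \<in> F"
      and gt: "\<And>j. s + Ssup a b + e / 2 < min s (t - real j * (OTc - J (f j))) + T (f j)"
      unfolding choice_iff by blast
    have f': "f j \<in> Fclass B W" for j using f[of j] by (simp add: F_def)
    obtain r g where r: "strict_mono (r :: nat \<Rightarrow> nat)" and "g \<in> Fclass B W"
      and ul: "uniform_limit UNIV (\<lambda>j. f (r j)) g sequentially"
      by (rule Fclass_convergent_subseq[of W f B, OF X_cpt W0 f'])
    then have g: "g \<in> F" by (simp add: F_def)
    have near: "\<forall>\<^sub>F j in sequentially. \<forall>x. \<bar>g x - f (r j) x\<bar> \<le> \<delta>" if "0 < \<delta>" for \<delta>
      using uniform_limitD[OF ul that]
      by eventually_elim (auto simp: dist_real_def abs_minus_commute less_imp_le)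
    have Jlim: "(\<lambda>j. J (f (r j))) \<longlonglongrightarrow> J g"
    proof (rule tendstoI)
      fix \<epsilon> :: real assume \<epsilon>: "0 < \<epsilon>"
      then have "0 < \<epsilon> / 3" by simp
      from near[OF this] show "\<forall>\<^sub>F j in sequentially. dist (J (f (r j))) (J g) < \<epsilon>"
      proof eventually_elim
        case (elim j)
        from J_diff[OF g f elim] show ?case using \<epsilon> by (simp add: dist_real_def abs_minus_commute)
      qed
    qed
    \<comment> \<open>The objective stays above a fixed number while \<open>a\<close> and
      \<open>b\<close> are bounded on the class, so the penalty at rate \<open>j\<close> stays
      bounded.\<close>
    have gap: "OTc - J (f j) \<le> (t - s - Ssup a b + 2 * K) / real j" if "0 < j" for j
    proof -
      have "T (f j) \<le> 2 * K" using bspec[OF K(2) f, of j] bspec[OF K(3) f, of j] unfolding T_def by linarith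
      then have "real j * (OTc - J (f j)) \<le> t - s - Ssup a b + 2 * K"
        using gt[of j] e by linarith
      then show ?thesis using that by (simp add: le_divide_eq mult.commute)
    qed
    have "(\<lambda>j. (t - s - Ssup a b + 2 * K) / real j) \<longlonglongrightarrow> 0" by (rule lim_const_over_n)
    from LIMSEQ_subseq_LIMSEQ[OF this r]
    have z0: "(\<lambda>j. (t - s - Ssup a b + 2 * K) / real (r j)) \<longlonglongrightarrow> 0" by (simp add: o_def)
    have "OTc - J g \<le> 0"
    proof (rule LIMSEQ_le[OF tendsto_diff[OF tendsto_const Jlim] z0])
      have "0 < r j" if "1 \<le> j" for j using seq_suble[OF r, of j] that by linarith
      then show "\<exists>N. \<forall>j\<ge>N. OTc - J (f (r j)) \<le> (t - s - Ssup a b + 2 * K) / real (r j)"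
        using gap by blast
    qed
    then have gS: "g \<in> Sc F \<mu> \<nu> c" using g J_le_OT[OF g] by (simp add: Sc_iff)
    \<comment> \<open>\<open>a\<close> and \<open>b\<close> change by at most \<open>e / 8\<close>
      each, which stays below the surplus \<open>e / 2\<close> of the near-maximizers.\<close>
    have e8: "0 < e / 8" using e by simp
    have "\<exists>\<delta>>0. \<forall>g'\<in>F. (\<forall>x. \<bar>g x - g' x\<bar> \<le> \<delta>) \<longrightarrow>
       \<bar>a (cctrans c g) - a (cctrans c g')\<bar> \<le> e / 8 \<and> \<bar>b (ctrans c g) - b (ctrans c g')\<bar> \<le> e / 8"
      using z g e8 unfolding D0_def by blast
    then obtain \<delta> where \<delta>: "0 < \<delta>" "\<And>g'. g' \<in> F \<Longrightarrow> \<forall>x. \<bar>g x - g' x\<bar> \<le> \<delta> \<Longrightarrow>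
       \<bar>a (cctrans c g) - a (cctrans c g')\<bar> \<le> e / 8 \<and> \<bar>b (ctrans c g) - b (ctrans c g')\<bar> \<le> e / 8" by blast
    obtain j where j: "\<forall>x. \<bar>g x - f (r j) x\<bar> \<le> \<delta>"
      using near[OF \<delta>(1)] by (auto simp: eventually_sequentially)
    have "T (f (r j)) \<le> T g + e / 4" using \<delta>(2)[OF f j] unfolding T_def by linarith
    moreover have "Ssup a b + e / 2 < T (f (r j))" using gt[of "r j"] by linarith
    ultimately show False using TS[OF gS] e by linarith
  qed
  show ?thesis
  proof (rule LIMSEQ_I)
    fix e :: real assume "0 < e"
    from ex[OF this] obtain j0 where "Usup (real j0) s t a b < s + Ssup a b + e" by blast
    then have "norm (Usup (real j) s t a b - (s + Ssup a b)) < e" if "j0 \<le> j" for j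
      using dec[OF that] low[of j] by simp
    then show "\<exists>no. \<forall>j\<ge>no. norm (Usup (real j) s t a b - (s + Ssup a b)) < e" by blast
  qed
qed

end

section \<open>Deterministic bounds for one sample\<close>

text \<open>With \<open>w 0 = 0\<close>, concavity puts \<open>w\<close> above the chord from 0 to
  \<open>a + b\<close>; the chord values at \<open>a\<close> and \<open>b\<close> add up to
  \<open>w (a + b)\<close>.\<close>

lemma concave_modulus_subadditive:
  assumes w: "concave_modulus w" and a: "0 \<le> a" and b: "0 \<le> b"
  shows "w (a + b) \<le> w a + w b"
proof (cases "a + b = 0")
  case True
  then show ?thesis using w a b by (simp add: concave_modulus_def)
next
  case False
  then have s: "0 < a + b" using a b by linarith
  have cc: "concave_on {0..} w" and w0: "w 0 = 0" using w by (auto simp: concave_modulus_def)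
  have part: "t / (a + b) * w (a + b) \<le> w t" if t: "0 \<le> t" "t \<le> a + b" for t
  proof -
    define u where "u = t / (a + b)"
    have u: "0 \<le> u" "u \<le> 1" using t s by (auto simp: u_def divide_le_eq)
    have "(1 - u) * w 0 + u * w (a + b) \<le> w ((1 - u) *\<^sub>R 0 + u *\<^sub>R (a + b))"
      using a b u by (intro concave_onD[OF cc]) auto
    moreover have "u * (a + b) = t" using s by (simp add: u_def)
    ultimately show ?thesis using w0 by (simp add: u_def)
  qed
  have "w (a + b) = a / (a + b) * w (a + b) + b / (a + b) * w (a + b)"
    using s by (simp flip: distrib_right add_divide_distrib)
  also have "\<dots> \<le> w a + w b" using part[of a] part[of b] a b by linarith
  finally show ?thesis .
qed

lemma concave_modulus_mono:
  assumes w: "concave_modulus w" and "0 \<le> s" "s \<le> t"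
  shows "w s \<le> w t"
proof -
  have "mono_on {0..} w" using w by (simp add: concave_modulus_def)
  then show ?thesis using assms(2,3) by (intro mono_onD[of "{0..}" w]) auto
qed

text \<open>Monotonicity and subadditivity give \<open>w\<close> composed with \<open>dist\<close>
  its own triangle inequality. This is what controls the modulus of an inf-convolution.\<close>

lemma concave_modulus_dist_diff:
  assumes w: "concave_modulus w"
  shows "\<bar>w (dist x z) - w (dist x' z)\<bar> \<le> w (dist x x')"
proof -
  note mono = concave_modulus_mono[OF w]
  have "w (dist x z) \<le> w (dist x x' + dist x' z)" by (rule mono) (auto intro: dist_triangle)
  also have "\<dots> \<le> w (dist x x') + w (dist x' z)" by (rule concave_modulus_subadditive[OF w]) auto
  finally have 1: "w (dist x z) \<le> w (dist x x') + w (dist x' z)" .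
  have "w (dist x' z) \<le> w (dist x x' + dist x z)"
    by (rule mono) (auto intro: dist_triangle3 simp: dist_commute)
  also have "\<dots> \<le> w (dist x x') + w (dist x z)" by (rule concave_modulus_subadditive[OF w]) auto
  finally show ?thesis using 1 by linarith
qed

text \<open>Inf-convolution with twice the modulus gives a cost of modulus exactly \<open>2 w\<close>. As \<open>c\<close> has
  modulus \<open>w\<close>, only points at distance at most \<open>\<delta>\<close> can lower the value, so the error is
  governed by the oscillation of the scaled perturbation \<open>h\<close>.\<close>

lemma cost_regularization:
  fixes c c' :: "'x::metric_space \<times> 'y \<Rightarrow> real"
  assumes w: "concave_modulus w" and c_w: "\<forall>x x' y. \<bar>c (x, y) - c (x', y)\<bar> \<le> w (dist x x')"
    and c': "\<forall>p. \<bar>c' p\<bar> \<le> C'" and r: "0 < r" and h: "\<And>p. h p = r * (c' p - c p)"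
    and K: "\<forall>p. \<bar>h p\<bar> \<le> K" and \<delta>: "0 < \<delta>" "2 * K < r * w \<delta>"
  obtains ct where "\<forall>p. \<bar>ct p\<bar> \<le> C'" "\<forall>x x' y. \<bar>ct (x, y) - ct (x', y)\<bar> \<le> 2 * w (dist x x')"
    "\<forall>p. ct p \<le> c' p" "\<forall>p. c' p \<le> ct p + osc \<delta> h / r"
proof -
  have w0: "w 0 = 0" and wn: "\<And>t. 0 \<le> t \<Longrightarrow> 0 \<le> w t"
    using w by (auto simp: concave_modulus_def)
  note wm = concave_modulus_mono[OF w]
  define g where "g x y x' = c' (x', y) + 2 * w (dist x x')" for x x' :: 'x and y
  define ct where "ct = (\<lambda>(x, y). INF x'. g x y x')"
  have gl: "- C' \<le> g x y x'" for x y x'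
    using c'[rule_format, of "(x', y)"] wn[of "dist x x'"] unfolding g_def by auto
  have bdd: "bdd_below (range (g x y))" for x y using gl by (intro bdd_belowI2) auto
  have ct_le: "ct (x, y) \<le> g x y x'" for x y x' unfolding ct_def by (auto intro: cINF_lower bdd)
  have le: "ct (x, y) \<le> c' (x, y)" for x y using ct_le[of x y x] by (simp add: g_def w0)
  have ge: "- C' \<le> ct (x, y)" for x y unfolding ct_def using gl by (auto intro!: cINF_greatest)
  have b: "\<forall>p. \<bar>ct p\<bar> \<le> C'"
  proof
    fix p :: "'x \<times> 'y"
    obtain x y where p: "p = (x, y)" by (cases p)
    show "\<bar>ct p\<bar> \<le> C'" using le[of x y] ge[of x y] c'[rule_format, of p] unfolding p by linarith
  qed
  have m: "\<bar>ct (x, y) - ct (z, y)\<bar> \<le> 2 * w (dist x z)" for x z y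
    unfolding ct_def prod.case
  proof (rule abs_cINF_diff_le[OF _ bdd bdd])
    fix x' show "\<bar>g x y x' - g z y x'\<bar> \<le> 2 * w (dist x z)"
      using concave_modulus_dist_diff[OF w, of x x' z] unfolding g_def by linarith
  qed simp
  have O0: "0 \<le> osc \<delta> h" using osc_nonneg[OF K] \<delta>(1) by simp
  have up: "c' (x, y) \<le> ct (x, y) + osc \<delta> h / r" for x y
  proof -
    have "c' (x, y) - osc \<delta> h / r \<le> g x y x'" for x'
    proof -
      have ch: "c' p = c p + h p / r" for p using r h[of p] by simp
      have cw: "c (x, y) \<le> c (x', y) + w (dist x x')" using c_w[rule_format, of x y x'] by linarith
      show ?thesis
      \<comment> \<open>One copy of \<open>w (dist x x')\<close> pays for the change of
        \<open>c\<close>. For near points the oscillation pays for the change of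
        \<open>h / r\<close>; for distant points the second copy does, as that change is at most
        \<open>2 * K / r < w \<delta>\<close>.\<close>
      proof (cases "dist x x' \<le> \<delta>")
        case True
        from osc_ge[OF K this, of y] have "h (x, y) - h (x', y) \<le> osc \<delta> h" by linarith
        then have "(h (x, y) - h (x', y)) / r \<le> osc \<delta> h / r" using r by (intro divide_right_mono) auto
        then have "h (x, y) / r \<le> h (x', y) / r + osc \<delta> h / r" by (simp add: diff_divide_distrib)
        then show ?thesis unfolding g_def ch using cw wn[of "dist x x'"] by simp
      next
        case False
        have "h (x, y) - h (x', y) \<le> 2 * K" using K[rule_format, of "(x, y)"] K[rule_format, of "(x', y)"] by linarith
        also have "\<dots> \<le> r * w \<delta>" using \<delta>(2) by simp
        also have "\<dots> \<le> r * w (dist x x')" using False \<delta>(1) r by (intro mult_left_mono wm) auto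
        finally have "(h (x, y) - h (x', y)) / r \<le> w (dist x x')" using r by (simp add: divide_le_eq mult.commute)
        then have "h (x, y) / r \<le> h (x', y) / r + w (dist x x')" by (simp add: diff_divide_distrib)
        moreover have "0 \<le> osc \<delta> h / r" using O0 r by simp
        ultimately show ?thesis unfolding g_def ch using cw by linarith
      qed
    qed
    then have "c' (x, y) - osc \<delta> h / r \<le> ct (x, y)" unfolding ct_def by (auto intro!: cINF_greatest)
    then show ?thesis by linarith
  qed
  show ?thesis
  proof (rule that[OF b])
    show "\<forall>x x' y. \<bar>ct (x, y) - ct (x', y)\<bar> \<le> 2 * w (dist x x')" using m by blast
    show "\<forall>p. ct p \<le> c' p" using le by (simp add: split_paired_all)
    show "\<forall>p. c' p \<le> ct p + osc \<delta> h / r" using up by (simp add: split_paired_all)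
  qed
qed

text \<open>The class is larger than \<open>c\<close> itself requires: it contains the potentials of
  \<open>c\<close>, found in \<open>Fclass C w\<close>, and those of regularized perturbed costs,
  found in \<open>Fclass (C + 1) (\<lambda>t. 2 * w t)\<close>.\<close>

locale compact_ot_modulus = compact_ot \<mu> \<nu> c "\<lambda>t. 2 * w t" "2 * C + 1" C
  for \<mu> :: "'x::metric_space measure" and \<nu> :: "'y::metric_space measure"
    and c :: "'x \<times> 'y \<Rightarrow> real" and w :: "real \<Rightarrow> real" and C :: real +
  assumes w_mod: "concave_modulus w"
    and c_w: "\<forall>x x' y. \<bar>c (x, y) - c (x', y)\<bar> \<le> w (dist x x')"
begin

lemma C_nonneg: "0 \<le> C"
  using C[rule_format, of undefined] by linarith

lemma w_nonneg: "0 \<le> t \<Longrightarrow> 0 \<le> w t"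
  using w_mod by (simp add: concave_modulus_def)

lemma Fclass_subset_F: "Fclass C w \<subseteq> F" "Fclass (C + 1) (\<lambda>t. 2 * w t) \<subseteq> F"
proof -
  show "Fclass C w \<subseteq> F"
  proof
    fix f :: "'x \<Rightarrow> real" assume f: "f \<in> Fclass C w"
    have "\<bar>f x\<bar> \<le> 2 * (2 * C + 1)" for x
    proof -
      have "\<bar>f x\<bar> \<le> 2 * C" using f by (simp add: Fclass_def)
      also have "2 * C \<le> 2 * (2 * C + 1)" using C_nonneg by simp
      finally show ?thesis .
    qed
    moreover have "\<bar>f x - f x'\<bar> \<le> 2 * w (dist x x')" for x x'
    proof -
      have "\<bar>f x - f x'\<bar> \<le> w (dist x x')" using f by (simp add: Fclass_def)
      then show ?thesis using w_nonneg[of "dist x x'"] zero_le_dist[of x x'] by linarith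
    qed
    ultimately show "f \<in> F" unfolding F_def by (simp add: Fclass_def)
  qed
  show "Fclass (C + 1) (\<lambda>t. 2 * w t) \<subseteq> F"
  proof
    fix f :: "'x \<Rightarrow> real" assume f: "f \<in> Fclass (C + 1) (\<lambda>t. 2 * w t)"
    have "\<bar>f x\<bar> \<le> 2 * (2 * C + 1)" for x
    proof -
      have "\<bar>f x\<bar> \<le> 2 * (C + 1)" using f by (simp add: Fclass_def)
      also have "\<dots> \<le> 2 * (2 * C + 1)" using C_nonneg by simp
      finally show ?thesis .
    qed
    then show "f \<in> F" using f unfolding F_def by (simp add: Fclass_def)
  qed
qed

text \<open>The origin, so that \<open>dD z z0\<close> plays the role of the norm of
  \<open>z\<close>.\<close>

definition z0 :: "(('x \<Rightarrow> real) \<Rightarrow> real) \<times> (('y \<Rightarrow> real) \<Rightarrow> real) \<times> ('x \<times> 'y \<Rightarrow> real)" where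
  "z0 = (\<lambda>_. 0, \<lambda>_. 0, \<lambda>_. 0)"

lemma z0_D: "z0 \<in> D"
proof -
  have "bounded ((\<lambda>_. 0::real) ` G1)" "bounded ((\<lambda>_. 0::real) ` G2)"
    by (rule bounded_subset[of "{0}"]; auto)+
  then show ?thesis unfolding z0_def D3_def by simp
qed

end

text \<open>One realisation of the samples and of the perturbed cost: everything inside is
  deterministic, and \<open>r\<close> is any positive number.\<close>

locale ot_sample = compact_ot_modulus \<mu> \<nu> c w C
  for \<mu> :: "'x::metric_space measure" and \<nu> :: "'y::metric_space measure"
    and c :: "'x \<times> 'y \<Rightarrow> real" and w :: "real \<Rightarrow> real" and C :: real +
  fixes N M :: nat and x :: "nat \<Rightarrow> 'x" and y :: "nat \<Rightarrow> 'y" and c' :: "'x \<times> 'y \<Rightarrow> real" and r :: real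
  assumes N: "0 < N" and M: "0 < M" and r: "0 < r" and c'_cont: "continuous_on UNIV c'"
begin

abbreviation "\<mu>' \<equiv> emp_meas N x"
abbreviation "\<nu>' \<equiv> emp_meas M y"

definition a :: "('x \<Rightarrow> real) \<Rightarrow> real" where "a g = r * (integral\<^sup>L \<mu>' g - integral\<^sup>L \<mu> g)"
definition b :: "('y \<Rightarrow> real) \<Rightarrow> real" where "b g = r * (integral\<^sup>L \<nu>' g - integral\<^sup>L \<nu> g)"
definition h :: "'x \<times> 'y \<Rightarrow> real" where "h p = r * (c' p - c p)"
definition K :: real where "K = dD (a, b, h) z0"

lemmas mu' = prob_space_emp_meas[OF N, of x] sets_emp_meas[of N x]
lemmas nu' = prob_space_emp_meas[OF M, of y] sets_emp_meas[of M y]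

lemma h_cont: "continuous_on UNIV h"
  unfolding h_def by (intro continuous_intros c_cont c'_cont)

lemma a_diff:
  assumes f: "f \<in> F" and g: "g \<in> F" and d: "\<forall>x. \<bar>f x - g x\<bar> \<le> e"
  shows "\<bar>a (cctrans c f) - a (cctrans c g)\<bar> \<le> 2 * r * e" "\<bar>b (ctrans c f) - b (ctrans c g)\<bar> \<le> 2 * r * e"
proof -
  have z: "\<forall>p. \<bar>c p - c p\<bar> \<le> 0" by simp
  have 1: "\<bar>cctrans c f x - cctrans c g x\<bar> \<le> e" for x
    using cctrans_diff_le[OF C F_bounded[OF f] C F_bounded[OF g] z d] by simp
  have 2: "\<bar>ctrans c f y - ctrans c g y\<bar> \<le> e" for y
    using ctrans_diff_le[OF C F_bounded[OF f] C F_bounded[OF g] _ d, of y y 0] by simp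
  have t: "\<bar>r * (u - v) - r * (u' - v')\<bar> \<le> 2 * r * e" if "\<bar>u - u'\<bar> \<le> e" "\<bar>v - v'\<bar> \<le> e" for u v u' v'
  proof -
    have "\<bar>(u - v) - (u' - v')\<bar> \<le> 2 * e" using that by linarith
    then have "r * \<bar>(u - v) - (u' - v')\<bar> \<le> r * (2 * e)" using r by (intro mult_left_mono) auto
    then show ?thesis using r by (simp add: abs_mult flip: right_diff_distrib)
  qed
  show "\<bar>a (cctrans c f) - a (cctrans c g)\<bar> \<le> 2 * r * e"
    unfolding a_def
    by (intro t abs_integral_prob_diff_le[OF X_cpt mu' cont_cc[OF f] cont_cc[OF g] 1]
        abs_integral_prob_diff_le[OF X_cpt mu cont_cc[OF f] cont_cc[OF g] 1])
  show "\<bar>b (ctrans c f) - b (ctrans c g)\<bar> \<le> 2 * r * e"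
    unfolding b_def
    by (intro t abs_integral_prob_diff_le[OF Y_cpt nu' cont_c[OF f] cont_c[OF g] 2]
        abs_integral_prob_diff_le[OF Y_cpt nu cont_c[OF f] cont_c[OF g] 2])
qed

text \<open>The modulus \<open>e / (2 * r)\<close> deteriorates as the rate grows. This is harmless,
  because \<open>D0\<close> asks for continuity without prescribing a modulus and is closed all the
  same.\<close>

lemma sample_D0:
  assumes z: "(a, b, h) \<in> D"
  shows "(a, b, h) \<in> D0"
proof -
  have "\<exists>\<delta>>0. \<forall>g\<in>F. (\<forall>x. \<bar>f x - g x\<bar> \<le> \<delta>) \<longrightarrow>
     \<bar>a (cctrans c f) - a (cctrans c g)\<bar> \<le> e \<and> \<bar>b (ctrans c f) - b (ctrans c g)\<bar> \<le> e"
    if f: "f \<in> F" and e: "0 < e" for f e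
  proof (intro exI[of _ "e / (2 * r)"] conjI ballI impI)
    show "0 < e / (2 * r)" using e r by simp
    fix g assume g: "g \<in> F" and d: "\<forall>x. \<bar>f x - g x\<bar> \<le> e / (2 * r)"
    show "\<bar>a (cctrans c f) - a (cctrans c g)\<bar> \<le> e" "\<bar>b (ctrans c f) - b (ctrans c g)\<bar> \<le> e"
      using a_diff[OF f g d] r by simp_all
  qed
  then show ?thesis using z unfolding D0_def by simp
qed

context
  assumes z: "(a, b, h) \<in> D"
begin

lemma K_bounds:
  shows "f \<in> F \<Longrightarrow> \<bar>a (cctrans c f)\<bar> \<le> K" "f \<in> F \<Longrightarrow> \<bar>b (ctrans c f)\<bar> \<le> K" "\<forall>p. \<bar>h p\<bar> \<le> K" "0 \<le> K"
proof -
  note ge = dD_ge[OF z z0_D[unfolded z0_def]]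
  show "f \<in> F \<Longrightarrow> \<bar>a (cctrans c f)\<bar> \<le> K" "f \<in> F \<Longrightarrow> \<bar>b (ctrans c f)\<bar> \<le> K" "\<forall>p. \<bar>h p\<bar> \<le> K"
    using ge unfolding K_def z0_def by simp_all
  show "0 \<le> K" unfolding K_def by (rule dD_nonneg[OF z z0_D])
qed

lemma emp_dual_value:
  assumes "f \<in> F"
  shows "integral\<^sup>L \<mu>' (cctrans c f) + integral\<^sup>L \<nu>' (ctrans c f) = J f + (a (cctrans c f) + b (ctrans c f)) / r"
  using r unfolding J_def a_def b_def by (simp add: field_simps)

lemma emp_dual_c:
  obtains \<pi> f where "\<pi> \<in> couplings \<mu>' \<nu>'" "f \<in> F"
    "integral\<^sup>L \<pi> c = J f + (a (cctrans c f) + b (ctrans c f)) / r"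
proof -
  obtain \<pi> f where "\<pi> \<in> couplings \<mu>' \<nu>'" and f: "f \<in> Fclass C w"
    and "integral\<^sup>L \<pi> c = integral\<^sup>L \<mu>' (cctrans c f) + integral\<^sup>L \<nu>' (ctrans c f)"
    by (rule emp_meas_duality[OF X_cpt Y_cpt c_cont N M C c_w])
  moreover have "f \<in> F" using f Fclass_subset_F by blast
  ultimately show ?thesis using that emp_dual_value by simp
qed

lemma integral_c':
  assumes "\<pi> \<in> couplings \<mu>'' \<nu>''"
  shows "integral\<^sup>L \<pi> c' = integral\<^sup>L \<pi> c + integral\<^sup>L \<pi> h / r"
proof -
  note \<pi> = couplingsD(1,2)[OF assms]
  interpret prob_space \<pi> by fact
  have i: "integrable \<pi> c" "integrable \<pi> c'"
    using integrable_continuous_compact[OF XY_cpt finite_measure_axioms \<pi>(2)] c_cont c'_cont by auto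
  have "integral\<^sup>L \<pi> h = r * (integral\<^sup>L \<pi> c' - integral\<^sup>L \<pi> c)" unfolding h_def using i by simp
  then show ?thesis using r by simp
qed

lemma abs_integral_h: "\<pi> \<in> couplings \<mu>'' \<nu>'' \<Longrightarrow> \<bar>integral\<^sup>L \<pi> h\<bar> \<le> K"
  using abs_integral_prob_le[OF XY_cpt couplingsD(1,2) h_cont] K_bounds(3) by blast

lemma near_optI:
  assumes \<pi>: "\<pi> \<in> couplings \<mu>' \<nu>'"
    and bx: "\<forall>g\<in>Fclass (1/2) (\<lambda>t. t). \<bar>integral\<^sup>L \<mu>' g - integral\<^sup>L \<mu> g\<bar> \<le> e"
    and bY: "\<forall>g\<in>Fclass (1/2) (\<lambda>t. t). \<bar>integral\<^sup>L \<nu>' g - integral\<^sup>L \<nu> g\<bar> \<le> e"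
    and "integral\<^sup>L \<pi> c \<le> OTc + e"
  shows "\<pi> \<in> near_opt_plans \<mu> \<nu> c e"
  unfolding near_opt_plans_def
proof (intro CollectI conjI ballI)
  show "prob_space \<pi>" "sets \<pi> = sets borel" using couplingsD[OF \<pi>] by auto
  show "integral\<^sup>L \<pi> c \<le> OTc + e" by fact
  show "\<bar>integral\<^sup>L \<pi> (\<lambda>p. g (fst p)) - integral\<^sup>L \<mu> g\<bar> \<le> e" if "g \<in> Fclass (1/2) (\<lambda>t. t)" for g
    using integral_coupling(1)[OF \<pi> Fclass_continuous[OF tendsto_id_at_right that]] bx that by simp
  show "\<bar>integral\<^sup>L \<pi> (\<lambda>p. g (snd p)) - integral\<^sup>L \<nu> g\<bar> \<le> e" if "g \<in> Fclass (1/2) (\<lambda>t. t)" for g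
    using integral_coupling(2)[OF \<pi> Fclass_continuous[OF tendsto_id_at_right that]] bY that by simp
qed

lemma dual_c_le:
  assumes "f \<in> F"
  shows "J f + (a (cctrans c f) + b (ctrans c f)) / r \<le> OTc + 2 * K / r"
proof -
  have "(a (cctrans c f) + b (ctrans c f)) / r \<le> 2 * K / r"
    using K_bounds(1,2)[OF assms] r by (intro divide_right_mono) auto
  then show ?thesis using J_le_OT[OF assms] by linarith
qed

lemma sample_lower:
  assumes bx: "\<forall>g\<in>Fclass (1/2) (\<lambda>t. t). \<bar>integral\<^sup>L \<mu>' g - integral\<^sup>L \<mu> g\<bar> \<le> 1 / real (Suc j)"
    and bY: "\<forall>g\<in>Fclass (1/2) (\<lambda>t. t). \<bar>integral\<^sup>L \<nu>' g - integral\<^sup>L \<nu> g\<bar> \<le> 1 / real (Suc j)"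
    and K: "4 * K / r \<le> 1 / real (Suc j)"
  shows "Ssup a b + Inear j h \<le> r * (OT \<mu>' \<nu>' c' - OTc)"
proof -
  obtain C' where C': "\<forall>p. \<bar>c' p\<bar> \<le> C'" by (rule continuous_compact_bounded[OF XY_cpt c'_cont])
  \<comment> \<open>Only a bound of \<open>c'\<close> is at hand, so the modulus is a constant; the
    resulting potential serves to certify that the plan is optimal.\<close>
  have W': "\<forall>x x' y. \<bar>c' (x, y) - c' (x', y)\<bar> \<le> (\<lambda>_. 2 * C') (dist x x')"
  proof (intro allI)
    fix x x' y show "\<bar>c' (x, y) - c' (x', y)\<bar> \<le> (\<lambda>_. 2 * C') (dist x x')"
      using C'[rule_format, of "(x, y)"] C'[rule_format, of "(x', y)"] by simp
  qed
  obtain \<pi> f' where \<pi>: "\<pi> \<in> couplings \<mu>' \<nu>'" and f': "f' \<in> Fclass C' (\<lambda>_. 2 * C')"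
    and eq: "integral\<^sup>L \<pi> c' = integral\<^sup>L \<mu>' (cctrans c' f') + integral\<^sup>L \<nu>' (ctrans c' f')"
    by (rule emp_meas_duality[OF X_cpt Y_cpt c'_cont N M C' W'])
  have OT': "OT \<mu>' \<nu>' c' = integral\<^sup>L \<pi> c'"
    using dual_attained_imp_opt(2)[OF X_cpt Y_cpt c'_cont Fclass_bounded[OF f'] \<pi> eq] eq by simp
  obtain \<pi>0 f0 where \<pi>0: "\<pi>0 \<in> couplings \<mu>' \<nu>'" and f0: "f0 \<in> F"
    and eq0: "integral\<^sup>L \<pi>0 c = J f0 + (a (cctrans c f0) + b (ctrans c f0)) / r"
    by (rule emp_dual_c)
  have "integral\<^sup>L \<pi> c' \<le> integral\<^sup>L \<pi>0 c'" using OT_le[OF X_cpt Y_cpt c'_cont \<pi>0] OT' by simp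
  then have "integral\<^sup>L \<pi> c \<le> integral\<^sup>L \<pi>0 c + (integral\<^sup>L \<pi>0 h - integral\<^sup>L \<pi> h) / r"
    using integral_c'[OF \<pi>] integral_c'[OF \<pi>0] by (simp add: diff_divide_distrib)
  \<comment> \<open>The first \<open>2 * K / r\<close> is the effect of \<open>a\<close> and
    \<open>b\<close> on the dual value for \<open>c\<close>, the second that of \<open>h\<close> on
    the comparison of the two plans. Together they make the \<open>4 * K / r\<close> of the
    hypothesis.\<close>
  also have "\<dots> \<le> OTc + 2 * K / r + 2 * K / r"
  proof (rule add_mono)
    show "integral\<^sup>L \<pi>0 c \<le> OTc + 2 * K / r" using eq0 dual_c_le[OF f0] by simp
    show "(integral\<^sup>L \<pi>0 h - integral\<^sup>L \<pi> h) / r \<le> 2 * K / r"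
      using abs_integral_h[OF \<pi>0] abs_integral_h[OF \<pi>] r by (intro divide_right_mono) auto
  qed
  finally have "integral\<^sup>L \<pi> c \<le> OTc + 2 * K / r + 2 * K / r" .
  moreover have "2 * K / r + 2 * K / r = 4 * K / r" by (simp flip: add_divide_distrib)
  ultimately have "integral\<^sup>L \<pi> c \<le> OTc + 1 / real (Suc j)" using K by linarith
  then have near: "\<pi> \<in> near_opt_plans \<mu> \<nu> c (1 / real (Suc j))" by (rule near_optI[OF \<pi> bx bY])
  have Ile: "Inear j h \<le> integral\<^sup>L \<pi> h" by (rule Inear_le[OF h_cont near])
  have "Ssup a b \<le> r * (OT \<mu>' \<nu>' c' - OTc) - Inear j h"
    unfolding Ssup_def
  proof (rule cSUP_least[OF Sc_ne])
    fix f assume "f \<in> Sc F \<mu> \<nu> c"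
    then have f: "f \<in> F" "J f = OTc" by (simp_all add: Sc_iff)
    have "OTc + (a (cctrans c f) + b (ctrans c f)) / r \<le> integral\<^sup>L \<pi> c"
      using weak_duality[OF X_cpt Y_cpt c_cont F_bounded[OF f(1)] \<pi>] emp_dual_value[OF f(1)] f(2) by simp
    then have "(a (cctrans c f) + b (ctrans c f)) / r \<le> OT \<mu>' \<nu>' c' - OTc - integral\<^sup>L \<pi> h / r"
      using OT' integral_c'[OF \<pi>] by linarith
    then have "a (cctrans c f) + b (ctrans c f) \<le> r * (OT \<mu>' \<nu>' c' - OTc - integral\<^sup>L \<pi> h / r)"
      using r by (simp add: divide_le_eq mult.commute)
    also have "\<dots> = r * (OT \<mu>' \<nu>' c' - OTc) - integral\<^sup>L \<pi> h" using r by (simp add: right_diff_distrib)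
    finally show "a (cctrans c f) + b (ctrans c f) \<le> r * (OT \<mu>' \<nu>' c' - OTc) - Inear j h" using Ile by linarith
  qed
  then show ?thesis by linarith
qed

lemma sample_upper_unique:
  assumes bx: "\<forall>g\<in>Fclass (1/2) (\<lambda>t. t). \<bar>integral\<^sup>L \<mu>' g - integral\<^sup>L \<mu> g\<bar> \<le> 1 / real (Suc j)"
    and bY: "\<forall>g\<in>Fclass (1/2) (\<lambda>t. t). \<bar>integral\<^sup>L \<nu>' g - integral\<^sup>L \<nu> g\<bar> \<le> 1 / real (Suc j)"
    and K: "4 * K / r \<le> 1 / real (Suc j)" and j: "real j \<le> r"
  shows "r * (OT \<mu>' \<nu>' c' - OTc) \<le> Usup (real j) 0 0 a b - Inear j (\<lambda>p. - h p)"
proof -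
  obtain \<pi>0 f0 where \<pi>0: "\<pi>0 \<in> couplings \<mu>' \<nu>'" and f0: "f0 \<in> F"
    and eq0: "integral\<^sup>L \<pi>0 c = J f0 + (a (cctrans c f0) + b (ctrans c f0)) / r"
    by (rule emp_dual_c)
  have "0 \<le> 2 * K / r" using K_bounds(4) r by simp
  moreover have "2 * K / r + 2 * K / r = 4 * K / r" by (simp flip: add_divide_distrib)
  ultimately have "integral\<^sup>L \<pi>0 c \<le> OTc + 1 / real (Suc j)"
    using eq0 dual_c_le[OF f0] K by linarith
  then have near: "\<pi>0 \<in> near_opt_plans \<mu> \<nu> c (1 / real (Suc j))" by (rule near_optI[OF \<pi>0 bx bY])
  have mc: "continuous_on UNIV (\<lambda>p. - h p)" by (intro continuous_intros h_cont)
  \<comment> \<open>\<open>- Inear j (\<lambda>p. - h p)\<close> is the supremum of the integrals of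
    \<open>h\<close> over nearly optimal plans.\<close>
  have I: "integral\<^sup>L \<pi>0 h \<le> - Inear j (\<lambda>p. - h p)" using Inear_le[OF mc near] by simp
  have "OT \<mu>' \<nu>' c' \<le> J f0 + (a (cctrans c f0) + b (ctrans c f0)) / r + integral\<^sup>L \<pi>0 h / r"
    using OT_le[OF X_cpt Y_cpt c'_cont \<pi>0] integral_c'[OF \<pi>0] eq0 by simp
  then have "r * (OT \<mu>' \<nu>' c') \<le> r * (J f0 + (a (cctrans c f0) + b (ctrans c f0)) / r + integral\<^sup>L \<pi>0 h / r)"
    using r by (intro mult_left_mono) auto
  also have "\<dots> = r * J f0 + (a (cctrans c f0) + b (ctrans c f0)) + integral\<^sup>L \<pi>0 h"
    using r by (simp add: field_simps)
  finally have 1: "r * (OT \<mu>' \<nu>' c' - OTc) \<le> - (r * (OTc - J f0)) + (a (cctrans c f0) + b (ctrans c f0)) + integral\<^sup>L \<pi>0 h"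
    by (simp add: right_diff_distrib)
  \<comment> \<open>The gap is nonnegative, so the rate \<open>r\<close> may be lowered to
    \<open>j\<close>; this frees the bracket from the sample size.\<close>
  have "real j * (OTc - J f0) \<le> r * (OTc - J f0)" using j J_le_OT[OF f0] by (intro mult_right_mono) auto
  moreover have "0 \<le> real j * (OTc - J f0)" using J_le_OT[OF f0] by simp
  ultimately have "- (r * (OTc - J f0)) \<le> min 0 (0 - real j * (OTc - J f0))" by linarith
  then have "- (r * (OTc - J f0)) + (a (cctrans c f0) + b (ctrans c f0)) \<le> Usup (real j) 0 0 a b"
    by (intro Usup_ge[OF z f0] add_right_mono)
  then show ?thesis using 1 I by linarith
qed

lemma sample_upper_regular:
  assumes \<delta>: "0 < \<delta>" "2 * K < r * w \<delta>" and Kr: "K \<le> r" and j: "real j \<le> r"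
  obtains f where "f \<in> F" "r * (OT \<mu>' \<nu>' c' - OTc) \<le> Usup (real j) (Ipl h) (3 * K) a b + 4 * osc \<delta> h
    + r * (integral\<^sup>L \<mu>' (\<lambda>x. cctrans c' f x - cctrans c f x) - integral\<^sup>L \<mu> (\<lambda>x. cctrans c' f x - cctrans c f x))
    + r * (integral\<^sup>L \<nu>' (\<lambda>y. ctrans c' f y - ctrans c f y) - integral\<^sup>L \<nu> (\<lambda>y. ctrans c' f y - ctrans c f y))"
proof -
  define Om where "Om = osc \<delta> h / r"
  have ch: "c' p = c p + h p / r" for p using r by (simp add: h_def)
  have hr: "\<bar>h p / r\<bar> \<le> K / r" for p
    using K_bounds(3)[rule_format, of p] r by (simp add: abs_divide divide_right_mono)
  \<comment> \<open>\<open>K \<le> r\<close> keeps the perturbed cost within 1 of \<open>c\<close>,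
    whence the constant \<open>C + 1\<close> of the potentials.\<close>
  have c'b: "\<forall>p. \<bar>c' p\<bar> \<le> C + 1"
  proof
    fix p
    have "K / r \<le> 1" using Kr r by simp
    then show "\<bar>c' p\<bar> \<le> C + 1" using hr[of p] C[rule_format, of p] ch[of p] by linarith
  qed
  obtain ct where ct: "\<forall>p. \<bar>ct p\<bar> \<le> C + 1" "\<forall>x x' y. \<bar>ct (x, y) - ct (x', y)\<bar> \<le> 2 * w (dist x x')"
    "\<forall>p. ct p \<le> c' p" "\<forall>p. c' p \<le> ct p + osc \<delta> h / r"
    by (rule cost_regularization[OF w_mod c_w c'b r h_def K_bounds(3) \<delta>])
  have cd: "\<forall>p. \<bar>ct p - c' p\<bar> \<le> Om"
  proof
    fix p show "\<bar>ct p - c' p\<bar> \<le> Om"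
      using ct(3)[rule_format, of p] ct(4)[rule_format, of p] unfolding Om_def by linarith
  qed
  obtain n x' y' f where n: "0 < n" and ex: "emp_meas n x' = \<mu>'" and ey: "emp_meas n y' = \<nu>'"
    and \<pi>: "emp_meas n (\<lambda>i. (x' i, y' i)) \<in> couplings \<mu>' \<nu>'" and f: "f \<in> Fclass (C + 1) (\<lambda>t. 2 * w t)"
    and eq: "\<And>i. i < n \<Longrightarrow> cctrans ct f (x' i) + ctrans ct f (y' i) = ct (x' i, y' i)"
    by (rule emp_meas_dual_coupling[OF N M ct(1,2), of x y]) blast
  have fF: "f \<in> F" using f Fclass_subset_F by blast
  note fb = F_bounded[OF fF]
  note cc' = continuous_cctrans[OF X_cpt Y_cpt c'_cont fb] and c'' = continuous_ctrans[OF X_cpt Y_cpt c'_cont fb]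
  have fz: "\<forall>x. \<bar>f x - f x\<bar> \<le> 0" by simp
  \<comment> \<open>Returning from \<open>ct\<close> to \<open>c'\<close> costs
    \<open>2 * Om\<close> in the double transform, \<open>Om\<close> in the single one and
    \<open>Om\<close> in the cost itself.\<close>
  have pt: "c' (x' i, y' i) \<le> cctrans c' f (x' i) + ctrans c' f (y' i) + 4 * Om" if "i < n" for i
  proof -
    have "\<bar>cctrans ct f (x' i) - cctrans c' f (x' i)\<bar> \<le> 2 * Om + 0"
      by (rule cctrans_diff_le[OF ct(1) fb c'b fb cd fz])
    moreover have "\<bar>ctrans ct f (y' i) - ctrans c' f (y' i)\<bar> \<le> Om + 0"
      using cd by (intro ctrans_diff_le[OF ct(1) fb c'b fb _ fz]) auto
    moreover have "c' (x' i, y' i) \<le> ct (x' i, y' i) + Om" using ct(4) unfolding Om_def by blast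
    ultimately show ?thesis using eq[OF that] by linarith
  qed
  have "OT \<mu>' \<nu>' c' \<le> integral\<^sup>L (emp_meas n (\<lambda>i. (x' i, y' i))) c'" by (rule OT_le[OF X_cpt Y_cpt c'_cont \<pi>])
  also have "\<dots> = (\<Sum>i<n. c' (x' i, y' i)) / real n"
    using n borel_measurable_continuous_onI[OF c'_cont] by (rule integral_emp_meas)
  also have "\<dots> \<le> (\<Sum>i<n. cctrans c' f (x' i) + ctrans c' f (y' i) + 4 * Om) / real n"
    using pt by (intro divide_right_mono sum_mono) auto
  also have "\<dots> = (\<Sum>i<n. cctrans c' f (x' i)) / real n + (\<Sum>i<n. ctrans c' f (y' i)) / real n + 4 * Om"
    using n by (simp add: sum.distrib add_divide_distrib)
  also have "\<dots> = integral\<^sup>L \<mu>' (cctrans c' f) + integral\<^sup>L \<nu>' (ctrans c' f) + 4 * Om"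
    using integral_emp_meas[OF n borel_measurable_continuous_onI[OF cc'], of x']
      integral_emp_meas[OF n borel_measurable_continuous_onI[OF c''], of y'] ex ey by simp
  finally have up: "OT \<mu>' \<nu>' c' \<le> integral\<^sup>L \<mu>' (cctrans c' f) + integral\<^sup>L \<nu>' (ctrans c' f) + 4 * Om" .
  define E1 where "E1 = integral\<^sup>L \<mu>' (\<lambda>x. cctrans c' f x - cctrans c f x) - integral\<^sup>L \<mu> (\<lambda>x. cctrans c' f x - cctrans c f x)"
  define E2 where "E2 = integral\<^sup>L \<nu>' (\<lambda>y. ctrans c' f y - ctrans c f y) - integral\<^sup>L \<nu> (\<lambda>y. ctrans c' f y - ctrans c f y)"
  have split1: "integral\<^sup>L m (\<lambda>x. cctrans c' f x - cctrans c f x) = integral\<^sup>L m (cctrans c' f) - integral\<^sup>L m (cctrans c f)"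
    if "prob_space m" "sets m = sets borel" for m
  proof -
    interpret prob_space m by fact
    show ?thesis
      using integrable_continuous_compact[OF X_cpt finite_measure_axioms that(2) cc']
        integrable_continuous_compact[OF X_cpt finite_measure_axioms that(2) cont_cc[OF fF]] by simp
  qed
  have split2: "integral\<^sup>L m (\<lambda>y. ctrans c' f y - ctrans c f y) = integral\<^sup>L m (ctrans c' f) - integral\<^sup>L m (ctrans c f)"
    if "prob_space m" "sets m = sets borel" for m
  proof -
    interpret prob_space m by fact
    show ?thesis
      using integrable_continuous_compact[OF Y_cpt finite_measure_axioms that(2) c'']
        integrable_continuous_compact[OF Y_cpt finite_measure_axioms that(2) cont_c[OF fF]] by simp
  qed
  \<comment> \<open>The dual value of \<open>f\<close> for the perturbed cost under the true
    measures. After centring and scaling, weak duality against optimal plans bounds it by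
    \<open>Ipl h\<close>, and comparison with \<open>J f\<close> bounds it by \<open>3 * K\<close>
    minus the penalty; \<open>Usup\<close> takes the minimum of the two.\<close>
  define \<tau> where "\<tau> = integral\<^sup>L \<mu> (cctrans c' f) + integral\<^sup>L \<nu> (ctrans c' f)"
  have dec: "integral\<^sup>L \<mu>' (cctrans c' f) + integral\<^sup>L \<nu>' (ctrans c' f)
      = \<tau> + E1 + E2 + (a (cctrans c f) + b (ctrans c f)) / r"
    using emp_dual_value[OF fF] unfolding E1_def E2_def split1[OF mu] split1[OF mu'] split2[OF nu] split2[OF nu'] \<tau>_def J_def
    by simp
  have t1: "r * (\<tau> - OTc) \<le> Ipl h"
    unfolding Ipl_def
  proof (rule cINF_greatest[OF opt_ne])
    fix \<pi> assume "\<pi> \<in> opt_plans \<mu> \<nu> c"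
    then have \<pi>: "\<pi> \<in> couplings \<mu> \<nu>" "integral\<^sup>L \<pi> c = OTc" by (auto simp: opt_plans_def)
    have "\<tau> \<le> integral\<^sup>L \<pi> c'" unfolding \<tau>_def by (rule weak_duality[OF X_cpt Y_cpt c'_cont fb \<pi>(1)])
    then have "\<tau> - OTc \<le> integral\<^sup>L \<pi> h / r" using integral_c'[OF \<pi>(1)] \<pi>(2) by simp
    then show "r * (\<tau> - OTc) \<le> integral\<^sup>L \<pi> h" using r by (simp add: le_divide_eq mult.commute)
  qed
  have cd': "\<forall>p. \<bar>c' p - c p\<bar> \<le> K / r"
  proof
    fix p show "\<bar>c' p - c p\<bar> \<le> K / r" using hr[of p] ch[of p] by linarith
  qed
  \<comment> \<open>The factor 3 is made of 2 from the double transform and 1 from the single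
    one.\<close>
  have "\<bar>integral\<^sup>L \<mu> (cctrans c' f) - integral\<^sup>L \<mu> (cctrans c f)\<bar> \<le> 2 * (K / r) + 0"
    by (rule abs_integral_prob_diff_le[OF X_cpt mu cc' cont_cc[OF fF] cctrans_diff_le[OF c'b fb C fb cd' fz]])
  moreover have "\<bar>integral\<^sup>L \<nu> (ctrans c' f) - integral\<^sup>L \<nu> (ctrans c f)\<bar> \<le> K / r + 0"
    using cd' by (intro abs_integral_prob_diff_le[OF Y_cpt nu c'' cont_c[OF fF] ctrans_diff_le[OF c'b fb C fb _ fz]]) auto
  ultimately have "\<tau> \<le> J f + 3 * (K / r)" unfolding \<tau>_def J_def by linarith
  then have "r * \<tau> \<le> r * (J f + 3 * (K / r))" using r by (intro mult_left_mono) auto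
  then have t2: "r * (\<tau> - OTc) \<le> 3 * K - r * (OTc - J f)" using r by (simp add: right_diff_distrib distrib_left)
  have "real j * (OTc - J f) \<le> r * (OTc - J f)" using j J_le_OT[OF fF] by (intro mult_right_mono) auto
  then have "r * (\<tau> - OTc) \<le> min (Ipl h) (3 * K - real j * (OTc - J f))" using t1 t2 by linarith
  then have "r * (\<tau> - OTc) + (a (cctrans c f) + b (ctrans c f)) \<le> Usup (real j) (Ipl h) (3 * K) a b"
    by (intro Usup_ge[OF z fF] add_right_mono)
  moreover have "r * (OT \<mu>' \<nu>' c' - OTc) \<le> r * (\<tau> - OTc) + (a (cctrans c f) + b (ctrans c f)) + 4 * osc \<delta> h + r * E1 + r * E2"
  proof -
    have "r * (OT \<mu>' \<nu>' c') \<le> r * (\<tau> + E1 + E2 + (a (cctrans c f) + b (ctrans c f)) / r + 4 * (osc \<delta> h / r))"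
      using up dec r unfolding Om_def by (intro mult_left_mono) auto
    also have "\<dots> = r * \<tau> + r * E1 + r * E2 + (a (cctrans c f) + b (ctrans c f)) + 4 * osc \<delta> h"
      using r by (simp add: field_simps)
    finally show ?thesis by (simp add: right_diff_distrib)
  qed
  ultimately have "r * (OT \<mu>' \<nu>' c' - OTc) \<le> Usup (real j) (Ipl h) (3 * K) a b + 4 * osc \<delta> h + r * E1 + r * E2" by linarith
  then show ?thesis unfolding E1_def E2_def by (rule that[OF fF])
qed

end

end

section \<open>Rates, null events and continuity of the brackets\<close>

lemma osc_diff_le:
  fixes h h' :: "'x::metric_space \<times> 'y \<Rightarrow> real"
  assumes h: "\<forall>p. \<bar>h p\<bar> \<le> K" and h': "\<forall>p. \<bar>h' p\<bar> \<le> K'" and \<delta>: "0 \<le> \<delta>" and d: "\<And>p. \<bar>h p - h' p\<bar> \<le> e"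
  shows "\<bar>osc \<delta> h - osc \<delta> h'\<bar> \<le> 2 * e"
proof -
  have "osc \<delta> h \<le> osc \<delta> h' + 2 * e"
  proof (rule osc_le[OF \<delta>])
    fix x x' :: 'x and y :: 'y assume "dist x x' \<le> \<delta>"
    from osc_ge[OF h' this, of y] d[of "(x, y)"] d[of "(x', y)"]
    show "\<bar>h (x, y) - h (x', y)\<bar> \<le> osc \<delta> h' + 2 * e" by linarith
  qed
  moreover have "osc \<delta> h' \<le> osc \<delta> h + 2 * e"
  proof (rule osc_le[OF \<delta>])
    fix x x' :: 'x and y :: 'y assume "dist x x' \<le> \<delta>"
    from osc_ge[OF h this, of y] d[of "(x, y)"] d[of "(x', y)"]
    show "\<bar>h' (x, y) - h' (x', y)\<bar> \<le> osc \<delta> h + 2 * e" by linarith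
  qed
  ultimately show ?thesis by linarith
qed

text \<open>The errors in the second alternative of the hypotheses are scaled by the separate square
  roots; these dominate the common rate.\<close>

lemma rate_le_sqrt: "rate n m \<le> sqrt (real n)" "rate n m \<le> sqrt (real m)"
proof -
  have "real n * real m \<le> real n * (real n + real m)" "real n * real m \<le> real m * (real n + real m)"
    by (auto simp: algebra_simps)
  then have "real n * real m / (real n + real m) \<le> real n" "real n * real m / (real n + real m) \<le> real m"
    by (cases "real n + real m = 0"; simp add: divide_le_eq)+
  then show "rate n m \<le> sqrt (real n)" "rate n m \<le> sqrt (real m)" unfolding rate_def by simp_all
qed

text \<open>The squared rate is \<open>N k\<close> times a ratio that tends to
  \<open>lam > 0\<close>.\<close>

lemma admissible_rate_at_top:
  assumes "admissible N M lam" "0 < lam"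
  shows "filterlim (\<lambda>k. rate (N k) (M k)) at_top sequentially"
proof -
  have N: "filterlim (\<lambda>k. real (N k)) at_top sequentially"
    using assms(1) by (auto simp: admissible_def intro: filterlim_compose[OF filterlim_real_sequentially])
  have "(\<lambda>k. real (M k) / (real (N k) + real (M k))) \<longlonglongrightarrow> lam" using assms(1) by (simp add: admissible_def)
  from filterlim_tendsto_pos_mult_at_top[OF this assms(2) N]
  have "filterlim (\<lambda>k. real (N k) * real (M k) / (real (N k) + real (M k))) at_top sequentially"
    by (simp add: mult.commute)
  then show ?thesis unfolding rate_def by (rule filterlim_compose[OF sqrt_at_top])
qed

context prob_space
begin

lemma outer_prob_tendsto_0_mono:
  assumes "\<forall>\<^sub>F k in sequentially. A k \<inter> space M \<subseteq> A' k" "(\<lambda>k. outer_prob M (A' k)) \<longlonglongrightarrow> 0"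
  shows "(\<lambda>k. outer_prob M (A k)) \<longlonglongrightarrow> 0"
proof (rule Lim_null_comparison[OF _ assms(2)])
  show "\<forall>\<^sub>F k in sequentially. norm (outer_prob M (A k)) \<le> outer_prob M (A' k)"
    using assms(1) by eventually_elim (simp add: outer_prob_mono outer_prob_nonneg)
qed

lemma outer_prob_tendsto_0_Un:
  assumes "(\<lambda>k. outer_prob M (A k)) \<longlonglongrightarrow> 0" "(\<lambda>k. outer_prob M (A' k)) \<longlonglongrightarrow> 0"
  shows "(\<lambda>k. outer_prob M (A k \<union> A' k)) \<longlonglongrightarrow> 0"
proof (rule Lim_null_comparison)
  show "(\<lambda>k. outer_prob M (A k) + outer_prob M (A' k)) \<longlonglongrightarrow> 0"
    using tendsto_add[OF assms] by simp
  show "\<forall>\<^sub>F k in sequentially. norm (outer_prob M (A k \<union> A' k)) \<le> outer_prob M (A k) + outer_prob M (A' k)"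
    by (simp add: outer_prob_Un outer_prob_nonneg)
qed

lemma outer_prob_tendsto_0_sets:
  assumes "\<And>k. A k \<in> sets M" "(\<lambda>k. measure M (A k)) \<longlonglongrightarrow> 0"
  shows "(\<lambda>k. outer_prob M (A k)) \<longlonglongrightarrow> 0"
proof (rule Lim_null_comparison[OF _ assms(2)])
  show "\<forall>\<^sub>F k in sequentially. norm (outer_prob M (A k)) \<le> measure M (A k)"
    using assms(1) by (intro always_eventually allI) (simp add: outer_prob_nonneg outer_prob_le)
qed

end

context compact_ot_modulus
begin

text \<open>Functionals of a triple \<open>z = (a, b, h)\<close>. \<open>phi\<close> is the asserted
  limit and the others are its brackets, in which \<open>j\<close> sets the tolerance of nearly
  optimal plans, the penalty rate and the scale of the oscillation.\<close>

definition phi where "phi z = Ipl (snd (snd z)) + Ssup (fst z) (fst (snd z))"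
definition lo where "lo j z = Ssup (fst z) (fst (snd z)) + Inear j (snd (snd z))"
definition up_unique where
  "up_unique j z = Usup (real j) 0 0 (fst z) (fst (snd z)) - Inear j (\<lambda>p. - snd (snd z) p)"
definition up_regular where
  "up_regular j z = Usup (real j) (Ipl (snd (snd z))) (3 * dD z z0) (fst z) (fst (snd z))
     + 4 * osc (1 / real (Suc j)) (snd (snd z))"

lemma dD_z0_Lipschitz:
  assumes "z \<in> D" "z' \<in> D"
  shows "\<bar>dD z' z0 - dD z z0\<bar> \<le> dD z z'"
  using dD_triangle[OF assms(1,2) z0_D] dD_triangle[OF assms(2,1) z0_D] dD_sym[of z z'] by linarith

lemma pm_cont_phi: "pm_cont dD D phi"
proof (rule pm_cont_Lipschitz[of 3])
  fix z z' assume z: "z \<in> D" and z': "z' \<in> D"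
  obtain a b h where zz: "z = (a, b, h)" by (rule prod_cases3)
  obtain a' b' h' where zz': "z' = (a', b', h')" by (rule prod_cases3)
  note D = z[unfolded zz] z'[unfolded zz']
  show "\<bar>phi z' - phi z\<bar> \<le> 3 * dD z z'"
    using Ssup_Lipschitz[OF D] Ipl_Lipschitz[OF D_cont[OF D(1)] D_cont[OF D(2)] dD_ge(3)[OF D]]
    unfolding zz zz' phi_def fst_conv snd_conv by linarith
qed simp

lemma pm_cont_lo: "pm_cont dD D (lo j)"
proof (rule pm_cont_Lipschitz[of 3])
  fix z z' assume z: "z \<in> D" and z': "z' \<in> D"
  obtain a b h where zz: "z = (a, b, h)" by (rule prod_cases3)
  obtain a' b' h' where zz': "z' = (a', b', h')" by (rule prod_cases3)
  note D = z[unfolded zz] z'[unfolded zz']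
  show "\<bar>lo j z' - lo j z\<bar> \<le> 3 * dD z z'"
    using Ssup_Lipschitz[OF D] Inear_Lipschitz[OF D_cont[OF D(1)] D_cont[OF D(2)] dD_ge(3)[OF D], of j]
    unfolding zz zz' lo_def fst_conv snd_conv by linarith
qed simp

lemma pm_cont_up_unique: "pm_cont dD D (up_unique j)"
proof (rule pm_cont_Lipschitz[of 3])
  fix z z' assume z: "z \<in> D" and z': "z' \<in> D"
  obtain a b h where zz: "z = (a, b, h)" by (rule prod_cases3)
  obtain a' b' h' where zz': "z' = (a', b', h')" by (rule prod_cases3)
  note D = z[unfolded zz] z'[unfolded zz']
  have "\<bar>Usup (real j) 0 0 a b - Usup (real j) 0 0 a' b'\<bar> \<le> 0 + 0 + 2 * dD (a, b, h) (a', b', h')"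
    by (rule Usup_Lipschitz[OF D]) auto
  moreover have "\<bar>Inear j (\<lambda>p. - h p) - Inear j (\<lambda>p. - h' p)\<bar> \<le> dD (a, b, h) (a', b', h')"
  proof (rule Inear_Lipschitz)
    show "\<bar>- h p - - h' p\<bar> \<le> dD (a, b, h) (a', b', h')" for p using dD_ge(3)[OF D, of p] by linarith
  qed (use D_cont[OF D(1)] D_cont[OF D(2)] in \<open>auto intro!: continuous_intros\<close>)
  ultimately show "\<bar>up_unique j z' - up_unique j z\<bar> \<le> 3 * dD z z'"
    unfolding zz zz' up_unique_def fst_conv snd_conv by linarith
qed simp

lemma pm_cont_up_regular: "pm_cont dD D (up_regular j)"
\<comment> \<open>\<open>Usup\<close> contributes 1 through \<open>Ipl\<close>, 3 through the norm
  and 2 through \<open>a\<close> and \<open>b\<close>; four times the oscillation contributes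
  8.\<close>
proof (rule pm_cont_Lipschitz[of 14])
  fix z z' assume z: "z \<in> D" and z': "z' \<in> D"
  obtain a b h where zz: "z = (a, b, h)" by (rule prod_cases3)
  obtain a' b' h' where zz': "z' = (a', b', h')" by (rule prod_cases3)
  note D = z[unfolded zz] z'[unfolded zz']
  define d where "d = dD (a, b, h) (a', b', h')"
  have "\<bar>Usup (real j) (Ipl h) (3 * dD (a, b, h) z0) a b - Usup (real j) (Ipl h') (3 * dD (a', b', h') z0) a' b'\<bar>
      \<le> d + 3 * d + 2 * dD (a, b, h) (a', b', h')"
  proof (rule Usup_Lipschitz[OF D])
    show "\<bar>Ipl h - Ipl h'\<bar> \<le> d"
      unfolding d_def by (rule Ipl_Lipschitz[OF D_cont[OF D(1)] D_cont[OF D(2)] dD_ge(3)[OF D]])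
    show "\<bar>3 * dD (a, b, h) z0 - 3 * dD (a', b', h') z0\<bar> \<le> 3 * d"
      using dD_z0_Lipschitz[OF D] unfolding d_def by linarith
  qed
  moreover obtain K where K: "\<forall>p. \<bar>h p\<bar> \<le> K" by (rule D_bounds[OF D(1)])
  moreover obtain K' where K': "\<forall>p. \<bar>h' p\<bar> \<le> K'" by (rule D_bounds[OF D(2)])
  have "\<bar>osc (1 / real (Suc j)) h - osc (1 / real (Suc j)) h'\<bar> \<le> 2 * d"
    unfolding d_def by (rule osc_diff_le[OF K K' _ dD_ge(3)[OF D]]) simp
  ultimately show "\<bar>up_regular j z' - up_regular j z\<bar> \<le> 14 * dD z z'"
    unfolding zz zz' up_regular_def fst_conv snd_conv d_def by linarith
qed simp

lemma z0_D0: "z0 \<in> D0"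
proof -
  have "\<exists>\<delta>>0. \<forall>g\<in>F. (\<forall>x. \<bar>f x - g x\<bar> \<le> \<delta>) \<longrightarrow> \<bar>0 - 0 :: real\<bar> \<le> e \<and> \<bar>0 - 0 :: real\<bar> \<le> e"
    if "0 < e" for f :: "'x \<Rightarrow> real" and e :: real
    using that by (intro exI[of _ 1]) simp
  then show ?thesis using z0_D unfolding z0_def D0_def by simp
qed

lemma lo_tendsto:
  assumes z: "z \<in> D0"
  shows "(\<lambda>j. lo j z) \<longlonglongrightarrow> phi z"
proof -
  obtain a b h where zz: "z = (a, b, h)" by (rule prod_cases3)
  have h: "continuous_on UNIV h" using z unfolding zz by (simp add: D0_def D3_def)
  have "(\<lambda>j. Ssup a b + Inear j h) \<longlonglongrightarrow> Ssup a b + Ipl h"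
    by (intro tendsto_intros Inear_tendsto h)
  then show ?thesis unfolding lo_def phi_def zz by (simp add: add.commute[of "Ipl h"])
qed

lemma up_unique_tendsto:
  assumes z: "z \<in> D0" and u: "opt_plans \<mu> \<nu> c = {\<pi>}"
  shows "(\<lambda>j. up_unique j z) \<longlonglongrightarrow> phi z"
proof -
  obtain a b h where zz: "z = (a, b, h)" by (rule prod_cases3)
  have h: "continuous_on UNIV h" using z unfolding zz by (simp add: D0_def D3_def)
  have "(\<lambda>j. Inear j (\<lambda>p. - h p)) \<longlonglongrightarrow> Ipl (\<lambda>p. - h p)"
    using h by (intro Inear_tendsto continuous_intros)
  \<comment> \<open>Uniqueness enters here: with a single optimal plan the infimum for
    \<open>- h\<close> is minus the infimum for \<open>h\<close>.\<close>
  moreover have "Ipl (\<lambda>p. - h p) = - Ipl h" unfolding Ipl_def u by simp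
  moreover have "(\<lambda>j. Usup (real j) 0 0 a b) \<longlonglongrightarrow> 0 + Ssup a b"
    using z unfolding zz by (rule Usup_tendsto) simp
  ultimately have "(\<lambda>j. Usup (real j) 0 0 a b - Inear j (\<lambda>p. - h p)) \<longlonglongrightarrow> 0 + Ssup a b - - Ipl h"
    by (intro tendsto_diff) auto
  then show ?thesis unfolding up_unique_def phi_def zz by (simp add: add.commute)
qed

lemma up_regular_tendsto:
  assumes z: "z \<in> D0"
  shows "(\<lambda>j. up_regular j z) \<longlonglongrightarrow> phi z"
proof -
  obtain a b h where zz: "z = (a, b, h)" by (rule prod_cases3)
  have zD: "(a, b, h) \<in> D" using z unfolding zz by (simp add: D0_def)
  note h = D_cont[OF zD]
  have K: "\<forall>p. \<bar>h p\<bar> \<le> dD z z0"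
    using dD_ge(3)[OF zD z0_D[unfolded z0_def]] unfolding zz z0_def by simp
  \<comment> \<open>This supplies the condition \<open>s \<le> t\<close> of
    \<open>Usup_tendsto\<close>, with \<open>s = Ipl h\<close> and
    \<open>t = 3 * dD z z0\<close>.\<close>
  have "Ipl h \<le> dD z z0" by (rule Ipl_le_norm[OF h K])
  moreover have "0 \<le> dD z z0" using zD z0_D unfolding zz by (rule dD_nonneg)
  ultimately have le: "Ipl h \<le> 3 * dD z z0" by linarith
  have "(\<lambda>j. Usup (real j) (Ipl h) (3 * dD z z0) a b + 4 * osc (1 / real (Suc j)) h) \<longlonglongrightarrow> Ipl h + Ssup a b + 4 * 0"
    using z unfolding zz
    by (intro tendsto_intros Usup_tendsto[OF _ le[unfolded zz]] osc_tendsto_0[OF X_cpt Y_cpt h])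
  then show ?thesis unfolding up_regular_def phi_def zz by simp
qed

end

context ot_sample
begin

text \<open>Passing from \<open>r\<close> to a larger factor \<open>s\<close> is monotone for
  nonnegative errors only; a negative error is dominated by the absolute value on the right. The
  errors are bounded over \<open>F\<close>, which makes the supremum a true upper bound.\<close>

lemma error_le_SUP:
  assumes f: "f \<in> F" and s: "r \<le> s"
  shows "r * (integral\<^sup>L \<mu>' (\<lambda>x. cctrans c' f x - cctrans c f x) - integral\<^sup>L \<mu> (\<lambda>x. cctrans c' f x - cctrans c f x))
      \<le> \<bar>SUP f\<in>F. s * (integral\<^sup>L \<mu>' (\<lambda>x. cctrans c' f x - cctrans c f x) - integral\<^sup>L \<mu> (\<lambda>x. cctrans c' f x - cctrans c f x))\<bar>"
    "r * (integral\<^sup>L \<nu>' (\<lambda>y. ctrans c' f y - ctrans c f y) - integral\<^sup>L \<nu> (\<lambda>y. ctrans c' f y - ctrans c f y))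
      \<le> \<bar>SUP f\<in>F. s * (integral\<^sup>L \<nu>' (\<lambda>y. ctrans c' f y - ctrans c f y) - integral\<^sup>L \<nu> (\<lambda>y. ctrans c' f y - ctrans c f y))\<bar>"
proof -
  obtain C' where C': "\<forall>p. \<bar>c' p\<bar> \<le> C'" by (rule continuous_compact_bounded[OF XY_cpt c'_cont])
  define R where "R = 2 * (2 * C + 1)"
  have s0: "0 < s" using r s by linarith
  have gen: "r * e f \<le> \<bar>SUP f\<in>F. s * e f\<bar>"
    if "\<And>f. f \<in> F \<Longrightarrow> \<bar>e f\<bar> \<le> Q" for e :: "('x \<Rightarrow> real) \<Rightarrow> real" and Q
  proof -
    have "bdd_above ((\<lambda>f. s * e f) ` F)"
    proof (rule bdd_aboveI2[where M="s * Q"])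
      fix f assume "f \<in> F"
      from that[OF this] s0 show "s * e f \<le> s * Q" by (intro mult_left_mono) auto
    qed
    from cSUP_upper[OF f this] have "s * e f \<le> \<bar>SUP f\<in>F. s * e f\<bar>" by linarith
    moreover have "r * e f \<le> s * e f \<or> r * e f \<le> 0"
    proof (cases "0 \<le> e f")
      case True then show ?thesis using s by (simp add: mult_right_mono)
    next
      case False then show ?thesis using r by (simp add: mult_pos_neg less_imp_le)
    qed
    ultimately show ?thesis using abs_ge_zero[of "SUP f\<in>F. s * e f"] by linarith
  qed
  have b1: "\<bar>integral\<^sup>L m (\<lambda>x. cctrans c' f x - cctrans c f x)\<bar> \<le> 2 * C' + 2 * C + 2 * R"
    if "prob_space m" "sets m = sets borel" "f \<in> F" for f m
  proof (rule abs_integral_prob_le[OF X_cpt that(1,2)])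
    note fb = F_bounded[OF that(3)]
    show "continuous_on UNIV (\<lambda>x. cctrans c' f x - cctrans c f x)"
      by (intro continuous_on_diff continuous_cctrans[OF X_cpt Y_cpt c'_cont fb] cont_cc[OF that(3)])
    fix x show "\<bar>cctrans c' f x - cctrans c f x\<bar> \<le> 2 * C' + 2 * C + 2 * R"
      using abs_cctrans_le[OF C' fb, of x] abs_cctrans_le[OF C fb, of x] unfolding R_def by linarith
  qed
  have b2: "\<bar>integral\<^sup>L m (\<lambda>y. ctrans c' f y - ctrans c f y)\<bar> \<le> 2 * C' + 2 * C + 2 * R"
    if "prob_space m" "sets m = sets borel" "f \<in> F" for f m
  proof (rule abs_integral_prob_le[OF Y_cpt that(1,2)])
    note fb = F_bounded[OF that(3)]
    show "continuous_on UNIV (\<lambda>x. ctrans c' f x - ctrans c f x)"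
      by (intro continuous_on_diff continuous_ctrans[OF X_cpt Y_cpt c'_cont fb] cont_c[OF that(3)])
    have "0 \<le> C'" using C'[rule_format, of undefined] by linarith
    fix x show "\<bar>ctrans c' f x - ctrans c f x\<bar> \<le> 2 * C' + 2 * C + 2 * R"
      using abs_ctrans_le[OF C' fb, of x] abs_ctrans_le[OF C fb, of x] \<open>0 \<le> C'\<close> C_nonneg
      unfolding R_def by linarith
  qed
  have t: "\<bar>u - v\<bar> \<le> 2 * Q" if "\<bar>u\<bar> \<le> Q" "\<bar>v\<bar> \<le> Q" for u v Q :: real using that by linarith
  show "r * (integral\<^sup>L \<mu>' (\<lambda>x. cctrans c' f x - cctrans c f x) - integral\<^sup>L \<mu> (\<lambda>x. cctrans c' f x - cctrans c f x))
      \<le> \<bar>SUP f\<in>F. s * (integral\<^sup>L \<mu>' (\<lambda>x. cctrans c' f x - cctrans c f x) - integral\<^sup>L \<mu> (\<lambda>x. cctrans c' f x - cctrans c f x))\<bar>"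
    by (rule gen[OF t[OF b1[OF mu'] b1[OF mu]]])
  show "r * (integral\<^sup>L \<nu>' (\<lambda>y. ctrans c' f y - ctrans c f y) - integral\<^sup>L \<nu> (\<lambda>y. ctrans c' f y - ctrans c f y))
      \<le> \<bar>SUP f\<in>F. s * (integral\<^sup>L \<nu>' (\<lambda>y. ctrans c' f y - ctrans c f y) - integral\<^sup>L \<nu> (\<lambda>y. ctrans c' f y - ctrans c f y))\<bar>"
    by (rule gen[OF t[OF b2[OF nu'] b2[OF nu]]])
qed

end

section \<open>The distributional limit\<close>

theorem mainTheorem4:
  fixes \<mu> :: "'x::metric_space measure" and \<nu> :: "'y::metric_space measure"
    and c :: "'x \<times> 'y \<Rightarrow> real" and w :: "real \<Rightarrow> real"
    and P :: "'o measure" and X :: "nat \<Rightarrow> 'o \<Rightarrow> 'x" and Y :: "nat \<Rightarrow> 'o \<Rightarrow> 'y"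
    and cnm :: "nat \<Rightarrow> nat \<Rightarrow> 'o \<Rightarrow> 'x \<times> 'y \<Rightarrow> real"
    and lam :: real
    and Q :: "'q measure"
    and Gmu :: "'q \<Rightarrow> ('x \<Rightarrow> real) \<Rightarrow> real" and Gnu :: "'q \<Rightarrow> ('y \<Rightarrow> real) \<Rightarrow> real"
    and Gc :: "'q \<Rightarrow> 'x \<times> 'y \<Rightarrow> real"
    and F :: "('x \<Rightarrow> real) set"
  defines "F \<equiv> Fclass (2 * (SUP p. \<bar>c p\<bar>) + 1) (\<lambda>t. 2 * w t)"
  assumes X_cpt: "compact (UNIV :: 'x set)" and Y_cpt: "compact (UNIV :: 'y set)"
    and c_cont: "continuous_on UNIV c"
    and w_mod: "concave_modulus w" and w_pos: "\<forall>\<delta>>0. w \<delta> > 0"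
    and c_w: "\<forall>x x' y. \<bar>c (x, y) - c (x', y)\<bar> \<le> w (dist x x')"
    and mu: "prob_space \<mu>" "sets \<mu> = sets borel"
    and nu: "prob_space \<nu>" "sets \<nu> = sets borel"
    and P: "prob_space P"
    and X_rv: "\<forall>i. X i \<in> borel_measurable P \<and> distr P borel (X i) = \<mu>"
    and Y_rv: "\<forall>j. Y j \<in> borel_measurable P \<and> distr P borel (Y j) = \<nu>"
    and X_iid: "prob_space.indep_vars P (\<lambda>_. borel) X UNIV"
    and Y_iid: "prob_space.indep_vars P (\<lambda>_. borel) Y UNIV"
    and XY_indep: "prob_space.indep_set P
         {(\<lambda>\<omega> i. X i \<omega>) -` A \<inter> space P | A. A \<in> sets (Pi\<^sub>M UNIV (\<lambda>_. borel))}
         {(\<lambda>\<omega> j. Y j \<omega>) -` B \<inter> space P | B. B \<in> sets (Pi\<^sub>M UNIV (\<lambda>_. borel))}"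
    and cnm_cont: "\<forall>n m. \<forall>\<omega>\<in>space P. continuous_on UNIV (cnm n m \<omega>)"
    and cnm_meas: "\<forall>n m p. (\<lambda>\<omega>. cnm n m \<omega> p) \<in> borel_measurable P"
    and lam: "0 < lam" "lam < 1"
    and Q: "prob_space Q"
    and A3: "\<forall>N M. admissible N M lam \<longrightarrow>
       HJ_conv P
         (\<lambda>k \<omega>. ((\<lambda>g. rate (N k) (M k) *
                      (integral\<^sup>L (emp_meas (N k) (\<lambda>i. X i \<omega>)) g - integral\<^sup>L \<mu> g)),
                  (\<lambda>h. rate (N k) (M k) *
                      (integral\<^sup>L (emp_meas (M k) (\<lambda>j. Y j \<omega>)) h - integral\<^sup>L \<nu> h)),
                  (\<lambda>p. rate (N k) (M k) * (cnm (N k) (M k) \<omega> p - c p))))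
         (dist3 (cctrans c ` F) (ctrans c ` F)) (D3 (cctrans c ` F) (ctrans c ` F))
         Q (\<lambda>q. ((\<lambda>g. sqrt lam * Gmu q g), (\<lambda>h. sqrt (1 - lam) * Gnu q h), Gc q))"
    and G_tight: "tight_into Q (dist3 (cctrans c ` F) (ctrans c ` F)) (D3 (cctrans c ` F) (ctrans c ` F))
         (\<lambda>q. (Gmu q, Gnu q, Gc q))"
    and G_cov: "bb_cov Q Gmu \<mu> (cctrans c ` F)" "bb_cov Q Gnu \<nu> (ctrans c ` F)"
    and B: "(\<exists>\<pi>. opt_plans \<mu> \<nu> c = {\<pi>}) \<or>
       (\<forall>N M. admissible N M lam \<longrightarrow>
          (\<forall>\<epsilon>>0. (\<lambda>k. outer_prob P {\<omega> \<in> space P. \<bar>SUP f\<in>F. sqrt (real (N k)) *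
              (integral\<^sup>L (emp_meas (N k) (\<lambda>i. X i \<omega>)) (\<lambda>x. cctrans (cnm (N k) (M k) \<omega>) f x - cctrans c f x)
               - integral\<^sup>L \<mu> (\<lambda>x. cctrans (cnm (N k) (M k) \<omega>) f x - cctrans c f x))\<bar> > \<epsilon>}) \<longlonglongrightarrow> 0) \<and>
          (\<forall>\<epsilon>>0. (\<lambda>k. outer_prob P {\<omega> \<in> space P. \<bar>SUP f\<in>F. sqrt (real (M k)) *
              (integral\<^sup>L (emp_meas (M k) (\<lambda>j. Y j \<omega>)) (\<lambda>y. ctrans (cnm (N k) (M k) \<omega>) f y - ctrans c f y)
               - integral\<^sup>L \<nu> (\<lambda>y. ctrans (cnm (N k) (M k) \<omega>) f y - ctrans c f y))\<bar> > \<epsilon>}) \<longlonglongrightarrow> 0))"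
  shows "\<forall>N M. admissible N M lam \<longrightarrow>
    HJ_conv P
      (\<lambda>k \<omega>. rate (N k) (M k) *
          (OT (emp_meas (N k) (\<lambda>i. X i \<omega>)) (emp_meas (M k) (\<lambda>j. Y j \<omega>)) (cnm (N k) (M k) \<omega>)
           - OT \<mu> \<nu> c))
      dist UNIV Q
      (\<lambda>q. (INF \<pi>\<in>opt_plans \<mu> \<nu> c. integral\<^sup>L \<pi> (Gc q)) +
           (SUP f\<in>Sc F \<mu> \<nu> c. sqrt lam * Gmu q (cctrans c f) + sqrt (1 - lam) * Gnu q (ctrans c f)))"
proof (intro allI impI)
  fix N M :: "nat \<Rightarrow> nat"
  assume adm: "admissible N M lam"
  interpret P: prob_space P by (rule P)
  note XY_cpt = compact_UNIV_prod[OF X_cpt Y_cpt]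
  define C where "C = (SUP p. \<bar>c p\<bar>)"
  have C: "\<forall>p. \<bar>c p\<bar> \<le> C"
  proof
    fix p
    obtain K where "\<forall>p. \<bar>c p\<bar> \<le> K" by (rule continuous_compact_bounded[OF XY_cpt c_cont])
    then show "\<bar>c p\<bar> \<le> C" unfolding C_def by (intro cSUP_upper bdd_aboveI2[where M=K]) auto
  qed
  have C0: "0 \<le> C" using C[rule_format, of undefined] by linarith
  have w0: "(w \<longlongrightarrow> 0) (at_right 0)" using w_mod by (simp add: concave_modulus_def)
  then have W0: "((\<lambda>t. 2 * w t) \<longlongrightarrow> 0) (at_right 0)" by (rule tendsto_mult_right_zero)
  have wn: "0 \<le> w t" if "0 \<le> t" for t using w_mod that by (simp add: concave_modulus_def)

  \<comment> \<open>The exceptional events are indexed by the sample size itself, so that they can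
    be used along \<open>N k\<close> and also to find one good sample for the duality below.\<close>
  have "\<forall>j. \<exists>BX. (\<forall>n. BX n \<in> sets P) \<and> (\<lambda>n. measure P (BX n)) \<longlonglongrightarrow> 0 \<and>
    (\<forall>n>0. \<forall>\<omega>\<in>space P - BX n. \<forall>g\<in>Fclass (1/2) (\<lambda>t. t).
      \<bar>integral\<^sup>L (emp_meas n (\<lambda>i. X i \<omega>)) g - integral\<^sup>L \<mu> g\<bar> \<le> 1 / real (Suc j))"
  proof
    fix j
    have j: "0 < 1 / real (Suc j)" by simp
    show "\<exists>BX. (\<forall>n. BX n \<in> sets P) \<and> (\<lambda>n. measure P (BX n)) \<longlonglongrightarrow> 0 \<and>
      (\<forall>n>0. \<forall>\<omega>\<in>space P - BX n. \<forall>g\<in>Fclass (1/2) (\<lambda>t. t).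
        \<bar>integral\<^sup>L (emp_meas n (\<lambda>i. X i \<omega>)) g - integral\<^sup>L \<mu> g\<bar> \<le> 1 / real (Suc j))"
      by (rule emp_meas_uniform_LLN[OF P X_cpt X_rv X_iid j], rule exI, intro conjI allI impI ballI)
  qed
  from choice[OF this] obtain BX where allBX: "\<forall>j. (\<forall>n. BX j n \<in> sets P) \<and> (\<lambda>n. measure P (BX j n)) \<longlonglongrightarrow> 0 \<and>
    (\<forall>n>0. \<forall>\<omega>\<in>space P - BX j n. \<forall>g\<in>Fclass (1/2) (\<lambda>t. t).
      \<bar>integral\<^sup>L (emp_meas n (\<lambda>i. X i \<omega>)) g - integral\<^sup>L \<mu> g\<bar> \<le> 1 / real (Suc j))"
    by (rule exE)
  have BX: "\<And>j n. BX j n \<in> sets P" "\<And>j. (\<lambda>n. measure P (BX j n)) \<longlonglongrightarrow> 0"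
    "\<And>j. \<forall>n>0. \<forall>\<omega>\<in>space P - BX j n. \<forall>g\<in>Fclass (1/2) (\<lambda>t. t).
      \<bar>integral\<^sup>L (emp_meas n (\<lambda>i. X i \<omega>)) g - integral\<^sup>L \<mu> g\<bar> \<le> 1 / real (Suc j)"
    using allBX by simp_all
  have "\<forall>j. \<exists>BY. (\<forall>n. BY n \<in> sets P) \<and> (\<lambda>n. measure P (BY n)) \<longlonglongrightarrow> 0 \<and>
    (\<forall>n>0. \<forall>\<omega>\<in>space P - BY n. \<forall>g\<in>Fclass (1/2) (\<lambda>t. t).
      \<bar>integral\<^sup>L (emp_meas n (\<lambda>i. Y i \<omega>)) g - integral\<^sup>L \<nu> g\<bar> \<le> 1 / real (Suc j))"
  proof
    fix j
    have j: "0 < 1 / real (Suc j)" by simp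
    show "\<exists>BY. (\<forall>n. BY n \<in> sets P) \<and> (\<lambda>n. measure P (BY n)) \<longlonglongrightarrow> 0 \<and>
      (\<forall>n>0. \<forall>\<omega>\<in>space P - BY n. \<forall>g\<in>Fclass (1/2) (\<lambda>t. t).
        \<bar>integral\<^sup>L (emp_meas n (\<lambda>i. Y i \<omega>)) g - integral\<^sup>L \<nu> g\<bar> \<le> 1 / real (Suc j))"
      by (rule emp_meas_uniform_LLN[OF P Y_cpt Y_rv Y_iid j], rule exI, intro conjI allI impI ballI)
  qed
  from choice[OF this] obtain BY where allBY: "\<forall>j. (\<forall>n. BY j n \<in> sets P) \<and> (\<lambda>n. measure P (BY j n)) \<longlonglongrightarrow> 0 \<and>
    (\<forall>n>0. \<forall>\<omega>\<in>space P - BY j n. \<forall>g\<in>Fclass (1/2) (\<lambda>t. t).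
      \<bar>integral\<^sup>L (emp_meas n (\<lambda>i. Y i \<omega>)) g - integral\<^sup>L \<nu> g\<bar> \<le> 1 / real (Suc j))"
    by (rule exE)
  have BY: "\<And>j n. BY j n \<in> sets P" "\<And>j. (\<lambda>n. measure P (BY j n)) \<longlonglongrightarrow> 0"
    "\<And>j. \<forall>n>0. \<forall>\<omega>\<in>space P - BY j n. \<forall>g\<in>Fclass (1/2) (\<lambda>t. t).
      \<bar>integral\<^sup>L (emp_meas n (\<lambda>i. Y i \<omega>)) g - integral\<^sup>L \<nu> g\<bar> \<le> 1 / real (Suc j)"
    using allBY by simp_all

  \<comment> \<open>Two events of probability below one half do not cover the space. A common
    outcome yields deterministic samples that approximate both measures, from which duality for
    \<open>(\<mu>, \<nu>, c)\<close> is derived.\<close>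
  have approx: "\<forall>j. \<exists>n x y. 0 < n \<and>
      (\<forall>g\<in>Fclass (1/2) (\<lambda>t. t). \<bar>integral\<^sup>L (emp_meas n x) g - integral\<^sup>L \<mu> g\<bar> \<le> 1 / real (Suc j)) \<and>
      (\<forall>g\<in>Fclass (1/2) (\<lambda>t. t). \<bar>integral\<^sup>L (emp_meas n y) g - integral\<^sup>L \<nu> g\<bar> \<le> 1 / real (Suc j))"
  proof
    fix j
    have "\<forall>\<^sub>F n in sequentially. measure P (BX j n) < 1 / 2"
      using BX(2)[of j] by (rule order_tendstoD) simp
    moreover have "\<forall>\<^sub>F n in sequentially. measure P (BY j n) < 1 / 2"
      using BY(2)[of j] by (rule order_tendstoD) simp
    ultimately have "\<forall>\<^sub>F n in sequentially. 0 < n \<and> measure P (BX j n) < 1 / 2 \<and> measure P (BY j n) < 1 / 2"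
      using eventually_gt_at_top[of 0] by eventually_elim simp
    then obtain n where n: "0 < n" "measure P (BX j n) < 1 / 2" "measure P (BY j n) < 1 / 2"
      using eventually_happens'[OF sequentially_bot] by blast
    have "measure P (BX j n \<union> BY j n) < 1"
      using measure_Un_le[OF BX(1)[of j n] BY(1)[of j n]] n by linarith
    then have "BX j n \<union> BY j n \<noteq> space P" using P.prob_space by auto
    moreover have "BX j n \<union> BY j n \<subseteq> space P"
      using sets.sets_into_space[OF BX(1)[of j n]] sets.sets_into_space[OF BY(1)[of j n]] by blast
    ultimately obtain \<omega> where "\<omega> \<in> space P - BX j n" "\<omega> \<in> space P - BY j n" by blast
    note \<omega> = this
    show "\<exists>n x y. 0 < n \<and>
      (\<forall>g\<in>Fclass (1/2) (\<lambda>t. t). \<bar>integral\<^sup>L (emp_meas n x) g - integral\<^sup>L \<mu> g\<bar> \<le> 1 / real (Suc j)) \<and>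
      (\<forall>g\<in>Fclass (1/2) (\<lambda>t. t). \<bar>integral\<^sup>L (emp_meas n y) g - integral\<^sup>L \<nu> g\<bar> \<le> 1 / real (Suc j))"
      by (rule exI[of _ n], rule exI[of _ "\<lambda>i. X i \<omega>"], rule exI[of _ "\<lambda>i. Y i \<omega>"])
        (intro conjI n(1) bspec[OF mp[OF spec[OF BX(3)] n(1)] \<omega>(1)] bspec[OF mp[OF spec[OF BY(3)] n(1)] \<omega>(2)])
  qed
  \<comment> \<open>With the relaxed bound \<open>2 * C + 1\<close> and modulus \<open>2 * w\<close>
    the attained potential is directly a member of \<open>F\<close>.\<close>
  have C21: "\<forall>p. \<bar>c p\<bar> \<le> 2 * C + 1"
  proof
    fix p show "\<bar>c p\<bar> \<le> 2 * C + 1" using C[rule_format, of p] C0 by linarith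
  qed
  have c_2w: "\<forall>x x' y. \<bar>c (x, y) - c (x', y)\<bar> \<le> 2 * w (dist x x')"
  proof (intro allI)
    fix x x' y show "\<bar>c (x, y) - c (x', y)\<bar> \<le> 2 * w (dist x x')"
      using c_w[rule_format, of x y x'] wn[OF zero_le_dist, of x x'] by linarith
  qed
  obtain \<pi>0 f0 where d0: "\<pi>0 \<in> couplings \<mu> \<nu>" "f0 \<in> Fclass (2 * C + 1) (\<lambda>t. 2 * w t)"
    "integral\<^sup>L \<pi>0 c = integral\<^sup>L \<mu> (cctrans c f0) + integral\<^sup>L \<nu> (ctrans c f0)"
    by (rule duality_by_approximation[OF X_cpt Y_cpt c_cont C21 c_2w W0 mu nu approx])
  have dual: "\<exists>\<pi> f. \<pi> \<in> couplings \<mu> \<nu> \<and> f \<in> Fclass (2 * C + 1) (\<lambda>t. 2 * w t) \<and>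
      integral\<^sup>L \<pi> c = integral\<^sup>L \<mu> (cctrans c f) + integral\<^sup>L \<nu> (ctrans c f)"
    by (intro exI[of _ \<pi>0] exI[of _ f0] conjI d0)
  interpret ot: compact_ot_modulus \<mu> \<nu> c w C
    by (intro compact_ot_modulus.intro compact_ot.intro compact_ot_modulus_axioms.intro
        X_cpt Y_cpt c_cont W0 mu nu C dual w_mod c_w)
  have FF: "F = ot.F" unfolding F_def ot.F_def by (simp only: C_def)

  define r where "r k = rate (N k) (M k)" for k
  define Z where "Z k \<omega> = ((\<lambda>g. r k * (integral\<^sup>L (emp_meas (N k) (\<lambda>i. X i \<omega>)) g - integral\<^sup>L \<mu> g)),
    (\<lambda>h. r k * (integral\<^sup>L (emp_meas (M k) (\<lambda>j. Y j \<omega>)) h - integral\<^sup>L \<nu> h)),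
    (\<lambda>p. r k * (cnm (N k) (M k) \<omega> p - c p)))" for k \<omega>
  define L where "L q = ((\<lambda>g. sqrt lam * Gmu q g), (\<lambda>h. sqrt (1 - lam) * Gnu q h), Gc q)" for q
  define \<Delta> where "\<Delta> k \<omega> = r k * (OT (emp_meas (N k) (\<lambda>i. X i \<omega>)) (emp_meas (M k) (\<lambda>j. Y j \<omega>)) (cnm (N k) (M k) \<omega>)
           - OT \<mu> \<nu> c)" for k \<omega>
  have HJ: "HJ_conv P Z ot.dD ot.D Q L"
    using mp[OF spec[OF spec[OF A3]] adm] unfolding FF Z_def[abs_def] L_def[abs_def] r_def[abs_def] .
  have ZD: "Z k \<omega> \<in> ot.D" if "\<omega> \<in> space P" for k \<omega> using that by (rule HJ_conv_in(1)[OF HJ])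

  have rtop: "filterlim r at_top sequentially"
    unfolding r_def[abs_def] using adm lam(1) by (rule admissible_rate_at_top)
  have Ntop: "filterlim N sequentially sequentially" and Mtop: "filterlim M sequentially sequentially"
    using adm by (auto simp: admissible_def)
  have ev_pos: "\<forall>\<^sub>F k in sequentially. 0 < N k \<and> 0 < M k \<and> 0 < r k"
  proof -
    have "\<forall>\<^sub>F k in sequentially. 0 < r k" using rtop unfolding filterlim_at_top_dense by blast
    with eventually_compose_filterlim[OF eventually_gt_at_top[of 0] Ntop]
      eventually_compose_filterlim[OF eventually_gt_at_top[of 0] Mtop]
    show ?thesis by eventually_elim simp
  qed
  have ev_ge: "\<forall>\<^sub>F k in sequentially. u \<le> r k" for u using rtop by (simp add: filterlim_at_top)

  have samp: "ot_sample \<mu> \<nu> c w C (N k) (M k) (cnm (N k) (M k) \<omega>) (r k)"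
    if "0 < N k \<and> 0 < M k \<and> 0 < r k" "\<omega> \<in> space P" for k \<omega>
    using that cnm_cont by unfold_locales auto
  have Zs: "(ot_sample.a \<mu> (N k) (\<lambda>i. X i \<omega>) (r k), ot_sample.b \<nu> (M k) (\<lambda>j. Y j \<omega>) (r k),
      ot_sample.h c (cnm (N k) (M k) \<omega>) (r k)) = Z k \<omega>"
    if "0 < N k \<and> 0 < M k \<and> 0 < r k" "\<omega> \<in> space P" for k \<omega>
    unfolding Z_def
    by (simp only: prod.inject fun_eq_iff ot_sample.a_def[OF samp[OF that]] ot_sample.b_def[OF samp[OF that]]
        ot_sample.h_def[OF samp[OF that]] simp_thms)
  have Ks: "ot_sample.K \<mu> \<nu> c w C (N k) (M k) (\<lambda>i. X i \<omega>) (\<lambda>j. Y j \<omega>) (cnm (N k) (M k) \<omega>) (r k) = ot.dD (Z k \<omega>) ot.z0"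
    if "0 < N k \<and> 0 < M k \<and> 0 < r k" "\<omega> \<in> space P" for k \<omega>
    by (simp only: ot_sample.K_def[OF samp[OF that]] Zs[OF that])

  \<comment> \<open>Every realised triple lies in \<open>D0\<close> once sample sizes and rate are
    positive; closedness then places almost every limit there.\<close>
  have AE0: "AE q in Q. L q \<in> ot.D0"
  proof (rule AE_limit_in_closed[OF P Q HJ])
    show "ot.D0 \<noteq> {}" using ot.z0_D0 by blast
    show "ot.D0 \<subseteq> ot.D" by (auto simp: ot.D0_def)
    show "\<forall>\<^sub>F k in sequentially. \<forall>\<omega>\<in>space P. Z k \<omega> \<in> ot.D0"
      using ev_pos
    proof eventually_elim
      case (elim k)
      show ?case
      proof
        fix \<omega> assume \<omega>: "\<omega> \<in> space P"
        note s = samp[OF elim \<omega>]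
        let ?a = "ot_sample.a \<mu> (N k) (\<lambda>i. X i \<omega>) (r k)" and ?b = "ot_sample.b \<nu> (M k) (\<lambda>j. Y j \<omega>) (r k)"
          and ?h = "ot_sample.h c (cnm (N k) (M k) \<omega>) (r k)"
        have "(?a, ?b, ?h) \<in> ot.D" unfolding Zs[OF elim \<omega>] using \<omega> by (rule ZD)
        from ot_sample.sample_D0[OF s this] show "Z k \<omega> \<in> ot.D0" unfolding Zs[OF elim \<omega>] .
      qed
    qed
    show "x \<in> ot.D0" if "x \<in> ot.D" "\<And>e. 0 < e \<Longrightarrow> \<exists>y\<in>ot.D0. ot.dD x y < e" for x
      using that by (rule ot.D0_closed)
  qed (rule ot.dD_triangle ot.dD_sym ot.dD_refl ot.dD_nonneg; assumption)+

  \<comment> \<open>Weak convergence keeps the norm of \<open>Z k\<close> bounded in outer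
    probability, while \<open>r k\<close> diverges. The test function is the norm divided by
    \<open>j + 1\<close>, truncated at 1.\<close>
  have size: "(\<lambda>k. outer_prob P {\<omega> \<in> space P. ot.dD (Z k \<omega>) ot.z0 > \<eta> * r k}) \<longlonglongrightarrow> 0" if \<eta>: "0 < \<eta>" for \<eta>
  proof (rule LIMSEQ_I)
    fix e :: real assume e: "0 < e"
    define \<psi> where "\<psi> j z = min 1 (\<bar>ot.dD z ot.z0\<bar> / real (Suc j))" for j z
    have c0: "pm_cont ot.dD ot.D (\<lambda>z. ot.dD z ot.z0)"
      using ot.dD_z0_Lipschitz by (intro pm_cont_Lipschitz[of 1]) auto
    have c\<psi>: "pm_cont ot.dD ot.D (\<psi> j)" for j
      unfolding \<psi>_def by (rule pm_cont_compose[OF c0]) (intro continuous_intros; simp)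
    have \<psi>01: "0 \<le> \<psi> j z \<and> \<psi> j z \<le> 1" for j z by (simp add: \<psi>_def)
    have "(\<lambda>j. \<psi> j z) \<longlonglongrightarrow> 0" for z
    proof -
      have "(\<lambda>j. \<bar>ot.dD z ot.z0\<bar> / real (Suc j)) \<longlonglongrightarrow> 0" by (rule LIMSEQ_Suc[OF lim_const_over_n])
      then have "(\<lambda>j. min 1 (\<bar>ot.dD z ot.z0\<bar> / real (Suc j))) \<longlonglongrightarrow> min 1 0" by (intro tendsto_min tendsto_const)
      then show ?thesis by (simp add: \<psi>_def)
    qed
    then have AEl: "AE q in Q. (\<lambda>j. \<psi> j (L q)) \<longlonglongrightarrow> 0" by simp
    obtain j where "\<forall>\<^sub>F k in sequentially. outer_prob P {\<omega> \<in> space P. 1 \<le> \<psi> j (Z k \<omega>)} < e"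
      using HJ_conv_vanishing[of P Q Z ot.dD ot.D L \<psi> 1 e, OF P Q HJ c\<psi> \<psi>01 AEl _ e] by auto
    then have "\<forall>\<^sub>F k in sequentially. norm (outer_prob P {\<omega> \<in> space P. ot.dD (Z k \<omega>) ot.z0 > \<eta> * r k} - 0) < e"
      using ev_ge[of "real (Suc j) / \<eta>"]
    proof eventually_elim
      case (elim k)
      have "real (Suc j) \<le> \<eta> * r k" using elim(2) \<eta> by (simp add: divide_le_eq mult.commute)
      then have "outer_prob P {\<omega> \<in> space P. ot.dD (Z k \<omega>) ot.z0 > \<eta> * r k}
          \<le> outer_prob P {\<omega> \<in> space P. 1 \<le> \<psi> j (Z k \<omega>)}"
        by (intro P.outer_prob_mono) (auto simp: \<psi>_def le_divide_eq)
      then show ?case using elim(1) P.outer_prob_nonneg by simp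
    qed
    then show "\<exists>no. \<forall>k\<ge>no. norm (outer_prob P {\<omega> \<in> space P. ot.dD (Z k \<omega>) ot.z0 > \<eta> * r k} - 0) < e"
      by (simp add: eventually_sequentially)
  qed
  have nullX: "(\<lambda>k. outer_prob P (BX j (N k))) \<longlonglongrightarrow> 0" for j
    using BX(1) filterlim_compose[OF BX(2) Ntop] by (intro P.outer_prob_tendsto_0_sets)
  have nullY: "(\<lambda>k. outer_prob P (BY j (M k))) \<longlonglongrightarrow> 0" for j
    using BY(1) filterlim_compose[OF BY(2) Mtop] by (intro P.outer_prob_tendsto_0_sets)
  \<comment> \<open>The factor \<open>1 / (4 * (j + 1))\<close> matches the condition
    \<open>4 * K / r \<le> 1 / (j + 1)\<close> of the deterministic bounds.\<close>
  define Bad where "Bad j k = (BX j (N k) \<union> BY j (M k)) \<union> {\<omega> \<in> space P. ot.dD (Z k \<omega>) ot.z0 > (1 / (4 * real (Suc j))) * r k}" for j k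
  have nullBad: "(\<lambda>k. outer_prob P (Bad j k)) \<longlonglongrightarrow> 0" for j
    unfolding Bad_def by (intro P.outer_prob_tendsto_0_Un nullX nullY size) simp
  have good: "\<forall>g\<in>Fclass (1/2) (\<lambda>t. t). \<bar>integral\<^sup>L (emp_meas (N k) (\<lambda>i. X i \<omega>)) g - integral\<^sup>L \<mu> g\<bar> \<le> 1 / real (Suc j)"
    "\<forall>g\<in>Fclass (1/2) (\<lambda>t. t). \<bar>integral\<^sup>L (emp_meas (M k) (\<lambda>i. Y i \<omega>)) g - integral\<^sup>L \<nu> g\<bar> \<le> 1 / real (Suc j)"
    "4 * ot.dD (Z k \<omega>) ot.z0 / r k \<le> 1 / real (Suc j)"
    if pos: "0 < N k \<and> 0 < M k \<and> 0 < r k" and \<omega>: "\<omega> \<in> space P" "\<omega> \<notin> Bad j k" for k j \<omega>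
  proof -
    have nb: "\<omega> \<in> space P - BX j (N k)" "\<omega> \<in> space P - BY j (M k)"
      "ot.dD (Z k \<omega>) ot.z0 \<le> (1 / (4 * real (Suc j))) * r k"
      using \<omega> unfolding Bad_def by auto
    show "\<forall>g\<in>Fclass (1/2) (\<lambda>t. t). \<bar>integral\<^sup>L (emp_meas (N k) (\<lambda>i. X i \<omega>)) g - integral\<^sup>L \<mu> g\<bar> \<le> 1 / real (Suc j)"
      using bspec[OF mp[OF spec[OF BX(3)]] nb(1)] pos by simp
    show "\<forall>g\<in>Fclass (1/2) (\<lambda>t. t). \<bar>integral\<^sup>L (emp_meas (M k) (\<lambda>i. Y i \<omega>)) g - integral\<^sup>L \<nu> g\<bar> \<le> 1 / real (Suc j)"
      using bspec[OF mp[OF spec[OF BY(3)]] nb(2)] pos by simp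
    show "4 * ot.dD (Z k \<omega>) ot.z0 / r k \<le> 1 / real (Suc j)"
      using nb(3) pos by (simp add: field_simps)
  qed

  have lower: "(\<lambda>k. outer_prob P {\<omega> \<in> space P. \<Delta> k \<omega> < ot.lo j (Z k \<omega>) - \<epsilon>}) \<longlonglongrightarrow> 0" if \<epsilon>: "0 < \<epsilon>" for j \<epsilon>
  \<comment> \<open>Off \<open>Bad j k\<close> the deterministic bound holds exactly, so the
    violation is contained in \<open>Bad j k\<close> for every
    \<open>\<epsilon> > 0\<close>.\<close>
  proof (rule P.outer_prob_tendsto_0_mono[OF _ nullBad[of j]])
    show "\<forall>\<^sub>F k in sequentially. {\<omega> \<in> space P. \<Delta> k \<omega> < ot.lo j (Z k \<omega>) - \<epsilon>} \<inter> space P \<subseteq> Bad j k"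
      using ev_pos
    proof eventually_elim
      case (elim k)
      show ?case
      proof (rule subsetI, rule ccontr)
        fix \<omega> assume "\<omega> \<in> {\<omega> \<in> space P. \<Delta> k \<omega> < ot.lo j (Z k \<omega>) - \<epsilon>} \<inter> space P" and nb: "\<omega> \<notin> Bad j k"
        then have \<omega>: "\<omega> \<in> space P" and lt: "\<Delta> k \<omega> < ot.lo j (Z k \<omega>) - \<epsilon>" by auto
        note s = samp[OF elim \<omega>]
        let ?a = "ot_sample.a \<mu> (N k) (\<lambda>i. X i \<omega>) (r k)" and ?b = "ot_sample.b \<nu> (M k) (\<lambda>j. Y j \<omega>) (r k)"
          and ?h = "ot_sample.h c (cnm (N k) (M k) \<omega>) (r k)"
        have sZ: "(?a, ?b, ?h) \<in> ot.D" unfolding Zs[OF elim \<omega>] using \<omega> by (rule ZD)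
        have "ot.Ssup ?a ?b + ot.Inear j ?h \<le> \<Delta> k \<omega>"
          unfolding \<Delta>_def
          by (rule ot_sample.sample_lower[OF s sZ good(1,2)[OF elim \<omega> nb] good(3)[OF elim \<omega> nb, folded Ks[OF elim \<omega>]]])
        then have "ot.lo j (?a, ?b, ?h) \<le> \<Delta> k \<omega>" by (simp add: ot.lo_def)
        then show False using lt \<epsilon> unfolding Zs[OF elim \<omega>] by linarith
      qed
    qed
  qed

  have limit: "(\<lambda>q. ot.phi (L q)) = (\<lambda>q. (INF \<pi>\<in>opt_plans \<mu> \<nu> c. integral\<^sup>L \<pi> (Gc q)) +
           (SUP f\<in>Sc F \<mu> \<nu> c. sqrt lam * Gmu q (cctrans c f) + sqrt (1 - lam) * Gnu q (ctrans c f)))"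
    unfolding ot.phi_def L_def ot.Ipl_def ot.Ssup_def FF fst_conv snd_conv ..
  have lo_lim: "AE q in Q. (\<lambda>j. ot.lo j (L q)) \<longlonglongrightarrow> ot.phi (L q)"
    using AE0 by eventually_elim (rule ot.lo_tendsto)

  have "HJ_conv P \<Delta> dist UNIV Q (\<lambda>q. ot.phi (L q))"
    using B
  proof
    assume "\<exists>\<pi>. opt_plans \<mu> \<nu> c = {\<pi>}"
    then obtain \<pi> where \<pi>: "opt_plans \<mu> \<nu> c = {\<pi>}" ..
    show ?thesis
    proof (rule HJ_conv_sandwich[OF P Q HJ ot.pm_cont_phi ot.pm_cont_up_unique ot.pm_cont_lo _ lo_lim _ lower])
      show "AE q in Q. (\<lambda>j. ot.up_unique j (L q)) \<longlonglongrightarrow> ot.phi (L q)"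
        using AE0 by eventually_elim (rule ot.up_unique_tendsto[OF _ \<pi>])
      fix j and \<epsilon> :: real assume \<epsilon>: "0 < \<epsilon>"
      show "(\<lambda>k. outer_prob P {\<omega> \<in> space P. \<Delta> k \<omega> > ot.up_unique j (Z k \<omega>) + \<epsilon>}) \<longlonglongrightarrow> 0"
      proof (rule P.outer_prob_tendsto_0_mono[OF _ nullBad[of j]])
        show "\<forall>\<^sub>F k in sequentially. {\<omega> \<in> space P. \<Delta> k \<omega> > ot.up_unique j (Z k \<omega>) + \<epsilon>} \<inter> space P \<subseteq> Bad j k"
          using ev_pos ev_ge[of "real j"]
        proof eventually_elim
          case (elim k)
          show ?case
          proof (rule subsetI, rule ccontr)
            fix \<omega> assume "\<omega> \<in> {\<omega> \<in> space P. \<Delta> k \<omega> > ot.up_unique j (Z k \<omega>) + \<epsilon>} \<inter> space P" and nb: "\<omega> \<notin> Bad j k"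
            then have \<omega>: "\<omega> \<in> space P" and gt: "\<Delta> k \<omega> > ot.up_unique j (Z k \<omega>) + \<epsilon>" by auto
            note s = samp[OF elim(1) \<omega>]
            let ?a = "ot_sample.a \<mu> (N k) (\<lambda>i. X i \<omega>) (r k)" and ?b = "ot_sample.b \<nu> (M k) (\<lambda>j. Y j \<omega>) (r k)"
              and ?h = "ot_sample.h c (cnm (N k) (M k) \<omega>) (r k)"
            have sZ: "(?a, ?b, ?h) \<in> ot.D" unfolding Zs[OF elim(1) \<omega>] using \<omega> by (rule ZD)
            have "\<Delta> k \<omega> \<le> ot.Usup (real j) 0 0 ?a ?b - ot.Inear j (\<lambda>p. - ?h p)"
              unfolding \<Delta>_def
              by (rule ot_sample.sample_upper_unique[OF s sZ good(1,2)[OF elim(1) \<omega> nb]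
                    good(3)[OF elim(1) \<omega> nb, folded Ks[OF elim(1) \<omega>]] elim(2)])
            then have "\<Delta> k \<omega> \<le> ot.up_unique j (?a, ?b, ?h)" by (simp add: ot.up_unique_def)
            then show False using gt \<epsilon> unfolding Zs[OF elim(1) \<omega>] by linarith
          qed
        qed
      qed
    qed
  next
    define S1 where "S1 k \<omega> = (SUP f\<in>F. sqrt (real (N k)) *
              (integral\<^sup>L (emp_meas (N k) (\<lambda>i. X i \<omega>)) (\<lambda>x. cctrans (cnm (N k) (M k) \<omega>) f x - cctrans c f x)
               - integral\<^sup>L \<mu> (\<lambda>x. cctrans (cnm (N k) (M k) \<omega>) f x - cctrans c f x)))" for k \<omega>
    define S2 where "S2 k \<omega> = (SUP f\<in>F. sqrt (real (M k)) *
              (integral\<^sup>L (emp_meas (M k) (\<lambda>j. Y j \<omega>)) (\<lambda>y. ctrans (cnm (N k) (M k) \<omega>) f y - ctrans c f y)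
               - integral\<^sup>L \<nu> (\<lambda>y. ctrans (cnm (N k) (M k) \<omega>) f y - ctrans c f y)))" for k \<omega>
    assume "\<forall>N M. admissible N M lam \<longrightarrow>
          (\<forall>\<epsilon>>0. (\<lambda>k. outer_prob P {\<omega> \<in> space P. \<bar>SUP f\<in>F. sqrt (real (N k)) *
              (integral\<^sup>L (emp_meas (N k) (\<lambda>i. X i \<omega>)) (\<lambda>x. cctrans (cnm (N k) (M k) \<omega>) f x - cctrans c f x)
               - integral\<^sup>L \<mu> (\<lambda>x. cctrans (cnm (N k) (M k) \<omega>) f x - cctrans c f x))\<bar> > \<epsilon>}) \<longlonglongrightarrow> 0) \<and>
          (\<forall>\<epsilon>>0. (\<lambda>k. outer_prob P {\<omega> \<in> space P. \<bar>SUP f\<in>F. sqrt (real (M k)) *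
              (integral\<^sup>L (emp_meas (M k) (\<lambda>j. Y j \<omega>)) (\<lambda>y. ctrans (cnm (N k) (M k) \<omega>) f y - ctrans c f y)
               - integral\<^sup>L \<nu> (\<lambda>y. ctrans (cnm (N k) (M k) \<omega>) f y - ctrans c f y))\<bar> > \<epsilon>}) \<longlonglongrightarrow> 0)"
    from mp[OF spec[OF spec[OF this]] adm, folded S1_def S2_def]
    have S1: "(\<lambda>k. outer_prob P {\<omega> \<in> space P. \<bar>S1 k \<omega>\<bar> > \<epsilon>}) \<longlonglongrightarrow> 0"
      and S2: "(\<lambda>k. outer_prob P {\<omega> \<in> space P. \<bar>S2 k \<omega>\<bar> > \<epsilon>}) \<longlonglongrightarrow> 0" if "0 < \<epsilon>" for \<epsilon>
      using that by auto
    show ?thesis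
    proof (rule HJ_conv_sandwich[OF P Q HJ ot.pm_cont_phi ot.pm_cont_up_regular ot.pm_cont_lo _ lo_lim _ lower])
      show "AE q in Q. (\<lambda>j. ot.up_regular j (L q)) \<longlonglongrightarrow> ot.phi (L q)"
        using AE0 by eventually_elim (rule ot.up_regular_tendsto)
      fix j and \<epsilon> :: real assume \<epsilon>: "0 < \<epsilon>"
      \<comment> \<open>The scale of the oscillation in \<open>up_regular j\<close>. It stays fixed
        while \<open>k\<close> grows, so \<open>w \<delta>\<close> is a positive constant.\<close>
      define \<delta> where "\<delta> = 1 / real (Suc j)"
      have \<delta>: "0 < \<delta>" by (simp add: \<delta>_def)
      then have w\<delta>: "0 < w \<delta>" using w_pos by simp
      \<comment> \<open>The threshold \<open>w \<delta> / 4\<close> gives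
        \<open>2 * K < r * w \<delta>\<close> with a factor two to spare, the threshold 1 gives
        \<open>K \<le> r\<close>, and the two error terms receive \<open>\<epsilon> / 2\<close>
        each.\<close>
      define E where "E k = ({\<omega> \<in> space P. ot.dD (Z k \<omega>) ot.z0 > w \<delta> / 4 * r k} \<union> {\<omega> \<in> space P. ot.dD (Z k \<omega>) ot.z0 > 1 * r k})
        \<union> ({\<omega> \<in> space P. \<bar>S1 k \<omega>\<bar> > \<epsilon> / 2} \<union> {\<omega> \<in> space P. \<bar>S2 k \<omega>\<bar> > \<epsilon> / 2})" for k
      have nullE: "(\<lambda>k. outer_prob P (E k)) \<longlonglongrightarrow> 0"
        unfolding E_def using w\<delta> \<epsilon> by (intro P.outer_prob_tendsto_0_Un size S1 S2) auto
      show "(\<lambda>k. outer_prob P {\<omega> \<in> space P. \<Delta> k \<omega> > ot.up_regular j (Z k \<omega>) + \<epsilon>}) \<longlonglongrightarrow> 0"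
      proof (rule P.outer_prob_tendsto_0_mono[OF _ nullE])
        show "\<forall>\<^sub>F k in sequentially. {\<omega> \<in> space P. \<Delta> k \<omega> > ot.up_regular j (Z k \<omega>) + \<epsilon>} \<inter> space P \<subseteq> E k"
          using ev_pos ev_ge[of "real j"]
        proof eventually_elim
          case (elim k)
          show ?case
          proof (rule subsetI, rule ccontr)
            fix \<omega> assume "\<omega> \<in> {\<omega> \<in> space P. \<Delta> k \<omega> > ot.up_regular j (Z k \<omega>) + \<epsilon>} \<inter> space P" and nb: "\<omega> \<notin> E k"
            then have \<omega>: "\<omega> \<in> space P" and gt: "\<Delta> k \<omega> > ot.up_regular j (Z k \<omega>) + \<epsilon>" by auto
            have nE: "ot.dD (Z k \<omega>) ot.z0 \<le> w \<delta> / 4 * r k" "ot.dD (Z k \<omega>) ot.z0 \<le> r k"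
              "\<bar>S1 k \<omega>\<bar> \<le> \<epsilon> / 2" "\<bar>S2 k \<omega>\<bar> \<le> \<epsilon> / 2"
              using nb \<omega> unfolding E_def by auto
            note s = samp[OF elim(1) \<omega>]
            let ?a = "ot_sample.a \<mu> (N k) (\<lambda>i. X i \<omega>) (r k)" and ?b = "ot_sample.b \<nu> (M k) (\<lambda>j. Y j \<omega>) (r k)"
              and ?h = "ot_sample.h c (cnm (N k) (M k) \<omega>) (r k)"
            have sZ: "(?a, ?b, ?h) \<in> ot.D" unfolding Zs[OF elim(1) \<omega>] using \<omega> by (rule ZD)
            define K where "K = ot.dD (Z k \<omega>) ot.z0"
            have sK: "ot_sample.K \<mu> \<nu> c w C (N k) (M k) (\<lambda>i. X i \<omega>) (\<lambda>j. Y j \<omega>) (cnm (N k) (M k) \<omega>) (r k) = K"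
              unfolding K_def by (rule Ks[OF elim(1) \<omega>])
            have "0 < r k * w \<delta>" using w\<delta> elim(1) by simp
            moreover have "w \<delta> / 4 * r k = (r k * w \<delta>) / 4" by simp
            ultimately have K1: "2 * K < r k * w \<delta>" using nE(1) unfolding K_def by linarith
            have K2: "K \<le> r k" using nE(2) unfolding K_def .
            define E1 where "E1 f = integral\<^sup>L (emp_meas (N k) (\<lambda>i. X i \<omega>)) (\<lambda>x. cctrans (cnm (N k) (M k) \<omega>) f x - cctrans c f x)
               - integral\<^sup>L \<mu> (\<lambda>x. cctrans (cnm (N k) (M k) \<omega>) f x - cctrans c f x)" for f
            define E2 where "E2 f = integral\<^sup>L (emp_meas (M k) (\<lambda>j. Y j \<omega>)) (\<lambda>y. ctrans (cnm (N k) (M k) \<omega>) f y - ctrans c f y)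
               - integral\<^sup>L \<nu> (\<lambda>y. ctrans (cnm (N k) (M k) \<omega>) f y - ctrans c f y)" for f
            obtain f where f: "f \<in> ot.F" and le: "\<Delta> k \<omega> \<le> ot.Usup (real j) (ot.Ipl ?h) (3 * K) ?a ?b + 4 * osc \<delta> ?h
                + r k * E1 f + r k * E2 f"
              unfolding \<Delta>_def E1_def E2_def
              by (rule ot_sample.sample_upper_regular[OF s sZ \<delta> K1[folded sK] K2[folded sK] elim(2), unfolded sK])
            have rN: "r k \<le> sqrt (real (N k))" and rM: "r k \<le> sqrt (real (M k))"
              unfolding r_def by (rule rate_le_sqrt)+
            have "r k * E1 f \<le> \<bar>S1 k \<omega>\<bar>"
              unfolding S1_def E1_def FF by (rule ot_sample.error_le_SUP(1)[OF s f rN])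
            moreover have "r k * E2 f \<le> \<bar>S2 k \<omega>\<bar>"
              unfolding S2_def E2_def FF by (rule ot_sample.error_le_SUP(2)[OF s f rM])
            moreover have "ot.up_regular j (Z k \<omega>) = ot.Usup (real j) (ot.Ipl ?h) (3 * K) ?a ?b + 4 * osc \<delta> ?h"
              unfolding K_def Zs[OF elim(1) \<omega>, symmetric] ot.up_regular_def \<delta>_def by simp
            ultimately show False using le gt nE(3,4) by linarith
          qed
        qed
      qed
    qed
  qed
  then show "HJ_conv P
      (\<lambda>k \<omega>. rate (N k) (M k) *
          (OT (emp_meas (N k) (\<lambda>i. X i \<omega>)) (emp_meas (M k) (\<lambda>j. Y j \<omega>)) (cnm (N k) (M k) \<omega>)
           - OT \<mu> \<nu> c))
      dist UNIV Q
      (\<lambda>q. (INF \<pi>\<in>opt_plans \<mu> \<nu> c. integral\<^sup>L \<pi> (Gc q)) +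
           (SUP f\<in>Sc F \<mu> \<nu> c. sqrt lam * Gmu q (cctrans c f) + sqrt (1 - lam) * Gnu q (ctrans c f)))"
    unfolding limit \<Delta>_def[abs_def] r_def .
qed

end
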